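(* Let $N_0,\dots,N_d$ be nonnegative integers with $\sum_jN_j=n$, $p_j=N_j/n$, and $p_{\min}=\min_{0\le j\le d}p_j$. Let $\pi^d$ be the marginal distribution of $(\theta_1,\dots,\theta_d)$ when $(\theta_0,\dots,\theta_d)\sim\mathrm{Dir}(N_0+1,\dots,N_d+1)$, and let $\hat\gamma^d$ be its Laplace approximation. Suppose $p_{\min}>0$ and $d^2/(np_{\min})$ is smaller than a certain small absolute constant. Then, with $L_{\mathrm{TV}}$, $R_{\mathrm{TV}}$ and $\bar\epsilon_3$ as in the context, $$0\le L_{\mathrm{TV}}\le\bar\epsilon_3\le\Big(\frac2n\sum_{j=0}^dp_j^{-1}\Big)^{1/2}\le2\sqrt{\frac{d}{np_{\min}}},$$ $$|R_{\mathrm{TV}}|=\big|\mathrm{TV}(\pi^d,\hat\gamma^d)-L_{\mathrm{TV}}\big|\lesssim\frac{d^2}{np_{\min}}+\tau,$$ where $\tau=d\exp\big(-C\sqrt d\,(np_{\min})^{1/4}\big)$.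
   Context: Let $\Theta^d=\{(\theta_1,\dots,\theta_d):0<\theta_1+\dots+\theta_d<1,\ 0<\theta_i<1\ \forall i\}$ and $v^d(\theta^d)=-p_0\log\big(1-\sum_{j=1}^d\theta_j\big)-\sum_{j=1}^dp_j\log\theta_j$ on $\Theta^d$. When all $N_j>0$, $\pi^d\propto e^{-nv^d}$ on $\Theta^d$, $v^d$ is strictly convex with unique minimizer $p^d=(p_1,\dots,p_d)$, and the Laplace approximation is $\hat\gamma^d=\mathcal N(p^d,H_V^{-1})=\mathcal N\big(p^d,n^{-1}[\mathrm{diag}(p^d)-p^d(p^d)^\top]\big)$, with $V=nv^d$, $H_V=\nabla^2V(p^d)$. $S(\theta^d)=-\frac16\langle\nabla^3V(p^d),(\theta^d-p^d)^{\otimes3}\rangle$, $L_{\mathrm{TV}}=\frac12\int|S|\,d\hat\gamma^d$, $R_{\mathrm{TV}}=\mathrm{TV}(\pi^d,\hat\gamma^d)-L_{\mathrm{TV}}$. With $W(x)=V(p^d+H_V^{-1/2}x)$, $\bar\epsilon_3\ge0$ is defined by $\bar\epsilon_3^2=\frac16\|\nabla^3W(0)\|_F^2+\frac14\|\langle\nabla^3W(0),I_d\rangle\|^2$, where $\|\cdot\|_F$ is the Frobenius norm and $\langle T,A\rangle_i=\sum_{j,k}T_{ijk}A_{jk}$. $\mathrm{TV}(\mu,\nu)=\sup_A|\mu(A)-\nu(A)|$ over Borel sets. $C>0$ is an absolute constant, and $a\lesssim b$ means $a\le C'b$ for an absolute constant $C'>0$. *)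

theory Defs
  imports
    "HOL-Probability.Probability"
    "Jordan_Normal_Form.Determinant"
    "Jordan_Normal_Form.Gauss_Jordan_Elimination"
begin

text \<open>
  The dimension \<open>d\<close> is a natural number over which one quantifies inside the formula, so a point of
  $\mathbb R^d$ is a function \<open>nat \<Rightarrow> real\<close> of which only the values on \<open>{..<d}\<close> matter.
  The coordinate with index \<open>i < d\<close> is $\theta_{i+1}$; the categories
  of the Dirichlet distribution are numbered \<open>0, \<dots>, d\<close>.
\<close>

abbreviation lebesgue_d :: "nat \<Rightarrow> (nat \<Rightarrow> real) measure" where
  "lebesgue_d d \<equiv> Pi\<^sub>M {..<d} (\<lambda>_. lborel)"

definition tv_dist :: "'a measure \<Rightarrow> 'a measure \<Rightarrow> real" where
  "tv_dist M N = (SUP A\<in>sets M. \<bar>measure M A - measure N A\<bar>)"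


section \<open>Derivatives and matrices\<close>

definition partial_deriv :: "nat \<Rightarrow> ((nat \<Rightarrow> real) \<Rightarrow> real) \<Rightarrow> (nat \<Rightarrow> real) \<Rightarrow> real" where
  "partial_deriv i f x = deriv (\<lambda>t. f (x(i := t))) (x i)"

definition hessian :: "nat \<Rightarrow> ((nat \<Rightarrow> real) \<Rightarrow> real) \<Rightarrow> (nat \<Rightarrow> real) \<Rightarrow> real mat" where
  "hessian d f x = mat d d (\<lambda>(i, j). partial_deriv i (partial_deriv j f) x)"

definition third_deriv ::
    "((nat \<Rightarrow> real) \<Rightarrow> real) \<Rightarrow> (nat \<Rightarrow> real) \<Rightarrow> nat \<Rightarrow> nat \<Rightarrow> nat \<Rightarrow> real" where
  "third_deriv f x i j k = partial_deriv i (partial_deriv j (partial_deriv k f)) x"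

definition minv :: "real mat \<Rightarrow> real mat" where
  "minv A = the (mat_inverse A)"

definition sym_psd :: "real mat \<Rightarrow> bool" where
  "sym_psd A \<longleftrightarrow> square_mat A \<and> transpose_mat A = A \<and>
     (\<forall>x \<in> carrier_vec (dim_row A). 0 \<le> scalar_prod x (mult_mat_vec A x))"

text \<open>The unique symmetric positive semidefinite square root; meaningful if \<open>sym_psd A\<close>.\<close>

definition mat_sqrt :: "real mat \<Rightarrow> real mat" where
  "mat_sqrt A = (THE B. sym_psd B \<and> dim_row B = dim_row A \<and> B * B = A)"

text \<open>The normal distribution with mean \<open>m\<close> and nonsingular covariance matrix \<open>\<Sigma>\<close>.\<close>

definition normal_d :: "nat \<Rightarrow> (nat \<Rightarrow> real) \<Rightarrow> real mat \<Rightarrow> (nat \<Rightarrow> real) measure" where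
  "normal_d d m \<Sigma> = density (lebesgue_d d) (\<lambda>x. ennreal
     (exp (- (\<Sum>i<d. \<Sum>j<d. minv \<Sigma> $$ (i, j) * (x i - m i) * (x j - m j)) / 2)
       / sqrt ((2 * pi) ^ d * Determinant.det \<Sigma>)))"


section \<open>The Dirichlet distribution\<close>

definition Theta :: "nat \<Rightarrow> (nat \<Rightarrow> real) set" where
  "Theta d = {\<theta>. 0 < (\<Sum>i<d. \<theta> i) \<and> (\<Sum>i<d. \<theta> i) < 1 \<and> (\<forall>i<d. 0 < \<theta> i \<and> \<theta> i < 1)}"

definition simplex_point :: "nat \<Rightarrow> (nat \<Rightarrow> real) \<Rightarrow> (nat \<Rightarrow> real)" where
  "simplex_point d \<theta> = (\<lambda>j\<in>{..d}. case j of 0 \<Rightarrow> 1 - (\<Sum>i<d. \<theta> i) | Suc i \<Rightarrow> \<theta> i)"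

definition dirichlet_kernel :: "nat \<Rightarrow> (nat \<Rightarrow> real) \<Rightarrow> (nat \<Rightarrow> real) \<Rightarrow> real" where
  "dirichlet_kernel d \<alpha> \<theta> =
     indicator (Theta d) \<theta> * (\<Prod>j\<le>d. simplex_point d \<theta> j powr (\<alpha> j - 1))"

text \<open>
  \<open>Dir(\<alpha>\<^sub>0, \<dots>, \<alpha>\<^sub>d)\<close> as a distribution on $\mathbb R^{d+1}$. It is carried by the simplex, and its
  density $\propto \prod_j \theta_j^{\alpha_j - 1}$ refers to Lebesgue measure in the last
  \<open>d\<close> coordinates, hence the push-forward under \<open>simplex_point\<close>.
\<close>

definition dirichlet :: "nat \<Rightarrow> (nat \<Rightarrow> real) \<Rightarrow> (nat \<Rightarrow> real) measure" where
  "dirichlet d \<alpha> = distr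
     (density (lebesgue_d d) (\<lambda>\<theta>. ennreal
        (dirichlet_kernel d \<alpha> \<theta> / (\<integral>\<eta>. dirichlet_kernel d \<alpha> \<eta> \<partial>lebesgue_d d))))
     (Pi\<^sub>M {..d} (\<lambda>_. lborel)) (simplex_point d)"

definition post :: "nat \<Rightarrow> (nat \<Rightarrow> nat) \<Rightarrow> (nat \<Rightarrow> real) measure" where
  "post d N = distr (dirichlet d (\<lambda>j. real (N j) + 1)) (lebesgue_d d) (\<lambda>\<theta>. \<lambda>i\<in>{..<d}. \<theta> (Suc i))"


section \<open>Laplace approximation and its total variation error\<close>

text \<open>Here \<open>p\<close> is the vector $(p_0,\dots,p_d)$, and \<open>p_tail p\<close> is $p^d = (p_1,\dots,p_d)$.\<close>

definition p_tail :: "(nat \<Rightarrow> real) \<Rightarrow> (nat \<Rightarrow> real)" where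
  "p_tail p = (\<lambda>i. p (Suc i))"

definition v_fun :: "nat \<Rightarrow> (nat \<Rightarrow> real) \<Rightarrow> (nat \<Rightarrow> real) \<Rightarrow> real" where
  "v_fun d p \<theta> = - p 0 * ln (1 - (\<Sum>i<d. \<theta> i)) - (\<Sum>i<d. p_tail p i * ln (\<theta> i))"

definition V_fun :: "nat \<Rightarrow> nat \<Rightarrow> (nat \<Rightarrow> real) \<Rightarrow> (nat \<Rightarrow> real) \<Rightarrow> real" where
  "V_fun d n p \<theta> = real n * v_fun d p \<theta>"

definition H_V :: "nat \<Rightarrow> nat \<Rightarrow> (nat \<Rightarrow> real) \<Rightarrow> real mat" where
  "H_V d n p = hessian d (V_fun d n p) (p_tail p)"

definition laplace_approx :: "nat \<Rightarrow> nat \<Rightarrow> (nat \<Rightarrow> real) \<Rightarrow> (nat \<Rightarrow> real) measure" where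
  "laplace_approx d n p = normal_d d (p_tail p) (minv (H_V d n p))"

definition S_fun :: "nat \<Rightarrow> nat \<Rightarrow> (nat \<Rightarrow> real) \<Rightarrow> (nat \<Rightarrow> real) \<Rightarrow> real" where
  "S_fun d n p \<theta> = - (1 / 6) * (\<Sum>i<d. \<Sum>j<d. \<Sum>k<d. third_deriv (V_fun d n p) (p_tail p) i j k
     * (\<theta> i - p_tail p i) * (\<theta> j - p_tail p j) * (\<theta> k - p_tail p k))"

definition L_TV :: "nat \<Rightarrow> nat \<Rightarrow> (nat \<Rightarrow> real) \<Rightarrow> real" where
  "L_TV d n p = 1 / 2 * (\<integral>\<theta>. \<bar>S_fun d n p \<theta>\<bar> \<partial>laplace_approx d n p)"

text \<open>$W(x) = V(p^d + H_V^{-1/2} x)$\<close>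

definition W_fun :: "nat \<Rightarrow> nat \<Rightarrow> (nat \<Rightarrow> real) \<Rightarrow> (nat \<Rightarrow> real) \<Rightarrow> real" where
  "W_fun d n p x = V_fun d n p
     (\<lambda>i. p_tail p i + (\<Sum>k<d. mat_sqrt (minv (H_V d n p)) $$ (i, k) * x k))"

definition eps3 :: "nat \<Rightarrow> nat \<Rightarrow> (nat \<Rightarrow> real) \<Rightarrow> real" where
  "eps3 d n p = (let T = third_deriv (W_fun d n p) (\<lambda>_. 0) in
     sqrt (1 / 6 * (\<Sum>i<d. \<Sum>j<d. \<Sum>k<d. (T i j k)\<^sup>2)
         + 1 / 4 * (\<Sum>i<d. (\<Sum>j<d. \<Sum>k<d. T i j k * 1\<^sub>m d $$ (j, k))\<^sup>2)))"

end

theory Submission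
  imports Defs
begin

text \<open>
  Let $z_l$, $l = 0, \dots, d$, be the centred coordinates of the simplex, so that $\sum_l z_l = 0$, and
  $u_l = z_l / p_l$. Up to constants, the log-ratio of the Dirichlet density to the Gaussian density is
  $\psi = n \sum_l p_l h(u_l)$ with $h(u) = \log(1+u) - u + u^2/2$, and the cubic Taylor term of $h$
  gives $S = \frac n3 \sum_l p_l u_l^3$. On the set where all $u_l \ge -1/2$ one has $|h(u)| \le \frac23 |u|^3$ and
  $|h(u) - u^3/3| \le u^4/2$. The elementary inequality $|e^\psi - 1 - \psi| \le \frac12 \psi^2 (1 + e^\psi)$
  bounds the first-order error by second moments of $\psi$ under \<^emph>\<open>both\<close> measures, so no exponential
  moments are needed; by Cauchy--Schwarz these are at most $(d+1) \sum_l (n p_l)^2 E\, u_l^6$, up to a constant,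
  which is $O(d^2 / (n p_{\min}))$. The complement of that set is
  controlled by Chebyshev's inequality with second moments. The sixth moments come from Stein's identity
  for the Beta marginals of the Dirichlet distribution and from the moment generating function of the Gaussian.

  For the bound on $L_{TV}$, Isserlis' formula for $E\, z_l^3 z_m^3$ shows that $\bar\epsilon_3^2 = E\, S^2$.
\<close>

section \<open>Derivatives of sums of logarithms of affine forms\<close>

text \<open>The coordinates z_0, ..., z_d are redundant, but they put category 0 on the same footing
  as the others: the potential is a sum of one-variable logarithms, the Gaussian exponent is the
  Pearson chi-square form, and the covariances have one formula for all pairs of indices. Derivative
  tensors become sums over l of rank-one tensors, so every contraction is a double sum of
  covariances.

  Two obstacles shape the work. \<open>mat_sqrt\<close> is a definite description, so existence and
  uniqueness of the root come before any statement about it; afterwards only its symmetry and its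
  square enter. And the Dirichlet mean (N_l + 1) / (n + d + 1) is not p_l: smallness of d^2 / (n
  p_min) yields (d + 1)^2 <= n, which keeps this bias on the scale sqrt(p_l / n) of the
  fluctuations.

  The Dirichlet integral is never evaluated. Ratios of such integrals come from integration by
  parts, and the comparison with the Laplace approximation falls out of the error estimate. The
  region away from the mode costs a multiple of d / (n p_min), which is absorbed in d^2 / (n
  p_min).\<close>

definition affine_form :: "nat \<Rightarrow> (nat \<Rightarrow> real) \<Rightarrow> (nat \<Rightarrow> nat \<Rightarrow> real) \<Rightarrow> nat \<Rightarrow> (nat \<Rightarrow> real) \<Rightarrow> real" where
  "affine_form d a b l x = a l + (\<Sum>k<d. b l k * x k)"

lemma affine_form_upd:
  assumes "j < d"
  shows "affine_form d a b l (x(j := t)) = affine_form d a b l x + b l j * (t - x j)"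
proof -
  have "(\<Sum>k<d. b l k * (x(j := t)) k) = b l j * t + (\<Sum>k\<in>{..<d}-{j}. b l k * x k)"
    using assms by (subst sum.remove[of _ j]) (auto intro!: sum.cong)
  moreover have "(\<Sum>k<d. b l k * x k) = b l j * x j + (\<Sum>k\<in>{..<d}-{j}. b l k * x k)"
    using assms by (subst sum.remove[of _ j]) auto
  ultimately show ?thesis
    by (simp add: affine_form_def algebra_simps)
qed

text \<open>Formulas for derivatives of the logarithms hold only where all affine forms are
  positive. To differentiate such a formula again it must hold near the point; positivity of
  finitely many affine forms is an open condition along a coordinate line.\<close>

lemma partial_deriv_cong_pos:
  assumes "\<And>y. (\<And>l. l \<le> m \<Longrightarrow> 0 < affine_form d a b l y) \<Longrightarrow> f y = g y"
    and pos: "\<And>l. l \<le> m \<Longrightarrow> 0 < affine_form d a b l x" and "j < d"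
  shows "partial_deriv j f x = partial_deriv j g x"
proof -
  have "\<forall>\<^sub>F t in nhds (x j). \<forall>l\<in>{..m}. 0 < affine_form d a b l (x(j := t))"
  proof (intro eventually_ball_finite ballI)
    fix l assume "l \<in> {..m}"
    then have "0 < affine_form d a b l (x(j := x j))"
      using pos by simp
    moreover have "((\<lambda>t. affine_form d a b l (x(j := t))) \<longlongrightarrow> affine_form d a b l (x(j := x j))) (nhds (x j))"
      unfolding affine_form_upd[OF \<open>j < d\<close>] by (intro tendsto_intros) (auto simp: filterlim_ident)
    ultimately show "\<forall>\<^sub>F t in nhds (x j). 0 < affine_form d a b l (x(j := t))"
      by (rule order_tendstoD(1)[rotated])
  qed auto
  then have "\<forall>\<^sub>F t in nhds (x j). f (x(j := t)) = g (x(j := t))"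
    by eventually_elim (use assms(1) in auto)
  then show ?thesis
    unfolding partial_deriv_def by (rule deriv_cong_ev) simp
qed

lemma partial_deriv_sum_ln:
  assumes pos: "\<And>l. l \<le> m \<Longrightarrow> 0 < affine_form d a b l x" and "j < d"
  shows "partial_deriv j (\<lambda>x. - (\<Sum>l\<le>m. w l * ln (affine_form d a b l x))) x
    = - (\<Sum>l\<le>m. w l * b l j / affine_form d a b l x)"
  unfolding partial_deriv_def
  by (rule DERIV_imp_deriv, unfold affine_form_upd[OF \<open>j < d\<close>])
     (use pos in \<open>auto intro!: derivative_eq_intros sum.cong simp: less_imp_neq[THEN not_sym]\<close>)

text \<open>One derivative turns logarithms into inverses of affine forms, so this rule with
  \<open>r\<close> = 1 and \<open>r\<close> = 2 yields the second and third derivatives.\<close>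

lemma partial_deriv_sum_inverse_power:
  assumes pos: "\<And>l. l \<le> m \<Longrightarrow> 0 < affine_form d a b l x" and "j < d"
  shows "partial_deriv j (\<lambda>x. (\<Sum>l\<le>m. c l * inverse (affine_form d a b l x) ^ r)) x
    = (\<Sum>l\<le>m. - real r * c l * b l j * inverse (affine_form d a b l x) ^ Suc r)"
  unfolding partial_deriv_def
proof (rule DERIV_imp_deriv, unfold affine_form_upd[OF \<open>j < d\<close>], rule DERIV_sum)
  fix l assume "l \<in> {..m}"
  let ?L = "affine_form d a b l x"
  have "((\<lambda>t. inverse (?L + b l j * (t - x j))) has_real_derivative
      - (inverse ?L * b l j * inverse ?L)) (at (x j))"
    using pos[of l] \<open>l \<in> {..m}\<close> by (auto intro!: derivative_eq_intros)
  from DERIV_cmult[OF DERIV_power[OF this, of r], of "c l"]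
  show "((\<lambda>t. c l * inverse (?L + b l j * (t - x j)) ^ r) has_real_derivative
      - real r * c l * b l j * inverse ?L ^ Suc r) (at (x j))"
    by (cases r) (simp_all add: algebra_simps)
qed

lemma partial_deriv2_sum_ln:
  assumes pos: "\<And>l. l \<le> m \<Longrightarrow> 0 < affine_form d a b l x" and "j < d" "k < d"
  shows "partial_deriv j (partial_deriv k (\<lambda>x. - (\<Sum>l\<le>m. w l * ln (affine_form d a b l x)))) x
    = (\<Sum>l\<le>m. w l * b l k * b l j / affine_form d a b l x ^ 2)"
proof -
  have "partial_deriv j (partial_deriv k (\<lambda>x. - (\<Sum>l\<le>m. w l * ln (affine_form d a b l x)))) x
    = partial_deriv j (\<lambda>x. (\<Sum>l\<le>m. - (w l * b l k) * inverse (affine_form d a b l x) ^ 1)) x"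
    by (rule partial_deriv_cong_pos[OF _ pos \<open>j < d\<close>])
       (simp_all add: partial_deriv_sum_ln \<open>k < d\<close> sum_negf divide_inverse)
  also have "\<dots> = (\<Sum>l\<le>m. w l * b l k * b l j / affine_form d a b l x ^ 2)"
    by (subst partial_deriv_sum_inverse_power[OF pos \<open>j < d\<close>])
       (auto simp: power2_eq_square field_simps)
  finally show ?thesis .
qed

lemma third_deriv_sum_ln:
  assumes pos: "\<And>l. l \<le> m \<Longrightarrow> 0 < affine_form d a b l x" and "i < d" "j < d" "k < d"
  shows "third_deriv (\<lambda>x. - (\<Sum>l\<le>m. w l * ln (affine_form d a b l x))) x i j k
    = - 2 * (\<Sum>l\<le>m. w l * b l i * b l j * b l k / affine_form d a b l x ^ 3)"
proof -
  have "third_deriv (\<lambda>x. - (\<Sum>l\<le>m. w l * ln (affine_form d a b l x))) x i j k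
    = partial_deriv i (\<lambda>x. (\<Sum>l\<le>m. (w l * b l k * b l j) * inverse (affine_form d a b l x) ^ 2)) x"
    unfolding third_deriv_def
    by (rule partial_deriv_cong_pos[OF _ pos \<open>i < d\<close>])
       (simp_all add: partial_deriv2_sum_ln \<open>j < d\<close> \<open>k < d\<close> divide_inverse power_inverse)
  also have "\<dots> = - 2 * (\<Sum>l\<le>m. w l * b l i * b l j * b l k / affine_form d a b l x ^ 3)"
    by (subst partial_deriv_sum_inverse_power[OF pos \<open>i < d\<close>])
       (auto simp: power2_eq_square power3_eq_cube field_simps sum_distrib_left sum_negf)
  finally show ?thesis .
qed

section \<open>Matrices: inverse, determinant and square root\<close>

unbundle no vec_syntax

lemma index_mult_mat_sum:
  assumes "A \<in> carrier_mat a b" "B \<in> carrier_mat b c" "i < a" "j < c"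
  shows "(A * B) $$ (i, j) = (\<Sum>k<b. A $$ (i, k) * B $$ (k, j))"
  using assms by (auto simp: scalar_prod_def atLeast0LessThan intro!: sum.cong)

lemma minv_eqI:
  assumes A: "A \<in> carrier_mat d d" and B: "B \<in> carrier_mat d d"
    and AB: "A * B = 1\<^sub>m d" and BA: "B * A = 1\<^sub>m d"
  shows "minv A = B"
proof -
  have "A \<in> Units (ring_mat TYPE(real) d ())"
    using assms by (auto simp: Units_def ring_mat_simps)
  then obtain B' where B': "mat_inverse A = Some B'"
    using mat_inverse(1)[OF A] by fastforce
  have "B' * A = 1\<^sub>m d" and B'c: "B' \<in> carrier_mat d d"
    using mat_inverse(2)[OF A B'] by auto
  have "B' = B' * (A * B)"
    using B'c AB by simp
  also have "\<dots> = B"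
    using \<open>B' * A = 1\<^sub>m d\<close> A B B'c assoc_mult_mat[OF B'c A B] by simp
  finally show ?thesis
    using B' by (simp add: minv_def)
qed

text \<open>The bordered matrix with blocks \<open>P\<close>, \<open>c\<close>, \<open>r\<close> and
  1 is factored in two ways: eliminating with the corner 1 leaves P - c r, the matrix in question,
  while eliminating with \<open>P\<close> leaves the corner \<open>s\<close>. The second elimination
  uses the all-ones row \<open>e\<close>, because e P = r, and so avoids inverting
  \<open>P\<close>.\<close>

lemma det_diag_minus_rank_one:
  fixes p :: "nat \<Rightarrow> real"
  shows "Determinant.det (mat d d (\<lambda>(i, j). (if i = j then p i else 0) - p i * p j))
    = (\<Prod>i<d. p i) * (1 - (\<Sum>i<d. p i))" (is "Determinant.det ?A = _")
proof -
  define P where "P = mat d d (\<lambda>(i, j). if i = j then p i else 0)"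
  define c where "c = mat d 1 (\<lambda>(i, j). p i)"
  define r where "r = mat 1 d (\<lambda>(i, j). p j)"
  define e :: "real mat" where "e = mat 1 d (\<lambda>_. 1)"
  define s where "s = mat 1 1 (\<lambda>_. 1 - (\<Sum>i<d. p i))"
  have carr[simp]: "P \<in> carrier_mat d d" "c \<in> carrier_mat d 1" "r \<in> carrier_mat 1 d"
    "e \<in> carrier_mat 1 d" "s \<in> carrier_mat 1 1" "?A \<in> carrier_mat d d"
    by (auto simp: P_def c_def r_def e_def s_def)
  have A: "?A + c * r = P"
    by (rule eq_matI) (auto simp: P_def c_def r_def scalar_prod_def)
  have eP: "e * P = r"
    by (rule eq_matI) (auto simp: P_def e_def r_def scalar_prod_def if_distrib sum.delta cong: if_cong)
  have ec: "e * c + s = 1\<^sub>m 1"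
    by (rule eq_matI) (auto simp: e_def c_def s_def scalar_prod_def atLeast0LessThan)
  have "four_block_mat ?A c (0\<^sub>m 1 d) (1\<^sub>m 1) * four_block_mat (1\<^sub>m d) (0\<^sub>m d 1) r (1\<^sub>m 1)
      = four_block_mat P c r (1\<^sub>m 1)"
    by (subst mult_four_block_mat[of _ d d _ 1 _ 1 _ _ d _ 1]) (auto simp: A right_mult_one_mat[of _ d 1] left_mult_one_mat[of _ 1 d] left_add_zero_mat[of _ d 1]
        left_add_zero_mat[of _ 1 d] simp del: One_nat_def)
  moreover have "four_block_mat (1\<^sub>m d) (0\<^sub>m d 1) e (1\<^sub>m 1) * four_block_mat P c (0\<^sub>m 1 d) s
      = four_block_mat P c r (1\<^sub>m 1)"
    by (subst mult_four_block_mat[of _ d d _ 1 _ 1 _ _ d _ 1]) (auto simp: eP ec left_mult_one_mat[of _ d d] left_mult_one_mat[of _ d 1] left_mult_one_mat[of _ 1 1] right_add_zero_mat[of _ d 1] right_add_zero_mat[of _ d d] left_mult_zero_mat[of s 1 1] right_add_zero_mat[of _ 1 d] simp del: One_nat_def)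
  ultimately have "Determinant.det (four_block_mat ?A c (0\<^sub>m 1 d) (1\<^sub>m 1))
        * Determinant.det (four_block_mat (1\<^sub>m d) (0\<^sub>m d 1) r (1\<^sub>m 1))
      = Determinant.det (four_block_mat (1\<^sub>m d) (0\<^sub>m d 1) e (1\<^sub>m 1))
        * Determinant.det (four_block_mat P c (0\<^sub>m 1 d) s)"
    by (subst (1 2) det_mult[of _ "d + 1", symmetric]) (auto simp del: One_nat_def)
  moreover have "Determinant.det (four_block_mat ?A c (0\<^sub>m 1 d) (1\<^sub>m 1)) = Determinant.det ?A"
    by (subst det_four_block_mat_lower_left_zero[of _ d _ 1]) (auto simp del: One_nat_def)
  moreover have "Determinant.det (four_block_mat (1\<^sub>m d) (0\<^sub>m d 1) r (1\<^sub>m 1)) = 1"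
    by (subst det_four_block_mat_upper_right_zero[of _ d _ 1]) (auto simp del: One_nat_def)
  moreover have "Determinant.det (four_block_mat (1\<^sub>m d) (0\<^sub>m d 1) e (1\<^sub>m 1)) = 1"
    by (subst det_four_block_mat_upper_right_zero[of _ d _ 1]) (auto simp del: One_nat_def)
  moreover have "Determinant.det (four_block_mat P c (0\<^sub>m 1 d) s) = Determinant.det P * Determinant.det s"
    by (subst det_four_block_mat_lower_left_zero[of _ d _ 1]) (auto simp del: One_nat_def)
  moreover have "Determinant.det P = (\<Prod>i<d. p i)"
    by (subst det_upper_triangular[of _ d])
       (auto simp: P_def diag_mat_def prod_list_diag_prod atLeast0LessThan upper_triangular_def
          prod.list_conv_set_nth intro!: prod.cong)
  moreover have "Determinant.det s = 1 - (\<Sum>i<d. p i)"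
    by (subst det_upper_triangular[of _ 1]) (auto simp: s_def diag_mat_def upper_triangular_def)
  ultimately show ?thesis
    by simp
qed

section \<open>Uniqueness and existence of positive semidefinite square roots\<close>

text \<open>Moving from \<open>y\<close> in the direction z = B y changes the quadratic form from 0
  to 2 t |z|^2 + t^2 q(z). This stays nonnegative for both signs of \<open>t\<close> only if the
  linear coefficient vanishes.\<close>

lemma sym_psd_null_vector:
  assumes B: "sym_psd B" "B \<in> carrier_mat d d" and y: "y \<in> carrier_vec d" and "y \<bullet> (B *\<^sub>v y) = 0"
  shows "B *\<^sub>v y = 0\<^sub>v d"
proof -
  define z where "z = B *\<^sub>v y"
  have [simp]: "z \<in> carrier_vec d" and Bz[simp]: "B *\<^sub>v z \<in> carrier_vec d"
    and By: "B *\<^sub>v y \<in> carrier_vec d"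
    using B y by (auto simp: z_def)
  have sym: "u \<bullet> (B *\<^sub>v v) = (B *\<^sub>v u) \<bullet> v" if "u \<in> carrier_vec d" "v \<in> carrier_vec d" for u v
    using transpose_vec_mult_scalar[OF B(2) that(2,1)] B by (simp add: sym_psd_def)
  have psd: "0 \<le> u \<bullet> (B *\<^sub>v u)" if "u \<in> carrier_vec d" for u
    using that B by (auto simp: sym_psd_def)
  have ge: "0 \<le> 2 * t * (z \<bullet> z) + t\<^sup>2 * (z \<bullet> (B *\<^sub>v z))" for t
  proof -
    have "0 \<le> (y + t \<cdot>\<^sub>v z) \<bullet> (B *\<^sub>v (y + t \<cdot>\<^sub>v z))"
      using y by (intro psd) auto
    also have "B *\<^sub>v (y + t \<cdot>\<^sub>v z) = z + t \<cdot>\<^sub>v (B *\<^sub>v z)"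
      using B y by (simp add: mult_add_distrib_mat_vec[OF B(2)] mult_mat_vec[OF B(2)] z_def)
    also have "(y + t \<cdot>\<^sub>v z) \<bullet> (z + t \<cdot>\<^sub>v (B *\<^sub>v z))
        = y \<bullet> z + t * (y \<bullet> (B *\<^sub>v z)) + t * (z \<bullet> z) + t * t * (z \<bullet> (B *\<^sub>v z))"
      using y by (simp add: add_scalar_prod_distrib[of _ d] scalar_prod_add_distrib[of _ d]
          smult_scalar_prod_distrib[of _ d] scalar_prod_smult_distrib[of _ d] algebra_simps)
    also have "y \<bullet> z = 0"
      using assms by (simp add: z_def)
    also have "y \<bullet> (B *\<^sub>v z) = z \<bullet> z"
      using y by (simp add: sym z_def[symmetric])
    finally show ?thesis
      by (simp add: power2_eq_square)
  qed
  define a b where "a = z \<bullet> z" and "b = z \<bullet> (B *\<^sub>v z)"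
  have a: "a = (\<Sum>i<d. (z $ i)\<^sup>2)"
    unfolding a_def scalar_prod_def carrier_vecD[OF \<open>z \<in> carrier_vec d\<close>]
    by (simp add: power2_eq_square atLeast0LessThan)
  have "b \<ge> 0"
    using psd by (simp add: b_def)
  have "a \<le> 0"
  proof (rule ccontr)
    assume "\<not> a \<le> 0"
    \<comment> \<open>The minimiser would be - a / b; the added 1 also covers b = 0 and still makes
      the value negative.\<close>
    define t where "t = - a / (b + 1)"
    have a_t: "a = - t * (b + 1)"
      using \<open>b \<ge> 0\<close> by (simp add: t_def)
    have "2 * t * a + t\<^sup>2 * b = - (t\<^sup>2 * (b + 2))"
      unfolding a_t by (simp add: algebra_simps power2_eq_square)
    moreover have "t \<noteq> 0"
      using \<open>\<not> a \<le> 0\<close> a_t by auto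
    then have "0 < t\<^sup>2 * (b + 2)"
      using \<open>b \<ge> 0\<close> by (intro mult_pos_pos) auto
    ultimately show False
      using ge[of t] by (simp add: a_def b_def)
  qed
  then have "\<forall>i<d. z $ i = 0"
    using sum_nonneg_eq_0_iff[of "{..<d}" "\<lambda>i. (z $ i)\<^sup>2"] a
    by (auto simp: antisym[OF _ sum_nonneg])
  then show ?thesis
    using \<open>z \<in> carrier_vec d\<close> unfolding z_def[symmetric] by (intro eq_vecI) auto
qed

text \<open>Commutation gives (B + C)(B - C) = 0. For y = (B - C) x the two nonnegative forms of B
  and C at \<open>y\<close> therefore add up to 0, so both vanish and B y = C y = 0; then |y|^2 is
  the product of \<open>x\<close> with (B - C) y, which is 0.\<close>

lemma commuting_psd_sqrt_unique:
  assumes B: "sym_psd B" "B \<in> carrier_mat d d" and C: "sym_psd C" "C \<in> carrier_mat d d"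
    and sq: "B * B = C * C" and comm: "B * C = C * B"
  shows "B = C"
proof -
  have zero: "(B - C) *\<^sub>v x = 0\<^sub>v d" if x: "x \<in> carrier_vec d" for x
  proof -
    define y where "y = (B - C) *\<^sub>v x"
    have y: "y \<in> carrier_vec d" "B *\<^sub>v y \<in> carrier_vec d" "C *\<^sub>v y \<in> carrier_vec d"
      using B(2) C(2) x by (auto simp: y_def intro!: mult_mat_vec_carrier)
    have BC: "B - C \<in> carrier_mat d d" "B + C \<in> carrier_mat d d"
      using B C by auto
    have "(B + C) * (B - C) = B * B + C * B - (B * C + C * C)"
      using B(2) C(2)
      by (simp add: mult_minus_distrib_mat[of _ d d _ d] add_mult_distrib_mat[of _ d d _ _ d])
    also have "\<dots> = 0\<^sub>m d d"
      using B(2) C(2) unfolding comm sq by (intro eq_matI) auto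
    finally have "(B + C) *\<^sub>v y = 0\<^sub>m d d *\<^sub>v x"
      using assoc_mult_mat_vec[OF BC(2,1) x] by (simp add: y_def)
    also have "\<dots> = 0\<^sub>v d"
      using x by (intro eq_vecI) (auto simp: scalar_prod_def)
    finally have "(B + C) *\<^sub>v y = 0\<^sub>v d" .
    then have "B *\<^sub>v y + C *\<^sub>v y = 0\<^sub>v d"
      using add_mult_distrib_mat_vec[OF B(2) C(2) y(1)] by simp
    then have "y \<bullet> (B *\<^sub>v y) + y \<bullet> (C *\<^sub>v y) = 0"
      using y by (simp add: scalar_prod_add_distrib[of _ d, symmetric])
    moreover have "0 \<le> y \<bullet> (B *\<^sub>v y)" "0 \<le> y \<bullet> (C *\<^sub>v y)"
      using B C y by (auto simp: sym_psd_def)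
    ultimately have "y \<bullet> (B *\<^sub>v y) = 0" "y \<bullet> (C *\<^sub>v y) = 0"
      by auto
    then have "B *\<^sub>v y = 0\<^sub>v d" "C *\<^sub>v y = 0\<^sub>v d"
      using sym_psd_null_vector[OF B y(1)] sym_psd_null_vector[OF C y(1)] by auto
    then have "(B - C) *\<^sub>v y = 0\<^sub>v d"
      using minus_mult_distrib_mat_vec[OF B(2) C(2) y(1)] by simp
    moreover have "transpose_mat (B - C) = B - C"
      using B C by (simp add: sym_psd_def transpose_minus)
    ultimately have "y \<bullet> y = 0"
      using transpose_vec_mult_scalar[OF BC(1) x y(1)] x y by (simp add: y_def)
    then have "(\<Sum>i<d. (y $ i)\<^sup>2) = 0"
      using y by (simp add: scalar_prod_def power2_eq_square atLeast0LessThan)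
    then have "\<forall>i<d. y $ i = 0"
      using sum_nonneg_eq_0_iff[of "{..<d}" "\<lambda>i. (y $ i)\<^sup>2"] by auto
    then show ?thesis
      using y unfolding y_def[symmetric] by (intro eq_vecI) auto
  qed
  show ?thesis
  proof (rule eq_matI)
    fix i j assume "i < dim_row C" "j < dim_col C"
    then have ij: "i < d" "j < d"
      using C by auto
    have "((B - C) *\<^sub>v unit_vec d j) $ i = 0"
      using zero[of "unit_vec d j"] ij by simp
    then show "B $$ (i, j) = C $$ (i, j)"
      using B(2) C(2) ij by (simp add: scalar_prod_right_unit)
  qed (use B C in auto)
qed

unbundle no inner_syntax
hide_type (open) Finite_Cartesian_Product.vec

text \<open>
  For a symmetric entrywise nonnegative $X$ with row sums at most 1 the iterates increase entrywise to some $Y$ with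
  $2Y = X + Y^2$, so that $1 - Y$ is the positive semidefinite root of $1 - X$. Being a limit of polynomials
  in $X$, it commutes with every other root, which gives uniqueness.
\<close>

primrec sqrt_iter :: "nat \<Rightarrow> real mat \<Rightarrow> nat \<Rightarrow> real mat" where
  "sqrt_iter d X 0 = 0\<^sub>m d d"
| "sqrt_iter d X (Suc k) = (1 / 2) \<cdot>\<^sub>m (X + sqrt_iter d X k * sqrt_iter d X k)"

lemma tendsto_index_mult_mat:
  fixes U V :: "nat \<Rightarrow> real mat"
  assumes "\<And>k. U k \<in> carrier_mat a b" "\<And>k. V k \<in> carrier_mat b c" "U' \<in> carrier_mat a b" "V' \<in> carrier_mat b c"
    and U: "\<And>i j. i < a \<Longrightarrow> j < b \<Longrightarrow> (\<lambda>k. U k $$ (i, j)) \<longlonglongrightarrow> U' $$ (i, j)"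
    and V: "\<And>i j. i < b \<Longrightarrow> j < c \<Longrightarrow> (\<lambda>k. V k $$ (i, j)) \<longlonglongrightarrow> V' $$ (i, j)"
    and ij: "i < a" "j < c"
  shows "(\<lambda>k. (U k * V k) $$ (i, j)) \<longlonglongrightarrow> (U' * V') $$ (i, j)"
  unfolding index_mult_mat_sum[OF assms(1,2) ij] index_mult_mat_sum[OF assms(3,4) ij]
  by (intro tendsto_intros U V) (use ij in auto)

lemma psd_sqrt_exists:
  assumes X: "X \<in> carrier_mat d d" and symX: "transpose_mat X = X"
    and pos: "\<And>i j. i < d \<Longrightarrow> j < d \<Longrightarrow> 0 \<le> X $$ (i, j)"
    and row: "\<And>i. i < d \<Longrightarrow> (\<Sum>j<d. X $$ (i, j)) \<le> 1"
  shows "\<exists>B. B \<in> carrier_mat d d \<and> sym_psd B \<and> B * B = 1\<^sub>m d - X \<and>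
    (\<forall>C. C \<in> carrier_mat d d \<longrightarrow> C * X = X * C \<longrightarrow> C * B = B * C)"
proof -
  let ?Y = "sqrt_iter d X"
  have Yc[simp]: "?Y k \<in> carrier_mat d d" for k
    using X by (induction k) auto
  have Yd[simp]: "dim_row (?Y k) = d" "dim_col (?Y k) = d" for k
    using Yc[of k] by (simp_all only: carrier_matD)
  have Yij: "?Y (Suc k) $$ (i, j) = (X $$ (i, j) + (\<Sum>l<d. ?Y k $$ (i, l) * ?Y k $$ (l, j))) / 2"
    if "i < d" "j < d" for i j k
    using that X by (simp add: index_mult_mat_sum[OF Yc Yc that, symmetric] del: index_mult_mat(1))
  have nonneg: "0 \<le> ?Y k $$ (i, j)" if "i < d" "j < d" for i j k
    using that by (induction k arbitrary: i j)
      (auto simp: Yij simp del: sqrt_iter.simps(2) intro!: sum_nonneg add_nonneg_nonneg pos)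
  have mono: "?Y k $$ (i, j) \<le> ?Y (Suc k) $$ (i, j)" if "i < d" "j < d" for i j k
    using that
  proof (induction k arbitrary: i j)
    case 0
    then show ?case using nonneg[of i j 1] by simp
  next
    case (Suc k)
    then have "(\<Sum>l<d. ?Y k $$ (i, l) * ?Y k $$ (l, j)) \<le> (\<Sum>l<d. ?Y (Suc k) $$ (i, l) * ?Y (Suc k) $$ (l, j))"
      by (intro sum_mono mult_mono nonneg) auto
    then show ?case
      using Suc.prems by (simp add: Yij del: sqrt_iter.simps(2))
  qed
  \<comment> \<open>Row sums at most 1 survive products of nonnegative matrices, hence also the
    average of \<open>X\<close> and the square of the iterate. They bound the entries, which gives
    the monotone limits.\<close>
  have rows: "(\<Sum>j<d. ?Y k $$ (i, j)) \<le> 1" if "i < d" for i k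
    using that
  proof (induction k arbitrary: i)
    case (Suc k)
    have "(\<Sum>j<d. \<Sum>l<d. ?Y k $$ (i, l) * ?Y k $$ (l, j)) = (\<Sum>l<d. ?Y k $$ (i, l) * (\<Sum>j<d. ?Y k $$ (l, j)))"
      by (subst sum.swap) (simp add: sum_distrib_left)
    also have "\<dots> \<le> (\<Sum>l<d. ?Y k $$ (i, l) * 1)"
      using Suc by (intro sum_mono mult_left_mono nonneg) auto
    also have "\<dots> \<le> 1"
      using Suc by simp
    finally have "(\<Sum>j<d. X $$ (i, j)) + (\<Sum>j<d. \<Sum>l<d. ?Y k $$ (i, l) * ?Y k $$ (l, j)) \<le> 2"
      using row[OF Suc.prems] by simp
    then show ?case
      using Suc.prems by (simp add: Yij sum.distrib sum_divide_distrib[symmetric] del: sqrt_iter.simps(2))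
  qed simp
  have bound: "?Y k $$ (i, j) \<le> 1" if "i < d" "j < d" for i j k
    using member_le_sum[of j "{..<d}" "\<lambda>j. ?Y k $$ (i, j)"] that nonneg rows[of i k] by force
  have symY: "transpose_mat (?Y k) = ?Y k" for k
  proof (induction k)
    case (Suc k)
    have "transpose_mat (?Y k * ?Y k) = ?Y k * ?Y k"
      by (simp add: transpose_mult[OF Yc Yc] Suc)
    then show ?case
      using X symX by (intro eq_matI) (auto simp: mat_eq_iff)
  qed auto
  have commY: "C * ?Y k = ?Y k * C" if C: "C \<in> carrier_mat d d" and CX: "C * X = X * C" for C k
  proof (induction k)
    case (Suc k)
    have YY: "?Y k * ?Y k \<in> carrier_mat d d"
      by auto
    have "C * (?Y k * ?Y k) = ?Y k * ?Y k * C"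
      using Suc assoc_mult_mat[OF C Yc Yc, of k k] assoc_mult_mat[OF Yc C Yc, of k k]
        assoc_mult_mat[OF Yc Yc C, of k k] by simp
    then have "C * (X + ?Y k * ?Y k) = (X + ?Y k * ?Y k) * C"
      using mult_add_distrib_mat[OF C X YY] add_mult_distrib_mat[OF X YY C] CX by simp
    moreover have XYY: "X + ?Y k * ?Y k \<in> carrier_mat d d"
      using X YY by auto
    ultimately show ?case
      using mult_smult_distrib[OF C XYY] mult_smult_assoc_mat[OF XYY C] by simp
  qed (use C in auto)
  have "\<exists>L. (\<lambda>k. ?Y k $$ (i, j)) \<longlonglongrightarrow> L" if "i < d" "j < d" for i j
    using incseq_convergent[of "\<lambda>k. ?Y k $$ (i, j)" 1] mono[OF that] bound[OF that]
    by (metis incseq_SucI)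
  then obtain L where L: "\<And>i j. i < d \<Longrightarrow> j < d \<Longrightarrow> (\<lambda>k. ?Y k $$ (i, j)) \<longlonglongrightarrow> L i j"
    by metis
  define Y where "Y = mat d d (\<lambda>(i, j). L i j)"
  have Y[simp]: "Y \<in> carrier_mat d d"
    by (simp add: Y_def)
  have Y_dim[simp]: "dim_row Y = d" "dim_col Y = d"
    by (simp_all add: Y_def)
  have lim: "(\<lambda>k. ?Y k $$ (i, j)) \<longlonglongrightarrow> Y $$ (i, j)" if "i < d" "j < d" for i j
    using L[OF that] that by (simp add: Y_def)
  have Y_nonneg: "0 \<le> Y $$ (i, j)" if "i < d" "j < d" for i j
    using LIMSEQ_le_const[OF lim[OF that]] nonneg[OF that] by blast
  have Y_sym: "Y $$ (i, j) = Y $$ (j, i)" if "i < d" "j < d" for i j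
  proof -
    have "?Y k $$ (i, j) = ?Y k $$ (j, i)" for k
      using arg_cong[OF symY[of k], of "\<lambda>M. M $$ (i, j)"] that by simp
    then show ?thesis
      using LIMSEQ_unique[OF lim[OF that]] lim[OF that(2,1)] by simp
  qed
  have Y_row: "(\<Sum>j<d. Y $$ (i, j)) \<le> 1" if "i < d" for i
    by (rule LIMSEQ_le_const2[OF tendsto_sum[of "{..<d}" "\<lambda>j k. ?Y k $$ (i, j)"]]) (use lim rows that in auto)
  have Y_fix: "X $$ (i, j) + (Y * Y) $$ (i, j) = 2 * Y $$ (i, j)" if "i < d" "j < d" for i j
  proof -
    have "(\<lambda>k. (X $$ (i, j) + (?Y k * ?Y k) $$ (i, j)) / 2) \<longlonglongrightarrow> (X $$ (i, j) + (Y * Y) $$ (i, j)) / 2"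
      by (intro tendsto_intros tendsto_index_mult_mat[of _ d d _ d]) (use lim that in auto)
    moreover have "(\<lambda>k. (X $$ (i, j) + (?Y k * ?Y k) $$ (i, j)) / 2) = (\<lambda>k. ?Y (Suc k) $$ (i, j))"
      using that X by auto
    ultimately show ?thesis
      using LIMSEQ_unique[OF _ LIMSEQ_Suc[OF lim[OF that]]] by force
  qed
  show ?thesis
  proof (intro exI[of _ "1\<^sub>m d - Y"] conjI allI impI)
    show B: "1\<^sub>m d - Y \<in> carrier_mat d d"
      by (rule minus_carrier_mat[OF Y])
    show "(1\<^sub>m d - Y) * (1\<^sub>m d - Y) = 1\<^sub>m d - X"
    proof -
      have "(1\<^sub>m d - Y) * (1\<^sub>m d - Y) = (1\<^sub>m d - Y) - (Y - Y * Y)"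
        by (simp add: mult_minus_distrib_mat[of _ d d _ d] minus_mult_distrib_mat[of _ d d _ _ d] B)
      also have "\<dots> = 1\<^sub>m d - X"
        using Y_fix X by (intro eq_matI) (auto simp del: index_mult_mat(1) simp: algebra_simps)
      finally show ?thesis .
    qed
    show "C * (1\<^sub>m d - Y) = (1\<^sub>m d - Y) * C" if C: "C \<in> carrier_mat d d" and CX: "C * X = X * C" for C
    proof -
      have "(C * Y) $$ (i, j) = (Y * C) $$ (i, j)" if "i < d" "j < d" for i j
      proof (rule LIMSEQ_unique)
        show "(\<lambda>k. (C * ?Y k) $$ (i, j)) \<longlonglongrightarrow> (C * Y) $$ (i, j)"
          by (rule tendsto_index_mult_mat[of _ d d _ d]) (use lim that C in auto)
        show "(\<lambda>k. (C * ?Y k) $$ (i, j)) \<longlonglongrightarrow> (Y * C) $$ (i, j)"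
          unfolding commY[OF C CX]
          by (rule tendsto_index_mult_mat[of _ d d _ d]) (use lim that C in auto)
      qed
      then have "C * Y = Y * C"
        using C by (intro eq_matI) (auto simp del: index_mult_mat(1))
      then show ?thesis
        using C by (simp add: mult_minus_distrib_mat[of _ d d _ d] minus_mult_distrib_mat[of _ d d _ _ d])
    qed
    show "sym_psd (1\<^sub>m d - Y)"
      unfolding sym_psd_def
    proof (intro conjI ballI)
      show "transpose_mat (1\<^sub>m d - Y) = 1\<^sub>m d - Y"
        using Y_sym by (intro eq_matI) auto
      fix x :: "real vec" assume "x \<in> carrier_vec (dim_row (1\<^sub>m d - Y))"
      then have x: "dim_vec x = d"
        by simp
      \<comment> \<open>Bounding x_i x_j by half the sum of squares and using that row sums, and by
        symmetry column sums, are at most 1 shows that the form of \<open>Y\<close> is at most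
        |x|^2. Hence 1 - Y is positive semidefinite without any spectral argument.\<close>
      have "(\<Sum>i<d. \<Sum>j<d. Y $$ (i, j) * (x $ i * x $ j))
          \<le> (\<Sum>i<d. \<Sum>j<d. Y $$ (i, j) * (((x $ i)\<^sup>2 + (x $ j)\<^sup>2) / 2))"
        using sum_squares_bound[of "x $ i" "x $ j" for i j]
        by (intro sum_mono mult_left_mono Y_nonneg) (auto simp: power2_eq_square algebra_simps)
      also have "\<dots> = ((\<Sum>i<d. \<Sum>j<d. Y $$ (i, j) * (x $ i)\<^sup>2) + (\<Sum>i<d. \<Sum>j<d. Y $$ (i, j) * (x $ j)\<^sup>2)) / 2"
        by (simp add: sum.distrib[symmetric] sum_divide_distrib algebra_simps)
      also have "(\<Sum>i<d. \<Sum>j<d. Y $$ (i, j) * (x $ j)\<^sup>2) = (\<Sum>i<d. \<Sum>j<d. Y $$ (i, j) * (x $ i)\<^sup>2)"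
        by (subst sum.swap) (use Y_sym in \<open>auto intro!: sum.cong\<close>)
      also have "(\<Sum>i<d. \<Sum>j<d. Y $$ (i, j) * (x $ i)\<^sup>2) = (\<Sum>i<d. (\<Sum>j<d. Y $$ (i, j)) * (x $ i)\<^sup>2)"
        by (simp add: sum_distrib_right)
      also have "((\<Sum>i<d. (\<Sum>j<d. Y $$ (i, j)) * (x $ i)\<^sup>2) + (\<Sum>i<d. (\<Sum>j<d. Y $$ (i, j)) * (x $ i)\<^sup>2)) / 2 
          \<le> (\<Sum>i<d. 1 * (x $ i)\<^sup>2)"
        using sum_mono[of "{..<d}" "\<lambda>i. (\<Sum>j<d. Y $$ (i, j)) * (x $ i)\<^sup>2" "\<lambda>i. 1 * (x $ i)\<^sup>2"]
          mult_right_mono[OF Y_row] by simp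
      finally have le: "(\<Sum>i<d. \<Sum>j<d. Y $$ (i, j) * (x $ i * x $ j)) \<le> (\<Sum>i<d. (x $ i)\<^sup>2)"
        by simp
      have "x \<bullet> ((1\<^sub>m d - Y) *\<^sub>v x) = x \<bullet> x - x \<bullet> (Y *\<^sub>v x)"
      proof -
        have c: "x \<in> carrier_vec d" "Y *\<^sub>v x \<in> carrier_vec d"
          using x Y by (auto intro: carrier_vecI)
        show ?thesis
          using minus_mult_distrib_mat_vec[OF one_carrier_mat Y c(1)] scalar_prod_minus_distrib[OF c(1) c(1) c(2)] c
          by simp
      qed
      also have "x \<bullet> x = (\<Sum>i<d. (x $ i)\<^sup>2)"
        using x by (simp add: scalar_prod_def power2_eq_square atLeast0LessThan)
      also have "x \<bullet> (Y *\<^sub>v x) = (\<Sum>i<d. \<Sum>j<d. Y $$ (i, j) * (x $ i * x $ j))"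
        using x by (auto simp: scalar_prod_def atLeast0LessThan sum_distrib_left Y_def intro!: sum.cong)
      finally show "0 \<le> x \<bullet> ((1\<^sub>m d - Y) *\<^sub>v x)"
        using le by simp
    qed simp
  qed
qed

text \<open>The candidate is sqrt s times the root of 1 - X. It commutes with any competitor, so the
  definite description in \<open>mat_sqrt\<close> denotes it.\<close>

lemma mat_sqrt_smult_one_minus:
  assumes X: "X \<in> carrier_mat d d" and symX: "transpose_mat X = X"
    and pos: "\<And>i j. i < d \<Longrightarrow> j < d \<Longrightarrow> 0 \<le> X $$ (i, j)"
    and row: "\<And>i. i < d \<Longrightarrow> (\<Sum>j<d. X $$ (i, j)) \<le> 1" and "0 < s"
  defines "B \<equiv> mat_sqrt (s \<cdot>\<^sub>m (1\<^sub>m d - X))"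
  shows "B \<in> carrier_mat d d" "transpose_mat B = B" "B * B = s \<cdot>\<^sub>m (1\<^sub>m d - X)"
proof -
  let ?A = "s \<cdot>\<^sub>m (1\<^sub>m d - X)"
  obtain R where R: "R \<in> carrier_mat d d" "sym_psd R" "R * R = 1\<^sub>m d - X"
    and comm: "\<And>C. C \<in> carrier_mat d d \<Longrightarrow> C * X = X * C \<Longrightarrow> C * R = R * C"
    using psd_sqrt_exists[OF X symX pos row] by meson
  let ?S = "sqrt s \<cdot>\<^sub>m R"
  have S: "?S \<in> carrier_mat d d"
    using R by auto
  have psdS: "sym_psd ?S"
    unfolding sym_psd_def
  proof (intro conjI ballI)
    show "transpose_mat ?S = ?S"
      using R by (intro eq_matI) (auto simp: sym_psd_def mat_eq_iff)
    fix x :: "real vec" assume "x \<in> carrier_vec (dim_row ?S)"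
    then have x: "x \<in> carrier_vec d"
      using R by simp
    have "?S *\<^sub>v x = sqrt s \<cdot>\<^sub>v (R *\<^sub>v x)"
      using R x by (intro eq_vecI) auto
    then have "x \<bullet> (?S *\<^sub>v x) = sqrt s * (x \<bullet> (R *\<^sub>v x))"
      using R x by simp
    then show "0 \<le> x \<bullet> (?S *\<^sub>v x)"
      using R x \<open>0 < s\<close> by (simp add: sym_psd_def)
  qed (use R in simp)
  have sqS: "?S * ?S = ?A"
    using R(1) \<open>0 < s\<close> unfolding R(3)[symmetric]
    by (intro eq_matI) (auto simp: mult_smult_distrib[of _ d d _ d] mult_smult_assoc_mat[of _ d d _ d])
  have "mat_sqrt ?A = ?S"
    unfolding mat_sqrt_def
  proof (rule the_equality)
    show "sym_psd ?S \<and> dim_row ?S = dim_row ?A \<and> ?S * ?S = ?A"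
      using psdS sqS R X by auto
    fix C assume C: "sym_psd C \<and> dim_row C = dim_row ?A \<and> C * C = ?A"
    then have Cc: "C \<in> carrier_mat d d"
      using X by (auto simp: sym_psd_def)
    \<comment> \<open>A competing root \<open>C\<close> determines \<open>X\<close> as a polynomial
      in \<open>C\<close>, so it commutes with \<open>X\<close> and hence with
      \<open>R\<close>.\<close>
    have XA: "X = 1\<^sub>m d - (1 / s) \<cdot>\<^sub>m (C * C)"
      using C X \<open>0 < s\<close> by (intro eq_matI) auto
    have "C * X = X * C"
      using Cc unfolding XA
      by (simp add: mult_minus_distrib_mat[of _ d d _ d] minus_mult_distrib_mat[of _ d d _ _ d]
          mult_smult_distrib[of _ d d _ d] mult_smult_assoc_mat[of _ d d _ d] assoc_mult_mat[of _ d d _ d _ d])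
    from comm[OF Cc this] have "C * ?S = ?S * C"
      using R Cc by (simp add: mult_smult_distrib[of _ d d _ d] mult_smult_assoc_mat[of _ d d _ d])
    then show "C = ?S"
      using commuting_psd_sqrt_unique[of C d ?S] C Cc S psdS sqS by simp
  qed
  then show "B \<in> carrier_mat d d" "transpose_mat B = B" "B * B = ?A"
    using S psdS sqS by (auto simp: B_def sym_psd_def)
qed

section \<open>Gaussian integrals and moments\<close>

interpretation lborel_product: product_sigma_finite "\<lambda>_::nat. lborel :: real measure"
  by standard

text \<open>The two cases are translations, used to complete the square, and point reflections, used
  to kill odd moments. Both preserve Lebesgue measure coordinate by coordinate.\<close>

lemma distr_lebesgue_d_affine:
  assumes "\<bar>s\<bar> = 1"
  shows "distr (lebesgue_d d) (lebesgue_d d) (\<lambda>x. \<lambda>i\<in>{..<d}. a i + s * x i) = lebesgue_d d" (is "?D = _")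
proof (rule lborel_product.PiM_eqI)
  have meas: "(\<lambda>x. \<lambda>i\<in>{..<d}. a i + s * x i) \<in> measurable (lebesgue_d d) (lebesgue_d d)"
    by measurable
  fix A :: "nat \<Rightarrow> real set" assume A: "\<And>i. i \<in> {..<d} \<Longrightarrow> A i \<in> sets lborel"
  define B where "B i = (\<lambda>t. a i + s * t) -` A i" for i
  have B: "B i \<in> sets lborel" "emeasure lborel (B i) = emeasure lborel (A i)" if "i < d" for i
  proof -
    have m: "(\<lambda>t. a i + s * t) \<in> measurable borel borel"
      by measurable
    show "B i \<in> sets lborel"
      using measurable_sets[OF m, of "A i"] A[of i] that by (simp add: B_def)
    have "emeasure lborel (A i) = (\<integral>\<^sup>+t. indicator (A i) t \<partial>lborel)"
      using A that by simp
    also have "\<dots> = (\<integral>\<^sup>+t. indicator (A i) (a i + s * t) \<partial>lborel)"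
      using assms A that by (subst nn_integral_real_affine[of _ s "a i"]) auto
    also have "\<dots> = (\<integral>\<^sup>+t. indicator (B i) t \<partial>lborel)"
      by (auto simp: B_def indicator_def intro!: nn_integral_cong)
    finally show "emeasure lborel (B i) = emeasure lborel (A i)"
      using \<open>B i \<in> sets lborel\<close> by simp
  qed
  have "emeasure ?D (Pi\<^sub>E {..<d} A)
      = emeasure (lebesgue_d d) ((\<lambda>x. \<lambda>i\<in>{..<d}. a i + s * x i) -` Pi\<^sub>E {..<d} A \<inter> space (lebesgue_d d))"
    using meas A by (intro emeasure_distr) (auto intro!: sets_PiM_I_finite)
  also have "(\<lambda>x. \<lambda>i\<in>{..<d}. a i + s * x i) -` Pi\<^sub>E {..<d} A \<inter> space (lebesgue_d d) = Pi\<^sub>E {..<d} B"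
  proof (rule Set.set_eqI)
    fix x :: "nat \<Rightarrow> real"
    show "x \<in> (\<lambda>x. \<lambda>i\<in>{..<d}. a i + s * x i) -` Pi\<^sub>E {..<d} A \<inter> space (lebesgue_d d) \<longleftrightarrow> x \<in> Pi\<^sub>E {..<d} B"
      unfolding space_PiM B_def PiE_iff vimage_def by (simp add: PiE_def)
  qed
  also have "emeasure (lebesgue_d d) (Pi\<^sub>E {..<d} B) = (\<Prod>i<d. emeasure lborel (A i))"
    using B by (subst lborel_product.emeasure_PiM) auto
  finally show "emeasure ?D (Pi\<^sub>E {..<d} A) = (\<Prod>i<d. emeasure lborel (A i))" .
qed auto

lemma nn_integral_lebesgue_d_affine:
  assumes "\<bar>s\<bar> = 1" and [measurable]: "f \<in> borel_measurable (lebesgue_d d)"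
  shows "(\<integral>\<^sup>+x. f (\<lambda>i\<in>{..<d}. a i + s * x i) \<partial>lebesgue_d d) = (\<integral>\<^sup>+x. f x \<partial>lebesgue_d d)"
proof -
  have "(\<integral>\<^sup>+x. f x \<partial>lebesgue_d d)
      = (\<integral>\<^sup>+x. f x \<partial>distr (lebesgue_d d) (lebesgue_d d) (\<lambda>x. \<lambda>i\<in>{..<d}. a i + s * x i))"
    using distr_lebesgue_d_affine[OF assms(1)] by simp
  also have "\<dots> = (\<integral>\<^sup>+x. f (\<lambda>i\<in>{..<d}. a i + s * x i) \<partial>lebesgue_d d)"
    by (rule nn_integral_distr) measurable
  finally show ?thesis ..
qed

lemma integral_lebesgue_d_affine:
  fixes f :: "(nat \<Rightarrow> real) \<Rightarrow> real"
  assumes "\<bar>s\<bar> = 1" and [measurable]: "f \<in> borel_measurable (lebesgue_d d)"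
  shows "(\<integral>x. f (\<lambda>i\<in>{..<d}. a i + s * x i) \<partial>lebesgue_d d) = (\<integral>x. f x \<partial>lebesgue_d d)"
proof -
  have "(\<integral>x. f x \<partial>lebesgue_d d)
      = (\<integral>x. f x \<partial>distr (lebesgue_d d) (lebesgue_d d) (\<lambda>x. \<lambda>i\<in>{..<d}. a i + s * x i))"
    using distr_lebesgue_d_affine[OF assms(1)] by simp
  also have "\<dots> = (\<integral>x. f (\<lambda>i\<in>{..<d}. a i + s * x i) \<partial>lebesgue_d d)"
    by (rule integral_distr) measurable
  finally show ?thesis ..
qed

text \<open>Convolution of centred Gaussians with variances p / s and q / s: completing the square
  in \<open>t\<close> splits off a normal density with variance p q / (s (p + q)) and leaves a
  Gaussian in \<open>y\<close> with variance (p + q) / s.\<close>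

lemma nn_integral_gaussian_convolution:
  fixes p q s :: real
  assumes "0 < p" "0 < q" "0 < s"
  shows "(\<integral>\<^sup>+t. ennreal (exp (- s / 2 * ((t - m)\<^sup>2 / p + (y + (t - m))\<^sup>2 / q))) \<partial>lborel)
    = ennreal (sqrt (2 * pi / s * (p * q / (p + q))) * exp (- s / 2 * (y\<^sup>2 / (p + q))))"
proof -
  define \<sigma> where "\<sigma> = sqrt (p * q / (s * (p + q)))"
  define \<mu> where "\<mu> = m - y * p / (p + q)"
  define K where "K = sqrt (2 * pi / s * (p * q / (p + q))) * exp (- s / 2 * (y\<^sup>2 / (p + q)))"
  have "0 < \<sigma>" and s2: "\<sigma>\<^sup>2 = p * q / (s * (p + q))"
    using assms by (auto simp: \<sigma>_def)
  have "(t - m)\<^sup>2 / p + (y + (t - m))\<^sup>2 / q = (t - \<mu>)\<^sup>2 * (p + q) / (p * q) + y\<^sup>2 / (p + q)" for t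
  proof -
    have [simp]: "p \<noteq> 0" "q \<noteq> 0" "p + q \<noteq> 0"
      using assms by auto
    define r where "r = t - m"
    have t: "t - \<mu> = r + y * p / (p + q)"
      by (simp add: \<mu>_def r_def)
    have "(r + y * p / (p + q))\<^sup>2 * (p + q) / (p * q) = (r * (p + q) + y * p)\<^sup>2 / ((p + q) * (p * q))"
      by (simp add: power2_eq_square add_divide_eq_iff)
    also have "\<dots> + y\<^sup>2 / (p + q) = ((r * (p + q) + y * p)\<^sup>2 + y\<^sup>2 * (p * q)) / ((p + q) * (p * q))"
      by (simp add: add_divide_distrib)
    also have "(r * (p + q) + y * p)\<^sup>2 + y\<^sup>2 * (p * q) = (p + q) * (r\<^sup>2 * q + (y + r)\<^sup>2 * p)"
      by (simp add: power2_eq_square algebra_simps)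
    also have "\<dots> / ((p + q) * (p * q)) = r\<^sup>2 / p + (y + r)\<^sup>2 / q"
      unfolding mult_divide_mult_cancel_left[OF \<open>p + q \<noteq> 0\<close>] by (simp add: add_divide_distrib)
    finally show ?thesis
      by (simp add: t r_def[symmetric])
  qed
  then have split: "exp (- s / 2 * ((t - m)\<^sup>2 / p + (y + (t - m))\<^sup>2 / q))
      = exp (- s / 2 * ((t - \<mu>)\<^sup>2 * (p + q) / (p * q))) * exp (- s / 2 * (y\<^sup>2 / (p + q)))" for t
    by (simp add: exp_add[symmetric] ring_distribs)
  have var: "2 * pi / s * (p * q / (p + q)) = 2 * pi * \<sigma>\<^sup>2"
    using assms by (simp add: s2)
  have "- s / 2 * ((t - \<mu>)\<^sup>2 * (p + q) / (p * q)) = - (t - \<mu>)\<^sup>2 / (2 * \<sigma>\<^sup>2)" for t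
    using assms by (simp add: s2)
  then have "exp (- s / 2 * ((t - m)\<^sup>2 / p + (y + (t - m))\<^sup>2 / q)) = K * normal_density \<mu> \<sigma> t" for t
    using \<open>0 < \<sigma>\<close> unfolding split K_def var by (simp add: normal_density_def)
  then have "(\<integral>\<^sup>+t. ennreal (exp (- s / 2 * ((t - m)\<^sup>2 / p + (y + (t - m))\<^sup>2 / q))) \<partial>lborel)
      = (\<integral>\<^sup>+t. ennreal K * ennreal (normal_density \<mu> \<sigma> t) \<partial>lborel)"
    using assms by (simp add: ennreal_mult K_def)
  also have "\<dots> = ennreal K * (\<integral>\<^sup>+t. ennreal (normal_density \<mu> \<sigma> t) \<partial>lborel)"
    by (rule nn_integral_cmult) measurable
  also have "(\<integral>\<^sup>+t. ennreal (normal_density \<mu> \<sigma> t) \<partial>lborel) = 1"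
    using integral_normal_density[OF \<open>0 < \<sigma>\<close>] integrable_normal_density[OF \<open>0 < \<sigma>\<close>]
    by (subst nn_integral_eq_integral) auto
  finally show ?thesis
    by (simp add: K_def)
qed

text \<open>Integrating out one coordinate replaces the weight \<open>q\<close> of the sum term by
  \<open>q + p d\<close> and leaves the shape unchanged. Hence \<open>q\<close> and the offset
  \<open>y\<close> stay free in the induction; the application has q = p_0 and y = 0, where the
  weights add up to 1.\<close>

lemma nn_integral_gaussian_simplex:
  fixes p m :: "nat \<Rightarrow> real"
  assumes "0 < q" "0 < s" "\<And>i. i < d \<Longrightarrow> 0 < p i"
  shows "(\<integral>\<^sup>+x. ennreal (exp (- s / 2 * ((\<Sum>i<d. (x i - m i)\<^sup>2 / p i) + (y + (\<Sum>i<d. x i - m i))\<^sup>2 / q))) \<partial>lebesgue_d d)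
    = ennreal (sqrt ((2 * pi / s) ^ d * ((\<Prod>i<d. p i) * q / (q + (\<Sum>i<d. p i))))
        * exp (- s / 2 * (y\<^sup>2 / (q + (\<Sum>i<d. p i)))))"
  using assms
proof (induction d arbitrary: q)
  case 0
  then show ?case
    by (simp add: PiM_empty nn_integral_count_space_finite)
next
  case (Suc d)
  let ?f = "\<lambda>x. ennreal (exp (- s / 2 * ((\<Sum>i<Suc d. (x i - m i)\<^sup>2 / p i) + (y + (\<Sum>i<Suc d. x i - m i))\<^sup>2 / q)))"
  have pos: "0 < p d" "0 < q + p d" "\<And>i. i < d \<Longrightarrow> 0 < p i"
    using Suc.prems by (auto intro: add_pos_pos)
  have meas: "?f \<in> borel_measurable (Pi\<^sub>M (insert d {..<d}) (\<lambda>_. lborel))"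
    unfolding lessThan_Suc by measurable
  define c where "c = sqrt (2 * pi / s * (p d * q / (p d + q)))"
  have c0: "0 \<le> c"
    using pos \<open>0 < q\<close> \<open>0 < s\<close> unfolding c_def
    by (intro real_sqrt_ge_zero mult_nonneg_nonneg divide_nonneg_nonneg) auto
  have "(\<integral>\<^sup>+x. ?f x \<partial>lebesgue_d (Suc d)) = (\<integral>\<^sup>+x. (\<integral>\<^sup>+t. ?f (x(d := t)) \<partial>lborel) \<partial>lebesgue_d d)"
    unfolding lessThan_Suc[of d]
    by (rule lborel_product.product_nn_integral_insert) (use meas in \<open>auto simp: lessThan_Suc\<close>)
  also have "\<dots> = (\<integral>\<^sup>+x. ennreal c *
      ennreal (exp (- s / 2 * ((\<Sum>i<d. (x i - m i)\<^sup>2 / p i) + (y + (\<Sum>i<d. x i - m i))\<^sup>2 / (q + p d)))) \<partial>lebesgue_d d)"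
  proof (rule nn_integral_cong)
    fix x :: "nat \<Rightarrow> real"
    let ?A = "\<Sum>i<d. (x i - m i)\<^sup>2 / p i" and ?Y = "y + (\<Sum>i<d. x i - m i)"
    have "(\<integral>\<^sup>+t. ?f (x(d := t)) \<partial>lborel)
      = (\<integral>\<^sup>+t. ennreal (exp (- s / 2 * ?A)) * ennreal (exp (- s / 2 * ((t - m d)\<^sup>2 / p d + (?Y + (t - m d))\<^sup>2 / q))) \<partial>lborel)"
      by (intro nn_integral_cong) (simp add: ennreal_mult[symmetric] exp_add[symmetric] algebra_simps)
    also have "\<dots> = ennreal (exp (- s / 2 * ?A))
        * (\<integral>\<^sup>+t. ennreal (exp (- s / 2 * ((t - m d)\<^sup>2 / p d + (?Y + (t - m d))\<^sup>2 / q))) \<partial>lborel)"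
      by (rule nn_integral_cmult) measurable
    also have "(\<integral>\<^sup>+t. ennreal (exp (- s / 2 * ((t - m d)\<^sup>2 / p d + (?Y + (t - m d))\<^sup>2 / q))) \<partial>lborel)
        = ennreal (c * exp (- s / 2 * (?Y\<^sup>2 / (q + p d))))"
      using nn_integral_gaussian_convolution[OF pos(1) \<open>0 < q\<close> \<open>0 < s\<close>, of "m d" ?Y]
      unfolding c_def add.commute[of q "p d"] .
    also have "ennreal (exp (- s / 2 * ?A)) * \<dots> = ennreal c * ennreal (exp (- s / 2 * ?A) * exp (- s / 2 * (?Y\<^sup>2 / (q + p d))))"
      by (simp add: c0 ennreal_mult mult_ac)
    also have "exp (- s / 2 * ?A) * exp (- s / 2 * (?Y\<^sup>2 / (q + p d))) = exp (- s / 2 * (?A + ?Y\<^sup>2 / (q + p d)))"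
      by (simp add: exp_add[symmetric] ring_distribs)
    finally show "(\<integral>\<^sup>+t. ?f (x(d := t)) \<partial>lborel)
      = ennreal c * ennreal (exp (- s / 2 * (?A + ?Y\<^sup>2 / (q + p d))))" .
  qed
  also have "\<dots> = ennreal c * ennreal (sqrt ((2 * pi / s) ^ d * ((\<Prod>i<d. p i) * (q + p d) / (q + p d + (\<Sum>i<d. p i))))
        * exp (- s / 2 * (y\<^sup>2 / (q + p d + (\<Sum>i<d. p i)))))"
    using Suc.IH[of "q + p d"] pos Suc.prems by (subst nn_integral_cmult) auto
  also have "q + p d + (\<Sum>i<d. p i) = q + (\<Sum>i<Suc d. p i)"
    by simp
  also have "ennreal c * ennreal (sqrt ((2 * pi / s) ^ d * ((\<Prod>i<d. p i) * (q + p d) / (q + (\<Sum>i<Suc d. p i))))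
        * exp (- s / 2 * (y\<^sup>2 / (q + (\<Sum>i<Suc d. p i)))))
      = ennreal ((c * sqrt ((2 * pi / s) ^ d * ((\<Prod>i<d. p i) * (q + p d) / (q + (\<Sum>i<Suc d. p i)))))
        * exp (- s / 2 * (y\<^sup>2 / (q + (\<Sum>i<Suc d. p i)))))"
    using c0 by (simp add: ennreal_mult'[symmetric] mult.assoc del: sum.lessThan_Suc)
  also have "c * sqrt ((2 * pi / s) ^ d * ((\<Prod>i<d. p i) * (q + p d) / (q + (\<Sum>i<Suc d. p i))))
      = sqrt ((2 * pi / s) ^ Suc d * ((\<Prod>i<Suc d. p i) * q / (q + (\<Sum>i<Suc d. p i))))"
    unfolding c_def real_sqrt_mult[symmetric] using pos(2)
    by (intro arg_cong[of _ _ sqrt]) (simp add: add.commute[of "p d" q] del: sum.lessThan_Suc)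
  finally show ?case .
qed

section \<open>Even moments from the moment generating function\<close>

lemma powser_zero_coeff:
  fixes a :: "nat \<Rightarrow> real"
  assumes "\<And>x. x \<noteq> 0 \<Longrightarrow> (\<lambda>n. a n * x ^ n) sums 0"
  shows "a n = 0"
proof (induction n rule: less_induct)
  case (less n)
  have "(\<lambda>k. a (k + n) * x ^ k) sums 0" if "x \<noteq> 0" for x
  proof -
    have "(\<lambda>k. a (k + n) * x ^ (k + n)) sums 0"
      using assms[OF that] less by (subst sums_zero_iff_shift) auto
    from sums_mult[OF this, of "1 / x ^ n"] show ?thesis
      using that by (simp add: power_add field_simps)
  qed
  then have "((\<lambda>_. 0) \<longlongrightarrow> a (0 + n)) (at (0::real))"
    by (intro powser_limit_0_strong[of 1 "\<lambda>k. a (k + n)" "\<lambda>_. 0"]) auto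
  then show ?case
    by (simp add: tendsto_const_iff)
qed

lemma sums_even_iff:
  fixes f :: "nat \<Rightarrow> real"
  shows "(\<lambda>k. f (2 * k)) sums c \<longleftrightarrow> (\<lambda>n. if even n then f n else 0) sums c"
proof -
  have "(if even n then f n else 0) = 0" if "n \<notin> range ((*) 2)" for n
    using that by (auto elim!: evenE)
  then show ?thesis
    using sums_mono_reindex[of "(*) 2" "\<lambda>n. if even n then f n else 0" c] by (simp add: strict_mono_def)
qed

text \<open>Averaging the generating function over t and -t gives the integral of cosh(t X), whose
  series has nonnegative terms. Summation and integration may thus be exchanged before any moment is
  known to be finite; finiteness is read off from the sum at t = 1, and the moments from comparing
  power series in t.\<close>

lemma even_moments_of_mgf:
  fixes X :: "'a \<Rightarrow> real"
  assumes X[measurable]: "X \<in> borel_measurable M" and "0 \<le> v"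
    and mgf: "\<And>t. (\<integral>\<^sup>+x. ennreal (exp (t * X x)) \<partial>M) = ennreal (exp (t\<^sup>2 * v / 2))"
  shows "has_bochner_integral M (\<lambda>x. X x ^ (2 * k)) (fact (2 * k) / (2 ^ k * fact k) * v ^ k)"
proof -
  define m where "m k = (\<integral>\<^sup>+x. ennreal (X x ^ (2 * k)) \<partial>M)" for k
  have cosh_sums: "(\<lambda>k. y ^ (2 * k) / fact (2 * k)) sums cosh y" for y :: real
    using cosh_converges[of y] sums_even_iff[of "\<lambda>n. y ^ n /\<^sub>R fact n" "cosh y"]
    by (simp add: divide_inverse mult.commute)
  have half: "ennreal (1 / 2) * (ennreal a + ennreal b) = ennreal ((a + b) / 2)" if "0 \<le> a" "0 \<le> b" for a b
    using that ennreal_mult[of "1 / 2" "a + b"] by (simp add: ennreal_plus del: ennreal_mult)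
  have series: "(\<Sum>k. ennreal (t ^ (2 * k) / fact (2 * k)) * m k) = ennreal (exp (t\<^sup>2 * v / 2))" for t
  proof -
    have "(\<Sum>k. ennreal (t ^ (2 * k) / fact (2 * k)) * m k)
        = (\<Sum>k. \<integral>\<^sup>+x. ennreal ((t * X x) ^ (2 * k) / fact (2 * k)) \<partial>M)"
      unfolding m_def
      by (subst nn_integral_cmult[symmetric])
        (auto simp: ennreal_mult[symmetric] power_mult_distrib divide_simps)
    also have "\<dots> = (\<integral>\<^sup>+x. (\<Sum>k. ennreal ((t * X x) ^ (2 * k) / fact (2 * k))) \<partial>M)"
      by (rule nn_integral_suminf[symmetric]) measurable
    also have "\<dots> = (\<integral>\<^sup>+x. ennreal (cosh (t * X x)) \<partial>M)"
      by (intro nn_integral_cong suminf_ennreal_eq cosh_sums) auto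
    also have "\<dots> = (\<integral>\<^sup>+x. ennreal (1 / 2) * (ennreal (exp (t * X x)) + ennreal (exp ((- t) * X x))) \<partial>M)"
      by (intro nn_integral_cong) (subst half, auto simp: cosh_def)
    also have "\<dots> = ennreal (1 / 2) * (ennreal (exp (t\<^sup>2 * v / 2)) + ennreal (exp ((- t)\<^sup>2 * v / 2)))"
      by (subst nn_integral_cmult, measurable) (subst nn_integral_add, measurable, simp only: mgf)
    also have "\<dots> = ennreal (exp (t\<^sup>2 * v / 2))"
      by (subst half) auto
    finally show ?thesis .
  qed
  have fin: "m k < \<top>" for k
  proof -
    have "ennreal (1 ^ (2 * k) / fact (2 * k)) * m k < \<top>"
      by (rule ennreal_suminf_lessD[of "\<lambda>k. ennreal (1 ^ (2 * k) / fact (2 * k)) * m k"]) (simp only: series, simp)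
    then show ?thesis
      by (auto simp: ennreal_mult_less_top)
  qed
  define \<mu> where "\<mu> k = enn2real (m k)" for k
  have m_\<mu>: "m k = ennreal (\<mu> k)" for k
    using fin[of k] by (simp add: \<mu>_def)
  have \<mu>0: "0 \<le> \<mu> k" for k
    by (simp add: \<mu>_def)
  have sums1: "(\<lambda>k. t ^ (2 * k) / fact (2 * k) * \<mu> k) sums exp (t\<^sup>2 * v / 2)" for t :: real
  proof -
    have "ennreal (t ^ (2 * k) / fact (2 * k)) * m k = ennreal (t ^ (2 * k) / fact (2 * k) * \<mu> k)" for k
      unfolding m_\<mu> by (rule ennreal_mult[symmetric]) (use \<mu>0 in auto)
    then have "(\<lambda>k. ennreal (t ^ (2 * k) / fact (2 * k) * \<mu> k)) sums ennreal (exp (t\<^sup>2 * v / 2))"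
      using series[of t] by (simp add: sums_iff)
    then show ?thesis
      using \<mu>0 by (subst (asm) sums_ennreal) auto
  qed
  have sums2: "(\<lambda>k. t ^ (2 * k) * ((v / 2) ^ k / fact k)) sums exp (t\<^sup>2 * v / 2)" for t :: real
  proof -
    have "(t\<^sup>2 * v / 2) ^ k = t ^ (2 * k) * (v / 2) ^ k" for k
      by (simp add: power_mult_distrib power_mult power_divide)
    then have "(t\<^sup>2 * v / 2) ^ k /\<^sub>R fact k = t ^ (2 * k) * ((v / 2) ^ k / fact k)" for k
      by (simp add: field_simps)
    then show ?thesis
      using exp_converges[of "t\<^sup>2 * v / 2"] by simp
  qed
  \<comment> \<open>Difference of the two series written in all powers of t, with zeros at odd
    indices, so that uniqueness of power series applies.\<close>
  define e where "e j = (if even j then \<mu> (j div 2) / fact j - (v / 2) ^ (j div 2) / fact (j div 2) else 0)" for j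
  have "(\<lambda>j. e j * t ^ j) sums 0" for t
  proof -
    let ?E = "\<lambda>j. (\<mu> (j div 2) / fact j - (v / 2) ^ (j div 2) / fact (j div 2)) * t ^ j"
    have "(\<lambda>k. t ^ (2 * k) / fact (2 * k) * \<mu> k - t ^ (2 * k) * ((v / 2) ^ k / fact k)) = (\<lambda>k. ?E (2 * k))"
      by (intro ext) (simp add: algebra_simps)
    then have "(\<lambda>k. ?E (2 * k)) sums 0"
      using sums_diff[OF sums1[of t] sums2[of t]] by simp
    moreover have "(\<lambda>j. e j * t ^ j) = (\<lambda>j. if even j then ?E j else 0)"
      by (auto simp: e_def)
    ultimately show ?thesis
      by (simp only: sums_even_iff[of ?E 0])
  qed
  then have "e (2 * k) = 0"
    by (rule powser_zero_coeff)
  then have "\<mu> k = fact (2 * k) / (2 ^ k * fact k) * v ^ k"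
    by (simp add: e_def field_simps)
  with m_\<mu>[of k] \<mu>0[of k] show ?thesis
    unfolding m_def by (intro has_bochner_integral_nn_integral) auto
qed

section \<open>The Gaussian in simplex coordinates\<close>

definition full_dev :: "nat \<Rightarrow> (nat \<Rightarrow> real) \<Rightarrow> (nat \<Rightarrow> real) \<Rightarrow> nat \<Rightarrow> real" where
  "full_dev d p \<theta> l = (case l of 0 \<Rightarrow> - (\<Sum>i<d. \<theta> i - p (Suc i)) | Suc i \<Rightarrow> \<theta> i - p (Suc i))"

lemma full_dev_simps [simp]:
  "full_dev d p \<theta> 0 = - (\<Sum>i<d. \<theta> i - p (Suc i))"
  "full_dev d p \<theta> (Suc i) = \<theta> i - p (Suc i)"
  by (simp_all add: full_dev_def)

lemma sum_full_dev: "(\<Sum>l\<le>d. full_dev d p \<theta> l) = 0"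
  by (simp add: sum.atMost_shift)

lemma measurable_full_dev [measurable]:
  "l \<le> d \<Longrightarrow> (\<lambda>\<theta>. full_dev d p \<theta> l) \<in> borel_measurable (lebesgue_d d)"
  by (cases l) auto

text \<open>The exponent is the inverse covariance form expressed in all d + 1 coordinates. The
  product over all p_l, p_0 included, is n^d times the determinant of the covariance of the last d
  coordinates.\<close>

definition gauss_density :: "nat \<Rightarrow> nat \<Rightarrow> (nat \<Rightarrow> real) \<Rightarrow> (nat \<Rightarrow> real) \<Rightarrow> real" where
  "gauss_density d n p \<theta> = exp (- real n / 2 * (\<Sum>l\<le>d. (full_dev d p \<theta> l)\<^sup>2 / p l))
     / sqrt ((2 * pi / real n) ^ d * (\<Prod>l\<le>d. p l))"

lemma measurable_gauss_density [measurable]: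
  "gauss_density d n p \<in> borel_measurable (lebesgue_d d)"
  unfolding gauss_density_def by measurable

locale simplex_weights =
  fixes d n :: nat and p :: "nat \<Rightarrow> real"
  assumes d_pos: "1 \<le> d" and n_pos: "0 < n" and p_pos: "\<And>l. l \<le> d \<Longrightarrow> 0 < p l"
    and p_sum: "(\<Sum>l\<le>d. p l) = 1"
begin

abbreviation "z \<equiv> full_dev d p"
abbreviation "g \<equiv> gauss_density d n p"

definition gauss_measure :: "(nat \<Rightarrow> real) measure" where
  "gauss_measure = density (lebesgue_d d) (\<lambda>\<theta>. ennreal (g \<theta>))"

lemma p_nz: "l \<le> d \<Longrightarrow> p l \<noteq> 0"
  using p_pos[of l] by simp

lemma g_pos: "0 < g \<theta>"
  unfolding gauss_density_def using p_pos n_pos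
  by (intro divide_pos_pos real_sqrt_gt_zero mult_pos_pos zero_less_power prod_pos) auto

lemma g_nonneg: "0 \<le> g \<theta>"
  using g_pos[of \<theta>] by simp

lemma nn_integral_g: "(\<integral>\<^sup>+\<theta>. ennreal (g \<theta>) \<partial>lebesgue_d d) = 1"
proof -
  define c where "c = sqrt ((2 * pi / real n) ^ d * (\<Prod>l\<le>d. p l))"
  have c: "0 < c"
    unfolding c_def using p_pos n_pos by (intro real_sqrt_gt_zero mult_pos_pos zero_less_power prod_pos) auto
  have sum1: "p 0 + (\<Sum>i<d. p (Suc i)) = 1"
    using p_sum by (simp add: sum.atMost_shift)
  have "(\<integral>\<^sup>+\<theta>. ennreal (g \<theta>) \<partial>lebesgue_d d)
      = (\<integral>\<^sup>+\<theta>. ennreal (1 / c) * ennreal (exp (- real n / 2 *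
          ((\<Sum>i<d. (\<theta> i - p (Suc i))\<^sup>2 / p (Suc i)) + (0 + (\<Sum>i<d. \<theta> i - p (Suc i)))\<^sup>2 / p 0))) \<partial>lebesgue_d d)"
    using c by (intro nn_integral_cong)
      (simp add: gauss_density_def c_def[symmetric] ennreal_mult[symmetric] sum.atMost_shift add.commute)
  also have "\<dots> = ennreal (1 / c) * (\<integral>\<^sup>+\<theta>. ennreal (exp (- real n / 2 *
          ((\<Sum>i<d. (\<theta> i - p (Suc i))\<^sup>2 / p (Suc i)) + (0 + (\<Sum>i<d. \<theta> i - p (Suc i)))\<^sup>2 / p 0))) \<partial>lebesgue_d d)"
    by (rule nn_integral_cmult) measurable
  also have "(\<integral>\<^sup>+\<theta>. ennreal (exp (- real n / 2 *
          ((\<Sum>i<d. (\<theta> i - p (Suc i))\<^sup>2 / p (Suc i)) + (0 + (\<Sum>i<d. \<theta> i - p (Suc i)))\<^sup>2 / p 0))) \<partial>lebesgue_d d) = ennreal c"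
    using n_pos p_pos sum1
    by (subst nn_integral_gaussian_simplex) (auto simp: c_def prod.atMost_shift mult_ac)
  also have "ennreal (1 / c) * ennreal c = 1"
    using c by (simp add: ennreal_mult[symmetric])
  finally show ?thesis .
qed

sublocale gauss: prob_space gauss_measure
  by standard (simp add: gauss_measure_def emeasure_density nn_integral_g cong: nn_integral_cong)

lemma sets_gauss_measure [measurable_cong, simp]: "sets gauss_measure = sets (lebesgue_d d)"
  by (simp add: gauss_measure_def)

text \<open>Variance of the linear form with coefficients \<open>c\<close> in the z_l: the variance
  of \<open>c\<close> under the weights \<open>p\<close>, divided by \<open>n\<close>.\<close>

definition lin_var :: "(nat \<Rightarrow> real) \<Rightarrow> real" where
  "lin_var c = ((\<Sum>l\<le>d. p l * (c l)\<^sup>2) - (\<Sum>l\<le>d. p l * c l)\<^sup>2) / real n"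

lemma lin_var_centered:
  "lin_var c = (\<Sum>l\<le>d. p l * (c l - (\<Sum>l\<le>d. p l * c l))\<^sup>2) / real n"
proof -
  define b where "b = (\<Sum>l\<le>d. p l * c l)"
  have "(\<Sum>l\<le>d. p l * (c l - b)\<^sup>2) = (\<Sum>l\<le>d. p l * (c l)\<^sup>2 - 2 * b * (p l * c l) + b\<^sup>2 * p l)"
    by (intro sum.cong) (auto simp: power2_eq_square algebra_simps)
  also have "\<dots> = (\<Sum>l\<le>d. p l * (c l)\<^sup>2) - 2 * b * b + b\<^sup>2 * 1"
    by (simp add: sum.distrib sum_subtractf sum_distrib_left[symmetric] p_sum b_def)
  finally show ?thesis
    by (simp add: lin_var_def b_def[symmetric] power2_eq_square)
qed

lemma lin_var_nonneg: "0 \<le> lin_var c"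
  unfolding lin_var_centered using p_pos by (intro divide_nonneg_nonneg sum_nonneg mult_nonneg_nonneg) (auto intro: less_imp_le)

lemma z_shift:
  assumes "l \<le> d"
  shows "z (\<lambda>i\<in>{..<d}. a (Suc i) + s * \<theta> i) l
    = (case l of 0 \<Rightarrow> - (\<Sum>i<d. a (Suc i) + s * \<theta> i - p (Suc i)) | Suc i \<Rightarrow> a (Suc i) + s * \<theta> i - p (Suc i))"
  using assms by (auto split: nat.split intro!: sum.cong)

text \<open>Completing the square amounts to translating by the covariance applied to \<open>c\<close>.\<close>

lemma gauss_mgf:
  "(\<integral>\<^sup>+\<theta>. ennreal (exp (\<Sum>l\<le>d. c l * z \<theta> l)) \<partial>gauss_measure) = ennreal (exp (lin_var c / 2))"
proof -
  define b where "b = (\<Sum>l\<le>d. p l * c l)"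
  define a where "a l = p l * (c l - b) / real n" for l
  have a_sum: "(\<Sum>l\<le>d. a l) = 0"
  proof -
    have "(\<Sum>l\<le>d. a l) = (\<Sum>l\<le>d. p l * c l - b * p l) / real n"
      unfolding sum_divide_distrib by (intro sum.cong) (auto simp: a_def algebra_simps)
    then show ?thesis
      by (simp add: sum_subtractf sum_distrib_left[symmetric] b_def p_sum)
  qed
  have z: "z (\<lambda>i\<in>{..<d}. a (Suc i) + 1 * \<theta> i) l = z \<theta> l + a l" if "l \<le> d" for \<theta> l
  proof (cases l)
    case 0
    have "a 0 = - (\<Sum>i<d. a (Suc i))"
      using a_sum by (simp add: sum.atMost_shift)
    then show ?thesis
      unfolding z_shift[OF that] 0 by (simp add: sum.distrib sum_subtractf)
  qed (use that in \<open>simp add: z_shift\<close>)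
  have vc: "(\<Sum>l\<le>d. c l * a l) = lin_var c"
  proof -
    have "(\<Sum>l\<le>d. c l * a l) = (\<Sum>l\<le>d. p l * (c l)\<^sup>2 - b * (p l * c l)) / real n"
      unfolding sum_divide_distrib by (intro sum.cong) (auto simp: a_def power2_eq_square algebra_simps)
    then show ?thesis
      by (simp add: lin_var_def sum_subtractf sum_distrib_left[symmetric] b_def power2_eq_square)
  qed
  have va: "(\<Sum>l\<le>d. (a l)\<^sup>2 / p l) = lin_var c / real n"
  proof -
    have "(\<Sum>l\<le>d. (a l)\<^sup>2 / p l) = (\<Sum>l\<le>d. p l * (c l - b)\<^sup>2 / real n / real n)"
      using n_pos by (intro sum.cong) (auto simp: a_def power2_eq_square field_simps p_nz)
    then show ?thesis
      by (simp add: lin_var_centered b_def sum_divide_distrib)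
  qed
  have vz: "(\<Sum>l\<le>d. z \<theta> l * a l / p l) = (\<Sum>l\<le>d. c l * z \<theta> l) / real n" for \<theta>
  proof -
    have "(\<Sum>l\<le>d. z \<theta> l * a l / p l) = (\<Sum>l\<le>d. c l * z \<theta> l - b * z \<theta> l) / real n"
      unfolding sum_divide_distrib 
      using n_pos by (intro sum.cong) (auto simp: a_def field_simps p_nz)
    then show ?thesis
      using sum_full_dev[of d p \<theta>] by (simp add: sum_subtractf sum_distrib_left[symmetric])
  qed
  have shift: "exp (\<Sum>l\<le>d. c l * (z \<theta> l + a l)) * exp (- real n / 2 * (\<Sum>l\<le>d. (z \<theta> l + a l)\<^sup>2 / p l))
      = exp (lin_var c / 2) * exp (- real n / 2 * (\<Sum>l\<le>d. (z \<theta> l)\<^sup>2 / p l))" for \<theta>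
  proof -
    have "(\<Sum>l\<le>d. (z \<theta> l + a l)\<^sup>2 / p l) = (\<Sum>l\<le>d. (z \<theta> l)\<^sup>2 / p l + 2 * (z \<theta> l * a l / p l) + (a l)\<^sup>2 / p l)"
      by (intro sum.cong) (auto simp: power2_eq_square algebra_simps add_divide_distrib)
    also have "\<dots> = (\<Sum>l\<le>d. (z \<theta> l)\<^sup>2 / p l) + 2 * ((\<Sum>l\<le>d. c l * z \<theta> l) / real n) + lin_var c / real n"
      by (simp only: sum.distrib sum_distrib_left[symmetric] vz va)
    finally have "(\<Sum>l\<le>d. c l * (z \<theta> l + a l)) + - real n / 2 * (\<Sum>l\<le>d. (z \<theta> l + a l)\<^sup>2 / p l)
        = lin_var c / 2 + - real n / 2 * (\<Sum>l\<le>d. (z \<theta> l)\<^sup>2 / p l)"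
      using n_pos by (simp add: ring_distribs sum.distrib vc)
    then show ?thesis
      by (simp add: exp_add[symmetric])
  qed
  have "(\<integral>\<^sup>+\<theta>. ennreal (exp (\<Sum>l\<le>d. c l * z \<theta> l)) \<partial>gauss_measure)
      = (\<integral>\<^sup>+\<theta>. ennreal (g \<theta> * exp (\<Sum>l\<le>d. c l * z \<theta> l)) \<partial>lebesgue_d d)"
    unfolding gauss_measure_def by (subst nn_integral_density) (auto simp: ennreal_mult g_nonneg)
  also have "\<dots> = (\<integral>\<^sup>+\<theta>. ennreal (g (\<lambda>i\<in>{..<d}. a (Suc i) + 1 * \<theta> i)
      * exp (\<Sum>l\<le>d. c l * z (\<lambda>i\<in>{..<d}. a (Suc i) + 1 * \<theta> i) l)) \<partial>lebesgue_d d)"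
    by (rule nn_integral_lebesgue_d_affine[of 1, symmetric]) (simp, measurable)
  also have "\<dots> = (\<integral>\<^sup>+\<theta>. ennreal (exp (lin_var c / 2)) * ennreal (g \<theta>) \<partial>lebesgue_d d)"
  proof (intro nn_integral_cong)
    fix \<theta> :: "nat \<Rightarrow> real"
    have "g (\<lambda>i\<in>{..<d}. a (Suc i) + 1 * \<theta> i) * exp (\<Sum>l\<le>d. c l * z (\<lambda>i\<in>{..<d}. a (Suc i) + 1 * \<theta> i) l)
        = exp (lin_var c / 2) * g \<theta>"
      using shift[of \<theta>] z unfolding gauss_density_def by (simp add: mult.commute)
    then show "ennreal (g (\<lambda>i\<in>{..<d}. a (Suc i) + 1 * \<theta> i) * exp (\<Sum>l\<le>d. c l * z (\<lambda>i\<in>{..<d}. a (Suc i) + 1 * \<theta> i) l))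
        = ennreal (exp (lin_var c / 2)) * ennreal (g \<theta>)"
      by (simp add: ennreal_mult g_nonneg)
  qed
  also have "\<dots> = ennreal (exp (lin_var c / 2))"
    by (subst nn_integral_cmult) (auto simp: nn_integral_g)
  finally show ?thesis .
qed

lemma gauss_even_moment:
  "has_bochner_integral gauss_measure (\<lambda>\<theta>. (\<Sum>l\<le>d. c l * z \<theta> l) ^ (2 * k))
     (fact (2 * k) / (2 ^ k * fact k) * lin_var c ^ k)"
proof (rule even_moments_of_mgf)
  fix t :: real
  have "lin_var (\<lambda>l. t * c l) = t\<^sup>2 * lin_var c"
  proof -
    have "(\<Sum>l\<le>d. p l * (t * c l)\<^sup>2) = t\<^sup>2 * (\<Sum>l\<le>d. p l * (c l)\<^sup>2)"
      "(\<Sum>l\<le>d. p l * (t * c l)) = t * (\<Sum>l\<le>d. p l * c l)"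
      unfolding sum_distrib_left by (intro sum.cong; simp add: power_mult_distrib)+
    then show ?thesis
      by (simp add: lin_var_def power_mult_distrib right_diff_distrib)
  qed
  then show "(\<integral>\<^sup>+\<theta>. ennreal (exp (t * (\<Sum>l\<le>d. c l * z \<theta> l))) \<partial>gauss_measure) = ennreal (exp (t\<^sup>2 * lin_var c / 2))"
    using gauss_mgf[of "\<lambda>l. t * c l"] by (simp add: sum_distrib_left mult.assoc)
qed (auto intro: lin_var_nonneg)

end

text \<open>
  Polarisation: the odd differences of $b \mapsto (x + by)^6$ at $b = 1, 2, 3$ isolate the coefficient of $x^3y^3$.
\<close>

lemma cube_mult_cube_by_differences:
  fixes x y :: real
  shows "8 * ((x + 2 * y) ^ 6 - (x - 2 * y) ^ 6) - 13 * ((x + y) ^ 6 - (x - y) ^ 6)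
    - ((x + 3 * y) ^ 6 - (x - 3 * y) ^ 6) = 960 * (x ^ 3 * y ^ 3)"
  by (simp add: eval_nat_numeral algebra_simps)

text \<open>The same combination of differences applied to the sixth moments 15 (u + 2 b v + b^2
  w)^3, where \<open>u\<close> and \<open>w\<close> are variances and \<open>v\<close> is the
  covariance. The weights 8, -13, -1 at b = 2, 1, 3 annihilate b and b^5 and send b^3 to 24, whence
  960 = 24 * 40.\<close>

lemma cube_by_differences:
  fixes u v w :: real
  shows "8 * (15 * (u + 4 * v + 4 * w) ^ 3 - 15 * (u - 4 * v + 4 * w) ^ 3)
    - 13 * (15 * (u + 2 * v + w) ^ 3 - 15 * (u - 2 * v + w) ^ 3)
    - (15 * (u + 6 * v + 9 * w) ^ 3 - 15 * (u - 6 * v + 9 * w) ^ 3) = 960 * (9 * u * w * v + 6 * v ^ 3)"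
  by (simp add: eval_nat_numeral algebra_simps)

context simplex_weights
begin

definition cov :: "nat \<Rightarrow> nat \<Rightarrow> real" where
  "cov l m = ((if l = m then p l else 0) - p l * p m) / real n"

lemma gauss_moment6_pair:
  assumes "l \<le> d" "m \<le> d"
  shows "has_bochner_integral gauss_measure (\<lambda>\<theta>. (z \<theta> l + b * z \<theta> m) ^ 6)
    (15 * (cov l l + 2 * b * cov l m + b\<^sup>2 * cov m m) ^ 3)"
proof -
  define c :: "nat \<Rightarrow> real" where "c = (\<lambda>j. (if j = l then 1 else 0) + b * (if j = m then 1 else 0))"
  have lin: "(\<Sum>j\<le>d. c j * f j) = f l + b * f m" for f
  proof -
    have "(\<Sum>j\<le>d. c j * f j) = (\<Sum>j\<le>d. (if j = l then f j else 0) + b * (if j = m then f j else 0))"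
      by (intro sum.cong) (auto simp: c_def distrib_right)
    then show ?thesis
      using assms by (simp add: sum.distrib sum_distrib_left[symmetric])
  qed
  have "(\<Sum>j\<le>d. p j * (c j)\<^sup>2) = (\<Sum>j\<le>d. c j * (p j * c j))"
    by (intro sum.cong) (auto simp: power2_eq_square)
  then have "lin_var c = cov l l + 2 * b * cov l m + b\<^sup>2 * cov m m"
    using lin[of p] lin[of "\<lambda>j. p j * c j"]
    by (simp add: lin_var_def cov_def c_def add_divide_distrib[symmetric] diff_divide_distrib[symmetric] mult.commute)
       (auto simp: power2_eq_square algebra_simps add_divide_distrib diff_divide_distrib)
  moreover have "fact (2 * 3) / (2 ^ 3 * fact 3) = (15 :: real)"
    by (simp add: fact_numeral)
  ultimately show ?thesis
    using gauss_even_moment[of c 3] lin by simp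
qed

lemma gauss_moment_pair:
  assumes "l \<le> d" "m \<le> d"
  shows "has_bochner_integral gauss_measure (\<lambda>\<theta>. z \<theta> l ^ 3 * z \<theta> m ^ 3)
    (9 * cov l l * cov m m * cov l m + 6 * cov l m ^ 3)"
proof -
  define D where "D b \<theta> = (z \<theta> l + b * z \<theta> m) ^ 6" for b \<theta>
  define I where "I b = 15 * (cov l l + 2 * b * cov l m + b\<^sup>2 * cov m m) ^ 3" for b
  have D: "has_bochner_integral gauss_measure (D b) (I b)" for b
    using gauss_moment6_pair[OF assms, of b] unfolding D_def I_def .
  have "has_bochner_integral gauss_measure
     (\<lambda>\<theta>. (1 / 960) * (8 * (D 2 \<theta> - D (- 2) \<theta>) - 13 * (D 1 \<theta> - D (- 1) \<theta>) - (D 3 \<theta> - D (- 3) \<theta>)))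
     ((1 / 960) * (8 * (I 2 - I (- 2)) - 13 * (I 1 - I (- 1)) - (I 3 - I (- 3))))"
    by (intro has_bochner_integral_mult_right has_bochner_integral_diff D)
  moreover have "8 * (D 2 \<theta> - D (- 2) \<theta>) - 13 * (D 1 \<theta> - D (- 1) \<theta>) - (D 3 \<theta> - D (- 3) \<theta>)
      = 960 * (z \<theta> l ^ 3 * z \<theta> m ^ 3)" for \<theta>
    using cube_mult_cube_by_differences[of "z \<theta> l" "z \<theta> m"] by (simp add: D_def)
  moreover have "8 * (I 2 - I (- 2)) - 13 * (I 1 - I (- 1)) - (I 3 - I (- 3))
      = 960 * (9 * cov l l * cov m m * cov l m + 6 * cov l m ^ 3)"
    using cube_by_differences[of "cov l l" "cov l m" "cov m m"] by (simp add: I_def)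
  ultimately show ?thesis
    by (simp only: mult.assoc[symmetric]) simp
qed

lemma gauss_even_moment_coord:
  assumes "l \<le> d"
  shows "has_bochner_integral gauss_measure (\<lambda>\<theta>. z \<theta> l ^ (2 * k)) (fact (2 * k) / (2 ^ k * fact k) * cov l l ^ k)"
proof -
  define c :: "nat \<Rightarrow> real" where "c = (\<lambda>j. if j = l then 1 else 0)"
  have lin: "(\<Sum>j\<le>d. c j * f j) = f l" for f
    using assms by (simp add: c_def if_distrib[of "\<lambda>x. x * _"] cong: if_cong)
  have "(\<Sum>j\<le>d. p j * (c j)\<^sup>2) = (\<Sum>j\<le>d. c j * p j)"
    by (intro sum.cong) (auto simp: c_def)
  then have "lin_var c = cov l l"
    using lin[of p] by (simp add: lin_var_def cov_def mult.commute power2_eq_square)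
  then show ?thesis
    using gauss_even_moment[of c k] lin by simp
qed

lemma integral_gauss_measure:
  assumes [measurable]: "f \<in> borel_measurable (lebesgue_d d)"
  shows "(\<integral>\<theta>. f \<theta> \<partial>gauss_measure) = (\<integral>\<theta>. g \<theta> * f \<theta> \<partial>lebesgue_d d)"
    "integrable gauss_measure f \<longleftrightarrow> integrable (lebesgue_d d) (\<lambda>\<theta>. g \<theta> * f \<theta>)"
  unfolding gauss_measure_def by (subst integral_density integrable_density; auto simp: g_nonneg)+

text \<open>Reflection through the mean flips the sign of every z_l and preserves the density, so
  the integral equals its own negative.\<close>

lemma gauss_odd_moment_coord:
  assumes "l \<le> d"
  shows "(\<integral>\<theta>. z \<theta> l ^ 3 \<partial>gauss_measure) = 0"
proof -
  have z: "z (\<lambda>i\<in>{..<d}. 2 * p (Suc i) + (- 1) * \<theta> i) j = - z \<theta> j" if "j \<le> d" for j \<theta>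
    unfolding z_shift[of _ "\<lambda>i. 2 * p i", OF that]
    by (auto split: nat.split simp: sum_subtractf sum.distrib sum_negf sum_distrib_left[symmetric])
  have g: "g (\<lambda>i\<in>{..<d}. 2 * p (Suc i) + (- 1) * \<theta> i) = g \<theta>" for \<theta>
    unfolding gauss_density_def using z by simp
  have "(\<integral>\<theta>. g \<theta> * z \<theta> l ^ 3 \<partial>lebesgue_d d)
      = (\<integral>\<theta>. g (\<lambda>i\<in>{..<d}. 2 * p (Suc i) + (- 1) * \<theta> i) * z (\<lambda>i\<in>{..<d}. 2 * p (Suc i) + (- 1) * \<theta> i) l ^ 3 \<partial>lebesgue_d d)"
    using assms by (intro integral_lebesgue_d_affine[symmetric, where s = "- 1"]) auto
  also have "\<dots> = - (\<integral>\<theta>. g \<theta> * z \<theta> l ^ 3 \<partial>lebesgue_d d)"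
    unfolding z[OF assms] g by simp
  finally show ?thesis
    using assms by (subst integral_gauss_measure(1)) auto
qed

definition cubic :: "(nat \<Rightarrow> real) \<Rightarrow> real" where
  "cubic \<theta> = real n / 3 * (\<Sum>l\<le>d. z \<theta> l ^ 3 / (p l)\<^sup>2)"

lemma measurable_cubic [measurable]: "cubic \<in> borel_measurable (lebesgue_d d)"
  unfolding cubic_def by measurable

lemma cubic_square:
  "has_bochner_integral gauss_measure (\<lambda>\<theta>. (cubic \<theta>)\<^sup>2)
    ((real n)\<^sup>2 / 9 * (\<Sum>l\<le>d. \<Sum>m\<le>d. (9 * cov l l * cov m m * cov l m + 6 * cov l m ^ 3) / ((p l)\<^sup>2 * (p m)\<^sup>2)))"
proof -
  have sq: "(cubic \<theta>)\<^sup>2 = (real n)\<^sup>2 / 9 * (\<Sum>l\<le>d. \<Sum>m\<le>d. (z \<theta> l ^ 3 * z \<theta> m ^ 3) / ((p l)\<^sup>2 * (p m)\<^sup>2))" for \<theta>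
  proof -
    have "(\<Sum>l\<le>d. z \<theta> l ^ 3 / (p l)\<^sup>2)\<^sup>2 = (\<Sum>l\<le>d. \<Sum>m\<le>d. (z \<theta> l ^ 3 * z \<theta> m ^ 3) / ((p l)\<^sup>2 * (p m)\<^sup>2))"
      unfolding power2_eq_square[of "\<Sum>l\<le>d. z \<theta> l ^ 3 / (p l)\<^sup>2"] sum_product by simp
    then show ?thesis
      by (simp add: cubic_def power_mult_distrib power_divide)
  qed
  show ?thesis
    unfolding sq
    by (intro has_bochner_integral_mult_right has_bochner_integral_sum has_bochner_integral_divide_zero gauss_moment_pair) auto
qed

lemma integrable_cube_coord:
  assumes "l \<le> d"
  shows "integrable gauss_measure (\<lambda>\<theta>. z \<theta> l ^ 3)"
proof (rule Bochner_Integration.integrable_bound)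
  show "integrable gauss_measure (\<lambda>\<theta>. 1 + z \<theta> l ^ 6)"
    using gauss_even_moment_coord[OF assms, of 3] by (simp add: has_bochner_integral_iff)
  have "\<bar>x ^ 3\<bar> \<le> 1 + x ^ 6" for x :: real
  proof -
    have "0 \<le> (1 - \<bar>x ^ 3\<bar>)\<^sup>2"
      by simp
    also have "\<dots> = 1 - 2 * \<bar>x ^ 3\<bar> + x ^ 6"
      by (simp add: power2_diff power_mult[symmetric])
    finally show ?thesis
      using abs_ge_zero[of "x ^ 3"] by linarith
  qed
  moreover have "0 \<le> x ^ 6" for x :: real
    by simp
  ultimately show "AE \<theta> in gauss_measure. norm (z \<theta> l ^ 3) \<le> norm (1 + z \<theta> l ^ 6)"
    by (intro AE_I2) (metis abs_of_nonneg add_nonneg_nonneg real_norm_def zero_le_one)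
qed (use assms in measurable)

lemma cubic_mean: "integrable gauss_measure cubic" "(\<integral>\<theta>. cubic \<theta> \<partial>gauss_measure) = 0"
proof -
  have "integrable gauss_measure (\<lambda>\<theta>. z \<theta> l ^ 3 / (p l)\<^sup>2)" if "l \<le> d" for l
    by (intro integrable_divide_zero impI integrable_cube_coord that)
  then show "integrable gauss_measure cubic" "(\<integral>\<theta>. cubic \<theta> \<partial>gauss_measure) = 0"
    unfolding cubic_def by (auto simp: Bochner_Integration.integral_sum gauss_odd_moment_coord
      intro!: integrable_mult_right Bochner_Integration.integrable_sum)
qed

end

section \<open>Dirichlet moments\<close>

text \<open>Algebraic core of the induction step for Stein's identity: x_i and y_i stand for the
  mixed moments with first exponent j + i and second exponent \<open>k\<close> or k - 1. The
  recursion relating them carries the factor \<open>k\<close>, so that it also holds at k = 0, where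
  k - 1 is truncated.\<close>

lemma stein_step:
  fixes T \<alpha> m j k :: real
  assumes "k * x1 = k * (y2 - m * y1)" "k * x2 = k * (y3 - m * y2)"
    and "T * x1 - \<alpha> * x0 = j * (x0 - x1) + k * (y1 - y2)"
    and "T * x2 - \<alpha> * x1 = (1 + j) * (x1 - x2) + k * (y2 - y3)"
  shows "T * (x2 - m * x1) - \<alpha> * (x1 - m * x0) = j * (x1 - m * x0 - (x2 - m * x1)) + (1 + k) * (x1 - x2)"
proof -
  have "T * (x2 - m * x1) - \<alpha> * (x1 - m * x0) = (T * x2 - \<alpha> * x1) - m * (T * x1 - \<alpha> * x0)"
    by (simp add: algebra_simps)
  also have "\<dots> = j * (x1 - m * x0 - (x2 - m * x1)) + (x1 - x2) + (k * (y2 - m * y1) - k * (y3 - m * y2))"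
    unfolding assms(3,4) by (simp add: algebra_simps)
  also have "\<dots> = j * (x1 - m * x0 - (x2 - m * x1)) + (1 + k) * (x1 - x2)"
    unfolding assms(1,2)[symmetric] by (simp add: algebra_simps)
  finally show ?thesis .
qed

text \<open>
  The hypothesis \<open>rec\<close> is the moment recursion of the Beta distribution with parameters
  \<open>\<alpha>\<close> and \<open>T - \<alpha>\<close>; \<open>stein\<close> is Stein's identity for that distribution.
\<close>

locale beta_moments = prob_space M for M :: "'a measure" +
  fixes X :: "'a \<Rightarrow> real" and \<alpha> T :: real
  assumes X_meas [measurable]: "X \<in> borel_measurable M"
    and X_range: "AE x in M. 0 \<le> X x \<and> X x \<le> 1"
    and \<alpha>_ge: "1 \<le> \<alpha>" and \<alpha>_le: "\<alpha> \<le> T"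
    and rec: "\<And>k. (T + real k) * expectation (\<lambda>x. X x ^ Suc k) = (\<alpha> + real k) * expectation (\<lambda>x. X x ^ k)"
begin

definition "m = \<alpha> / T"

lemma T_pos: "0 < T"
  using \<alpha>_ge \<alpha>_le by simp

lemma m_bounds: "1 / T \<le> m" "0 < m" "m \<le> 1"
  using \<alpha>_ge \<alpha>_le T_pos by (auto simp: m_def divide_right_mono)

lemma integrable_mono [simp, intro]:
  "integrable M (\<lambda>x. X x ^ j * (X x - m) ^ k)"
proof (rule integrable_const_bound)
  show "AE x in M. norm (X x ^ j * (X x - m) ^ k) \<le> 1"
    using X_range
  proof eventually_elim
    case (elim x)
    then have "\<bar>X x\<bar> \<le> 1" "\<bar>X x - m\<bar> \<le> 1"
      using m_bounds by auto
    then show ?case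
      by (auto simp: abs_mult power_abs intro!: mult_le_one power_le_one)
  qed
qed measurable

definition "E j k = expectation (\<lambda>x. X x ^ j * (X x - m) ^ k)"

lemma E_Suc_right: "E j (Suc k) = E (Suc j) k - m * E j k"
proof -
  have "E j (Suc k) = expectation (\<lambda>x. X x ^ Suc j * (X x - m) ^ k - m * (X x ^ j * (X x - m) ^ k))"
    unfolding E_def by (intro arg_cong[of _ _ expectation] ext) (simp add: algebra_simps)
  then show ?thesis
    unfolding E_def
    by (subst (asm) Bochner_Integration.integral_diff) (auto intro: integrable_mult_right simp del: power_Suc)
qed

text \<open>With h(x) = x^j (x - m)^k this reads T E[x h] - \<alpha> E[h] = E[x (1 - x) h'(x)]. For
  k = 0 it is the raw moment recursion, and each factor x - m is then added by linearity.\<close>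

lemma stein:
  "T * E (Suc j) k - \<alpha> * E j k
    = real j * (E j k - E (Suc j) k) + real k * (E (Suc j) (k - 1) - E (Suc (Suc j)) (k - 1))"
proof (induction k arbitrary: j)
  case 0
  then show ?case
    using rec[of j] by (simp add: E_def algebra_simps)
next
  case (Suc k)
  have "real k * E j k = real k * (E (Suc j) (k - 1) - m * E j (k - 1))" for j
    by (cases k) (simp_all add: E_Suc_right)
  from this[of "Suc j"] this[of "Suc (Suc j)"] Suc[of j] Suc[of "Suc j"] show ?case
    unfolding E_Suc_right diff_Suc_1 of_nat_Suc by (rule stein_step)
qed

text \<open>Stein's identity for h(x) = (x - m)^k; since \<alpha> = T m, the left-hand side
  collapses to one central moment. For odd \<open>k\<close> the subtracted moment contains an even
  power and may be dropped.\<close>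

lemma central_moment_step:
  "T * E 0 (Suc k) \<le> real k * (m * E 0 (k - 1) + E 0 k)" if "odd k"
proof -
  have "T * E 0 (Suc k) = real k * (E 1 (k - 1) - E 2 (k - 1))"
    using stein[of 0 k] T_pos by (simp add: E_Suc_right m_def algebra_simps numeral_2_eq_2)
  also have "\<dots> \<le> real k * E 1 (k - 1)"
  proof -
    have "0 \<le> E 2 (k - 1)"
      unfolding E_def using that by (intro Bochner_Integration.integral_nonneg) (auto intro!: mult_nonneg_nonneg zero_le_even_power)
    then show ?thesis
      by (intro mult_left_mono) auto
  qed
  also have "E 1 (k - 1) = m * E 0 (k - 1) + E 0 k"
    using E_Suc_right[of 0 "k - 1"] that by (cases k) auto
  finally show ?thesis .
qed

text \<open>The odd moment has no sign, so it is traded for its two even neighbours by expanding (r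
  y^i - y^(i+1))^2 >= 0. The free parameter \<open>r\<close> allows the higher one to be
  absorbed.\<close>

lemma odd_central_moment_le:
  assumes "0 < r" "odd k"
  shows "E 0 k \<le> r / 2 * E 0 (k - 1) + E 0 (Suc k) / (2 * r)"
proof -
  obtain i where i: "k = Suc (2 * i)"
    using assms(2) by (elim oddE) simp
  have young: "y ^ k \<le> r / 2 * y ^ (k - 1) + y ^ Suc k / (2 * r)" for y :: real
  proof -
    have "0 \<le> (r * y ^ i - y ^ Suc i)\<^sup>2 / (2 * r)"
      using assms by simp
    also have "\<dots> = r / 2 * y ^ (k - 1) + y ^ Suc k / (2 * r) - y ^ k"
      using assms by (simp add: i power2_eq_square field_simps power_add[symmetric] mult_2[symmetric])
    finally show ?thesis by simp
  qed
  have int: "integrable M (\<lambda>x. (X x - m) ^ k)" for k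
    using integrable_mono[of 0 k] by simp
  have "E 0 k \<le> expectation (\<lambda>x. r / 2 * (X x - m) ^ (k - 1) + (X x - m) ^ Suc k / (2 * r))"
    unfolding E_def using young int
    by (intro integral_mono) (auto simp del: power_Suc intro!: Bochner_Integration.integrable_add integrable_mult_right integrable_divide_zero)
  also have "\<dots> = r / 2 * E 0 (k - 1) + E 0 (Suc k) / (2 * r)"
    unfolding E_def using int
    by (subst Bochner_Integration.integral_add) (auto simp del: power_Suc intro!: integrable_mult_right integrable_divide_zero)
  finally show ?thesis .
qed

text \<open>The second, fourth and sixth moments are bounded in turn, each step costing a multiple
  of m / T. The extra terms in 1 / T coming from odd moments are at most multiples of
  \<open>m\<close> because \<alpha> >= 1. The constants are 15 = 6 + 9, 35 = 10 + 25 and 525 = 15 *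
  35.\<close>

lemma central_moments:
  "expectation (\<lambda>x. (X x - m)\<^sup>2) \<le> m / T"
  "expectation (\<lambda>x. (X x - m) ^ 6) \<le> 525 * (m / T) ^ 3"
proof -
  have E00: "E 0 0 = 1"
    by (simp add: E_def prob_space)
  have E01: "E 0 1 = 0"
    using stein[of 0 0] T_pos by (simp add: E_Suc_right E00 m_def field_simps)
  have nonneg: "0 \<le> E 0 (2 * i)" for i
    unfolding E_def by (intro Bochner_Integration.integral_nonneg) auto
  have M2: "E 0 2 \<le> m / T"
    using central_moment_step[of 1] T_pos E01 by (simp add: E00 field_simps numeral_2_eq_2)
  \<comment> \<open>The bound on the odd moment \<open>e\<close> returns half of \<open>a\<close>,
    which is moved to the left. The choice r = c / T in the two applications, c = 3 and c = 5,
    produces exactly this half.\<close>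
  have absorb: "a \<le> 2 * c * b + c\<^sup>2 * x" if "a \<le> c * (b + e)" "e \<le> c / 2 * x + a / (2 * c)" "0 < c" for a b c e x :: real
  proof -
    have "c * e \<le> c * (c / 2 * x + a / (2 * c))"
      using that by (intro mult_left_mono) auto
    also have "\<dots> = c\<^sup>2 / 2 * x + a / 2"
      using that by (simp add: field_simps power2_eq_square)
    finally show ?thesis
      using that by (simp add: distrib_left)
  qed
  have M4: "E 0 4 \<le> 15 * (m / T) * E 0 2"
  proof -
    have "T * E 0 4 \<le> 3 * (m * E 0 2 + E 0 3)"
      using central_moment_step[of 3] by simp
    moreover have "E 0 3 \<le> 3 / 2 * (1 / T * E 0 2) + T * E 0 4 / (2 * 3)"
      using odd_central_moment_le[of "3 / T" 3] T_pos by (simp add: mult.commute)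
    ultimately have "T * E 0 4 \<le> 6 * m * E 0 2 + 9 * (1 / T * E 0 2)"
      using absorb[of "T * E 0 4" 3 "m * E 0 2" "E 0 3" "1 / T * E 0 2"] by simp
    also have "\<dots> = 6 * m * E 0 2 + 9 * (1 / T) * E 0 2"
      by simp
    also have "\<dots> \<le> 6 * m * E 0 2 + 9 * m * E 0 2"
      using m_bounds nonneg[of 1] by (intro add_left_mono mult_right_mono mult_left_mono) auto
    finally show ?thesis
      using T_pos by (simp add: field_simps)
  qed
  have M6: "E 0 6 \<le> 35 * (m / T) * E 0 4"
  proof -
    have "T * E 0 6 \<le> 5 * (m * E 0 4 + E 0 5)"
      using central_moment_step[of 5] by simp
    moreover have "E 0 5 \<le> 5 / 2 * (1 / T * E 0 4) + T * E 0 6 / (2 * 5)"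
      using odd_central_moment_le[of "5 / T" 5] T_pos by (simp add: mult.commute)
    ultimately have "T * E 0 6 \<le> 10 * m * E 0 4 + 25 * (1 / T * E 0 4)"
      using absorb[of "T * E 0 6" 5 "m * E 0 4" "E 0 5" "1 / T * E 0 4"] by simp
    also have "\<dots> = 10 * m * E 0 4 + 25 * (1 / T) * E 0 4"
      by simp
    also have "\<dots> \<le> 10 * m * E 0 4 + 25 * m * E 0 4"
      using m_bounds nonneg[of 2] by (intro add_left_mono mult_right_mono mult_left_mono) auto
    finally show ?thesis
      using T_pos by (simp add: field_simps)
  qed
  have mT: "0 \<le> m / T"
    using m_bounds T_pos by simp
  have "E 0 6 \<le> 35 * (m / T) * (15 * (m / T) * (m / T))"
    using M2 M4 M6 mT by (meson mult_left_mono mult_nonneg_nonneg order_trans zero_le_numeral)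
  then show "expectation (\<lambda>x. (X x - m) ^ 6) \<le> 525 * (m / T) ^ 3"
    by (simp add: E_def power3_eq_cube)
  show "expectation (\<lambda>x. (X x - m)\<^sup>2) \<le> m / T"
    using M2 by (simp add: E_def)
qed

end

section \<open>Dirichlet densities with integer exponents and their moment recursion\<close>

abbreviation "sp \<equiv> simplex_point"

lemma simplex_point_simps:
  "sp d \<theta> 0 = 1 - (\<Sum>i<d. \<theta> i)"
  "i < d \<Longrightarrow> sp d \<theta> (Suc i) = \<theta> i"
  by (auto simp: simplex_point_def)

lemma Theta_eq: "1 \<le> d \<Longrightarrow> Theta d = {\<theta>. (\<forall>i<d. 0 < \<theta> i) \<and> (\<Sum>i<d. \<theta> i) < 1}"
proof (intro equalityI subsetI)
  fix \<theta> :: "nat \<Rightarrow> real" assume d: "1 \<le> d" and \<theta>: "\<theta> \<in> {\<theta>. (\<forall>i<d. 0 < \<theta> i) \<and> (\<Sum>i<d. \<theta> i) < 1}"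
  then have "\<theta> i \<le> (\<Sum>i<d. \<theta> i)" if "i < d" for i
    using that by (intro member_le_sum) (auto intro: less_imp_le)
  moreover have "0 < (\<Sum>i<d. \<theta> i)"
    using d \<theta> by (intro sum_pos) (auto intro: exI[of _ 0] simp: set_eq_iff)
  ultimately show "\<theta> \<in> Theta d"
    using \<theta> by (force simp: Theta_def)
qed (auto simp: Theta_def)

lemma Theta_iff: "1 \<le> d \<Longrightarrow> \<theta> \<in> Theta d \<longleftrightarrow> (\<forall>j\<le>d. 0 < sp d \<theta> j)"
  using All_less_Suc2[of d "\<lambda>j. 0 < sp d \<theta> j"] by (auto simp: Theta_eq simplex_point_simps less_Suc_eq_le)

lemma sum_simplex_point: "(\<Sum>j\<le>d. sp d \<theta> j) = 1"
  by (simp add: sum.atMost_shift simplex_point_simps)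

lemma simplex_point_le_1: "1 \<le> d \<Longrightarrow> \<theta> \<in> Theta d \<Longrightarrow> j \<le> d \<Longrightarrow> sp d \<theta> j \<le> 1"
  using member_le_sum[of j "{..d}" "sp d \<theta>"] sum_simplex_point[of d \<theta>]
  by (auto simp: Theta_iff intro: less_imp_le)

definition simplex_monomial :: "nat \<Rightarrow> (nat \<Rightarrow> nat) \<Rightarrow> (nat \<Rightarrow> real) \<Rightarrow> real" where
  "simplex_monomial d M \<theta> = indicator (Theta d) \<theta> * (\<Prod>j\<le>d. sp d \<theta> j ^ M j)"

definition simplex_moment :: "nat \<Rightarrow> (nat \<Rightarrow> nat) \<Rightarrow> real" where
  "simplex_moment d M = (\<integral>\<theta>. simplex_monomial d M \<theta> \<partial>lebesgue_d d)"

lemma dirichlet_kernel_eq: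
  assumes "1 \<le> d"
  shows "dirichlet_kernel d (\<lambda>j. real (M j) + 1) = simplex_monomial d M"
  unfolding dirichlet_kernel_def simplex_monomial_def
  using Theta_iff[OF assms] by (intro ext) (auto simp: indicator_def powr_realpow intro!: prod.cong)

lemma measurable_simplex_point_coord [measurable]:
  "j \<le> d \<Longrightarrow> (\<lambda>\<theta>. sp d \<theta> j) \<in> borel_measurable (lebesgue_d d)"
  by (cases j) (auto simp: simplex_point_simps)

lemma measurable_simplex_point: "sp d \<in> measurable (lebesgue_d d) (Pi\<^sub>M {..d} (\<lambda>_. lborel))"
proof -
  have "(\<lambda>\<theta>. \<lambda>j\<in>{..d}. sp d \<theta> j) \<in> measurable (lebesgue_d d) (Pi\<^sub>M {..d} (\<lambda>_. lborel))"
    by (rule measurable_restrict) simp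
  moreover have "sp d = (\<lambda>\<theta>. \<lambda>j\<in>{..d}. sp d \<theta> j)"
    by (auto simp: simplex_point_def fun_eq_iff)
  ultimately show ?thesis
    by simp
qed

lemma indicator_Theta:
  assumes "1 \<le> d"
  shows "indicator (Theta d) \<theta> = (\<Prod>j\<le>d. indicator {0<..} (sp d \<theta> j) :: real)"
  using Theta_iff[OF assms, of \<theta>] by (auto simp: indicator_def)

lemma measurable_simplex_monomial [measurable]:
  assumes "1 \<le> d"
  shows "simplex_monomial d M \<in> borel_measurable (lebesgue_d d)"
  unfolding simplex_monomial_def indicator_Theta[OF assms] by measurable

lemma simplex_monomial_nonneg: "1 \<le> d \<Longrightarrow> 0 \<le> simplex_monomial d M \<theta>"
  by (auto simp: simplex_monomial_def indicator_def Theta_iff simp: less_imp_le intro!: prod_nonneg zero_le_power)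

lemma finite_box: "emeasure (lebesgue_d d) (Pi\<^sub>E {..<d} (\<lambda>_. {0..1})) = 1"
  by (subst lborel_product.emeasure_PiM) auto

lemma simplex_monomial_le:
  assumes "1 \<le> d" "\<theta> \<in> space (lebesgue_d d)"
  shows "simplex_monomial d M \<theta> \<le> indicator (Pi\<^sub>E {..<d} (\<lambda>_. {0..1})) \<theta>"
proof (cases "\<theta> \<in> Theta d")
  case True
  then have "(\<Prod>j\<le>d. sp d \<theta> j ^ M j) \<le> 1"
    using assms(1) by (intro prod_le_1) (auto simp: Theta_iff simplex_point_le_1 power_le_one less_imp_le)
  moreover have "\<theta> \<in> Pi\<^sub>E {..<d} (\<lambda>_. {0..1})"
    using True assms(2) by (auto simp: Theta_def space_PiM PiE_iff less_imp_le)
  ultimately show ?thesis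
    using True by (simp add: simplex_monomial_def)
qed (simp add: simplex_monomial_def)

lemma integrable_simplex_monomial:
  assumes "1 \<le> d"
  shows "integrable (lebesgue_d d) (simplex_monomial d M)"
proof (rule Bochner_Integration.integrable_bound)
  show "integrable (lebesgue_d d) (indicator (Pi\<^sub>E {..<d} (\<lambda>_. {0..1})) :: _ \<Rightarrow> real)"
    by (rule integrable_real_indicator) (auto simp: finite_box intro!: sets_PiM_I_finite)
  show "AE \<theta> in lebesgue_d d. norm (simplex_monomial d M \<theta>) \<le> norm (indicator (Pi\<^sub>E {..<d} (\<lambda>_. {0..1})) \<theta> :: real)"
    using simplex_monomial_le[OF assms] simplex_monomial_nonneg[OF assms] by (intro AE_I2) simp
qed (use assms in measurable)

lemma simplex_moment_pos:
  assumes "1 \<le> d"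
  shows "0 < simplex_moment d M"
proof -
  \<comment> \<open>On the box with sides from e to 2 e the coordinate of index 0 is at least 1 - 2
    e d = 2 e, so all d + 1 coordinates are at least e.\<close>
  define e where "e = 1 / (2 * real (Suc d))"
  let ?B = "Pi\<^sub>E {..<d} (\<lambda>_. {e..2 * e})"
  have e: "0 < e" "2 * e * real (Suc d) = 1"
    by (auto simp: e_def)
  have box: "e \<le> sp d \<theta> j" if "\<theta> \<in> ?B" "j \<le> d" for \<theta> j
  proof (cases j)
    case 0
    have "(\<Sum>i<d. \<theta> i) \<le> (\<Sum>i<d. 2 * e)"
      using that by (intro sum_mono) (auto simp: PiE_iff)
    then show ?thesis
      using e by (simp add: 0 simplex_point_simps algebra_simps)
  next
    case (Suc i)
    then show ?thesis
      using that by (auto simp: simplex_point_simps PiE_iff)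
  qed
  have le: "(\<Prod>j\<le>d. e ^ M j) * indicator ?B \<theta> \<le> simplex_monomial d M \<theta>" for \<theta>
  proof (cases "\<theta> \<in> ?B")
    case True
    then have "\<theta> \<in> Theta d"
      using box[OF True] e(1) by (force simp: Theta_iff[OF assms])
    moreover have "(\<Prod>j\<le>d. e ^ M j) \<le> (\<Prod>j\<le>d. sp d \<theta> j ^ M j)"
      using box[OF True] e(1) by (intro prod_mono) (auto intro!: power_mono)
    ultimately show ?thesis
      using True by (simp add: simplex_monomial_def)
  qed (simp add: simplex_monomial_nonneg[OF assms])
  have em: "emeasure (lebesgue_d d) ?B = ennreal (e ^ d)"
    using e by (subst lborel_product.emeasure_PiM) (auto simp: ennreal_power)
  have "0 < (\<Prod>j\<le>d. e ^ M j) * e ^ d"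
    using e by (intro mult_pos_pos prod_pos) auto
  also have "\<dots> = (\<integral>\<theta>. (\<Prod>j\<le>d. e ^ M j) * indicator ?B \<theta> \<partial>lebesgue_d d)"
    using em e by (simp add: measure_def sets_PiM_I_finite)
  also have "\<dots> \<le> simplex_moment d M"
    unfolding simplex_moment_def using le em
    by (intro integral_mono integrable_simplex_monomial[OF assms] integrable_mult_right integrable_real_indicator)
      (auto intro!: sets_PiM_I_finite)
  finally show ?thesis .
qed

text \<open>The integrand is the derivative of t^(a+1) (s - t)^(b+1), which vanishes at both ends of
  the interval; for negative \<open>s\<close> the interval is empty.\<close>

lemma integral_beta_derivative:
  fixes s :: real
  shows "(\<integral>t. indicator {0<..<s} t * (real (Suc a) * t ^ a * (s - t) ^ Suc b - real (Suc b) * t ^ Suc a * (s - t) ^ b) \<partial>lborel) = 0"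
proof (cases "0 \<le> s")
  case True
  let ?f = "\<lambda>t. real (Suc a) * t ^ a * (s - t) ^ Suc b - real (Suc b) * t ^ Suc a * (s - t) ^ b"
  have "(\<integral>t. ?f t * indicator {0..s} t \<partial>lborel) = s ^ Suc a * (s - s) ^ Suc b - 0 ^ Suc a * (s - 0) ^ Suc b"
  proof (rule integral_FTC_Icc_real[OF True])
    show "((\<lambda>t. t ^ Suc a * (s - t) ^ Suc b) has_real_derivative ?f t) (at t)" for t
    proof -
      have "((\<lambda>t. s - t) has_real_derivative - 1) (at t)"
        by (auto intro!: derivative_eq_intros)
      from DERIV_mult[OF DERIV_pow[of "Suc a" t] DERIV_power[OF this, of "Suc b"]] show ?thesis
        by (simp add: algebra_simps)
    qed
    show "isCont ?f t" for t
      by (intro continuous_intros)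
  qed
  moreover have "(\<integral>t. indicator {0<..<s} t * ?f t \<partial>lborel) = (\<integral>t. ?f t * indicator {0..s} t \<partial>lborel)"
  proof (rule integral_cong_AE)
    show "AE t in lborel. indicator {0<..<s} t * ?f t = ?f t * indicator {0..s} t"
      using AE_lborel_singleton[of 0] AE_lborel_singleton[of s]
      by eventually_elim (auto simp: indicator_def)
  qed auto
  ultimately show ?thesis
    by simp
qed (simp add: indicator_def)

abbreviation incr :: "(nat \<Rightarrow> nat) \<Rightarrow> nat \<Rightarrow> nat \<Rightarrow> nat" where
  "incr M j \<equiv> M(j := Suc (M j))"

lemma simplex_monomial_incr:
  assumes "j \<le> d"
  shows "simplex_monomial d (incr M j) \<theta> = sp d \<theta> j * simplex_monomial d M \<theta>"
proof -
  have "(\<Prod>k\<le>d. sp d \<theta> k ^ incr M j k) = sp d \<theta> j ^ Suc (M j) * (\<Prod>k\<in>{..d} - {j}. sp d \<theta> k ^ M k)"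
    using assms by (subst prod.remove[of _ j]) auto
  moreover have "(\<Prod>k\<le>d. sp d \<theta> k ^ M k) = sp d \<theta> j ^ M j * (\<Prod>k\<in>{..d} - {j}. sp d \<theta> k ^ M k)"
    using assms by (subst prod.remove[of _ j]) auto
  ultimately show ?thesis
    by (simp add: simplex_monomial_def)
qed

text \<open>Integration by parts along the line on which mass moves between coordinate 0 and
  coordinate i + 1. With the others fixed these two share the mass \<open>s\<close>, and the slice
  is a Beta-type integral.\<close>

lemma simplex_moment_exchange:
  assumes d: "1 \<le> d" and i: "i < d"
  shows "real (Suc (M (Suc i))) * simplex_moment d (incr M 0) = real (Suc (M 0)) * simplex_moment d (incr M (Suc i))"
proof -
  let ?J = "{..<d} - {i}"
  let ?f = "\<lambda>\<theta>. real (Suc (M (Suc i))) * simplex_monomial d (incr M 0) \<theta> - real (Suc (M 0)) * simplex_monomial d (incr M (Suc i)) \<theta>"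
  have ins: "{..<d} = insert i ?J"
    using i by auto
  have int: "integrable (lebesgue_d d) ?f"
    by (intro Bochner_Integration.integrable_diff integrable_mult_right integrable_simplex_monomial d)
  have slice: "(\<integral>t. ?f (x(i := t)) \<partial>lborel) = 0" for x :: "nat \<Rightarrow> real"
  proof -
    define s where "s = 1 - (\<Sum>j\<in>?J. x j)"
    define c where "c = indicator {x. \<forall>j\<in>?J. 0 < x j} x * (\<Prod>j\<in>?J. x j ^ M (Suc j))"
    have sp0: "sp d (x(i := t)) 0 = s - t" for t
      using i by (simp add: simplex_point_simps s_def sum.remove[of "{..<d}" i])
    have mono: "simplex_monomial d M (x(i := t)) = indicator {0<..<s} t * (c * ((s - t) ^ M 0 * t ^ M (Suc i)))" for t
    proof -
      have "x(i := t) \<in> Theta d \<longleftrightarrow> (\<forall>j\<in>?J. 0 < x j) \<and> 0 < t \<and> t < s"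
        using i by (auto simp: Theta_eq[OF d] s_def sum.remove[of "{..<d}" i])
      then have "indicator (Theta d) (x(i := t)) = (indicator {x. \<forall>j\<in>?J. 0 < x j} x * indicator {0<..<s} t :: real)"
        by (auto simp: indicator_def)
      moreover have "(\<Prod>j\<le>d. sp d (x(i := t)) j ^ M j) = (s - t) ^ M 0 * (\<Prod>j<d. (x(i := t)) j ^ M (Suc j))"
        by (simp add: prod.atMost_shift sp0 simplex_point_simps(2))
      moreover have "(\<Prod>j<d. (x(i := t)) j ^ M (Suc j)) = t ^ M (Suc i) * (\<Prod>j\<in>?J. x j ^ M (Suc j))"
        using i by (subst prod.remove[of _ i]) auto
      ultimately show ?thesis
        by (simp add: simplex_monomial_def c_def)
    qed
    have "?f (x(i := t)) = c * (indicator {0<..<s} t * (real (Suc (M (Suc i))) * t ^ M (Suc i) * (s - t) ^ Suc (M 0)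
        - real (Suc (M 0)) * t ^ Suc (M (Suc i)) * (s - t) ^ M 0))" for t
      using i by (simp add: simplex_monomial_incr mono sp0 simplex_point_simps(2) algebra_simps)
    then show ?thesis
      using integral_beta_derivative[of s "M (Suc i)" "M 0"] by simp
  qed
  have "(\<integral>\<theta>. ?f \<theta> \<partial>lebesgue_d d) = (\<integral>x. (\<integral>t. ?f (x(i := t)) \<partial>lborel) \<partial>Pi\<^sub>M ?J (\<lambda>_. lborel))"
  proof -
    have "(\<integral>\<theta>. ?f \<theta> \<partial>Pi\<^sub>M K (\<lambda>_. lborel)) = (\<integral>x. (\<integral>t. ?f (x(i := t)) \<partial>lborel) \<partial>Pi\<^sub>M ?J (\<lambda>_. lborel))"
      if "K = insert i ?J" "integrable (Pi\<^sub>M K (\<lambda>_. lborel)) ?f" for K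
      using that(2) unfolding that(1) by (intro lborel_product.product_integral_insert) auto
    from this[OF ins int] show ?thesis .
  qed
  also have "\<dots> = 0"
    by (simp only: slice) simp
  finally show ?thesis
    unfolding simplex_moment_def
    by (subst (asm) Bochner_Integration.integral_diff) (auto intro!: integrable_simplex_monomial d)
qed

text \<open>By the exchange relation the raised moments are proportional to M_k + 1 with a common
  factor \<open>r\<close>. As the coordinates sum to 1, these moments add up to the original one,
  which determines \<open>r\<close>.\<close>

lemma simplex_moment_incr:
  assumes d: "1 \<le> d" and j: "j \<le> d"
  shows "real ((\<Sum>k\<le>d. M k) + d + 1) * simplex_moment d (incr M j) = real (Suc (M j)) * simplex_moment d M"
proof -
  define r where "r = simplex_moment d (incr M 0) / real (Suc (M 0))"
  have r: "simplex_moment d (incr M k) = real (Suc (M k)) * r" if "k \<le> d" for k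
    using that simplex_moment_exchange[OF d, of "k - 1" M] by (cases k) (auto simp: r_def field_simps)
  have "simplex_moment d M = (\<integral>\<theta>. (\<Sum>k\<le>d. simplex_monomial d (incr M k) \<theta>) \<partial>lebesgue_d d)"
    unfolding simplex_moment_def
    by (simp add: simplex_monomial_incr sum_distrib_right[symmetric] sum_simplex_point)
  also have "\<dots> = (\<Sum>k\<le>d. simplex_moment d (incr M k))"
    unfolding simplex_moment_def by (rule Bochner_Integration.integral_sum) (rule integrable_simplex_monomial[OF d])
  also have "\<dots> = (\<Sum>k\<le>d. real (Suc (M k)) * r)"
    by (simp add: r)
  also have "\<dots> = real ((\<Sum>k\<le>d. M k) + d + 1) * r"
    by (simp add: sum_distrib_right[symmetric] sum.distrib distrib_right)
  finally show ?thesis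
    by (simp add: r[OF j] algebra_simps)
qed

text \<open>Dropping coordinate 0 undoes \<open>sp d\<close>, so the two push-forwards
  cancel.\<close>

lemma post_eq_density:
  assumes d: "1 \<le> d"
  shows "post d N = density (lebesgue_d d) (\<lambda>\<theta>. ennreal (simplex_monomial d N \<theta> / simplex_moment d N))" (is "_ = ?P")
proof -
  have [measurable]: "sp d \<in> measurable ?P (Pi\<^sub>M {..d} (\<lambda>_. lborel))"
    using measurable_simplex_point by (simp cong: measurable_cong_sets)
  have "post d N = distr (distr ?P (Pi\<^sub>M {..d} (\<lambda>_. lborel)) (sp d)) (lebesgue_d d) (\<lambda>\<theta>. \<lambda>i\<in>{..<d}. \<theta> (Suc i))"
    by (simp add: post_def dirichlet_def dirichlet_kernel_eq[OF d] simplex_moment_def)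
  also have "\<dots> = distr ?P (lebesgue_d d) ((\<lambda>\<theta>. \<lambda>i\<in>{..<d}. \<theta> (Suc i)) \<circ> sp d)"
  proof (rule distr_distr)
    show "(\<lambda>\<theta>. \<lambda>i\<in>{..<d}. \<theta> (Suc i)) \<in> measurable (Pi\<^sub>M {..d} (\<lambda>_. lborel :: real measure)) (lebesgue_d d)"
      by (rule measurable_restrict) (auto intro!: measurable_component_singleton)
  qed fact
  also have "\<dots> = distr ?P (lebesgue_d d) (\<lambda>\<theta>. \<theta>)"
    by (rule distr_cong)
      (auto simp: space_PiM simplex_point_simps fun_eq_iff restrict_def PiE_iff extensional_def)
  also have "\<dots> = ?P"
    by (rule distr_id2) simp
  finally show ?thesis .
qed

section \<open>Total variation and first-order expansion\<close>

text \<open>Equal masses allow the difference of the measures of \<open>A\<close> to be written as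
  half the integral of f - g against 2 1_A - 1, a function with values 1 and -1. The supremum is
  attained where f exceeds g.\<close>

lemma tv_dist_density:
  fixes f g :: "'a \<Rightarrow> real"
  assumes f: "integrable M f" "\<And>x. 0 \<le> f x" and g: "integrable M g" "\<And>x. 0 \<le> g x"
    and eq: "(\<integral>x. f x \<partial>M) = (\<integral>x. g x \<partial>M)"
  shows "tv_dist (density M f) (density M g) = (\<integral>x. \<bar>f x - g x\<bar> \<partial>M) / 2"
proof -
  have [measurable]: "f \<in> borel_measurable M" "g \<in> borel_measurable M"
    using f g by auto
  have meas: "measure (density M h) A = (\<integral>x. indicator A x * h x \<partial>M)"
    if "A \<in> sets M" "integrable M h" "\<And>x. 0 \<le> h x" for A and h :: "'a \<Rightarrow> real"
  proof -
    have [measurable]: "A \<in> sets M" "h \<in> borel_measurable M"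
      using that by auto
    have "emeasure (density M h) A = (\<integral>\<^sup>+x. ennreal (indicator A x * h x) \<partial>M)"
      by (subst emeasure_density) (auto intro!: nn_integral_cong simp: indicator_def)
    also have "\<dots> = ennreal (\<integral>x. indicator A x * h x \<partial>M)"
      using integrable_real_mult_indicator[OF that(1,2)] that(3)
      by (intro nn_integral_eq_integral) (auto simp: mult.commute)
    finally show ?thesis
      using that by (simp add: measure_def integral_nonneg_AE)
  qed
  have diff: "measure (density M f) A - measure (density M g) A
      = (\<integral>x. (2 * indicator A x - 1) * (f x - g x) \<partial>M) / 2" if A: "A \<in> sets M" for A
  proof -
    have int: "integrable M (\<lambda>x. indicator A x * f x)" "integrable M (\<lambda>x. indicator A x * g x)"
      using f g A by (auto intro!: integrable_real_mult_indicator simp: mult.commute[of "indicator _ _"])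
    have "(\<integral>x. (2 * indicator A x - 1) * (f x - g x) \<partial>M)
        = (\<integral>x. 2 * (indicator A x * f x - indicator A x * g x) - (f x - g x) \<partial>M)"
      by (intro Bochner_Integration.integral_cong) (auto simp: algebra_simps)
    also have "\<dots> = 2 * ((\<integral>x. indicator A x * f x \<partial>M) - (\<integral>x. indicator A x * g x \<partial>M))"
      using int f g eq by simp
    finally show ?thesis
      using A f g by (simp add: meas)
  qed
  let ?D = "\<lambda>A. \<bar>measure (density M f) A - measure (density M g) A\<bar>"
  have upper: "?D A \<le> (\<integral>x. \<bar>f x - g x\<bar> \<partial>M) / 2" if A: "A \<in> sets M" for A
  proof -
    have "\<bar>\<integral>x. (2 * indicator A x - 1) * (f x - g x) \<partial>M\<bar> \<le> (\<integral>x. \<bar>(2 * indicator A x - 1) * (f x - g x)\<bar> \<partial>M)"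
      by (rule integral_abs_bound)
    also have "\<dots> = (\<integral>x. \<bar>f x - g x\<bar> \<partial>M)"
      by (intro Bochner_Integration.integral_cong) (auto simp: indicator_def)
    finally show ?thesis
      using A by (simp add: diff)
  qed
  define B where "B = {x \<in> space M. g x < f x}"
  have B: "B \<in> sets M"
    unfolding B_def by measurable
  have "(\<integral>x. (2 * indicator B x - 1) * (f x - g x) \<partial>M) = (\<integral>x. \<bar>f x - g x\<bar> \<partial>M)"
    by (intro Bochner_Integration.integral_cong) (auto simp: B_def indicator_def)
  then have attained: "?D B = (\<integral>x. \<bar>f x - g x\<bar> \<partial>M) / 2"
    by (simp add: diff[OF B])
  show ?thesis
    unfolding tv_dist_def
  proof (rule antisym)
    show "(SUP A\<in>sets (density M f). ?D A) \<le> (\<integral>x. \<bar>f x - g x\<bar> \<partial>M) / 2"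
      using upper B by (intro cSUP_least) auto
    show "(\<integral>x. \<bar>f x - g x\<bar> \<partial>M) / 2 \<le> (SUP A\<in>sets (density M f). ?D A)"
      unfolding attained[symmetric] using B upper
      by (intro cSUP_upper bdd_aboveI2[where M = "(\<integral>x. \<bar>f x - g x\<bar> \<partial>M) / 2"]) auto
  qed
qed

section \<open>Elementary inequalities for exp and ln\<close>

text \<open>The condition 0 <= x f'(x) makes f decrease towards 0 on the left and increase on the
  right, so both signs of \<open>u\<close> are treated by one hypothesis.\<close>

lemma nonneg_of_derivative_sign:
  fixes f :: "real \<Rightarrow> real"
  assumes der: "\<And>x. min 0 u \<le> x \<Longrightarrow> x \<le> max 0 u \<Longrightarrow> (f has_real_derivative f' x) (at x)"
    and sign: "\<And>x. min 0 u \<le> x \<Longrightarrow> x \<le> max 0 u \<Longrightarrow> 0 \<le> x * f' x" and "f 0 = 0"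
  shows "0 \<le> f u"
proof (cases u "0 :: real" rule: linorder_cases)
  case less
  obtain x where "u < x" "x < 0" "f 0 - f u = (0 - u) * f' x"
    using MVT2[OF less, of f f'] der less by auto
  moreover from this have "f' x \<le> 0"
    using sign[of x] less by (simp add: zero_le_mult_iff)
  ultimately have "f 0 - f u \<le> 0"
    using less mult_nonneg_nonpos[of "0 - u" "f' x"] by simp
  then show ?thesis
    using assms(3) by simp
next
  case greater
  obtain x where "0 < x" "x < u" "f u - f 0 = (u - 0) * f' x"
    using MVT2[OF greater, of f f'] der greater by auto
  moreover from this have "0 \<le> f' x"
    using sign[of x] greater by (simp add: zero_le_mult_iff)
  ultimately have "0 \<le> f u - f 0"
    using greater by simp
  then show ?thesis
    using assms(3) by simp
qed (use assms(3) in simp)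

text \<open>The Taylor remainder is at most x^2 / 2 times the larger of 1 and e^x. Replacing the
  maximum by the sum separates a term without an exponential from one in which e^x can serve as a
  density ratio.\<close>

lemma exp_minus_linear_bound:
  fixes x :: real
  shows "\<bar>exp x - 1 - x\<bar> \<le> x\<^sup>2 / 2 * (1 + exp x)"
proof -
  have "exp x - 1 - x \<le> x\<^sup>2 / 2 * (1 + exp x)"
  proof (cases "0 \<le> x")
    case True
    have "0 \<le> x\<^sup>2 / 2 - 1 + (1 + x) * exp (- x)"
    proof (rule nonneg_of_derivative_sign[where u = x and f = "\<lambda>x. x\<^sup>2 / 2 - 1 + (1 + x) * exp (- x)"
          and f' = "\<lambda>x. x * (1 - exp (- x))"])
      fix y assume "min 0 x \<le> y"
      then have "0 \<le> y"
        using True by simp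
      then show "0 \<le> y * (y * (1 - exp (- y)))"
        by simp
    qed (auto intro!: derivative_eq_intros simp: algebra_simps)
    then have "0 \<le> (x\<^sup>2 / 2 - 1 + (1 + x) * exp (- x)) * exp x"
      by simp
    also have "\<dots> = x\<^sup>2 / 2 * exp x - exp x + (1 + x)"
      by (simp add: algebra_simps exp_minus)
    finally show ?thesis
      using zero_le_power2[of x] unfolding distrib_left by linarith
  next
    case False
    have "0 \<le> 1 + x + x\<^sup>2 / 2 - exp x"
    proof (rule nonneg_of_derivative_sign[where u = x and f = "\<lambda>x. 1 + x + x\<^sup>2 / 2 - exp x"
          and f' = "\<lambda>x. 1 + x - exp x"])
      fix y assume "y \<le> max 0 x"
      then show "0 \<le> y * (1 + y - exp y)"
        using False exp_ge_add_one_self[of y] by (intro mult_nonpos_nonpos) auto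
    qed (auto intro!: derivative_eq_intros)
    moreover have "0 \<le> x\<^sup>2 / 2 * exp x"
      by simp
    ultimately show ?thesis
      unfolding distrib_left by linarith
  qed
  moreover have "0 \<le> exp x - 1 - x"
    using exp_ge_add_one_self[of x] by linarith
  ultimately show ?thesis
    by simp
qed

definition ln_remainder :: "real \<Rightarrow> real" where
  "ln_remainder u = ln (1 + u) - u + u\<^sup>2 / 2"

text \<open>The differences have derivatives x^3 / (1 + x) and x^3 (2 - 1 / (1 + x)). The cut at
  -1/2 is exactly where the bracket 2 - 1 / (1 + x) stays nonnegative, matching the constant 1/2 of
  the quartic term.\<close>

lemma ln_remainder_cubic:
  assumes "- 1 / 2 \<le> u"
  shows "ln_remainder u \<le> u ^ 3 / 3" "u ^ 3 / 3 - u ^ 4 / 2 \<le> ln_remainder u"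
proof -
  have "0 \<le> u ^ 3 / 3 - ln_remainder u"
  proof (rule nonneg_of_derivative_sign[where u = u and f = "\<lambda>u. u ^ 3 / 3 - ln_remainder u" and f' = "\<lambda>x. x ^ 3 / (1 + x)"])
    fix x assume "min 0 u \<le> x" "x \<le> max 0 u"
    then have x: "0 < 1 + x"
      using assms by (auto simp: min_def split: if_splits)
    show "((\<lambda>u. u ^ 3 / 3 - ln_remainder u) has_real_derivative x ^ 3 / (1 + x)) (at x)"
      unfolding ln_remainder_def using x
      by (auto intro!: derivative_eq_intros simp: field_simps power2_eq_square power3_eq_cube)
    have "x * (x ^ 3 / (1 + x)) = x ^ 4 / (1 + x)"
      by (simp add: power4_eq_xxxx power3_eq_cube)
    then show "0 \<le> x * (x ^ 3 / (1 + x))"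
      using x by simp
  qed (simp add: ln_remainder_def)
  then show "ln_remainder u \<le> u ^ 3 / 3"
    by simp
  have "0 \<le> ln_remainder u - u ^ 3 / 3 + u ^ 4 / 2"
  proof (rule nonneg_of_derivative_sign[where u = u and f = "\<lambda>u. ln_remainder u - u ^ 3 / 3 + u ^ 4 / 2"
        and f' = "\<lambda>x. x ^ 3 * (2 - 1 / (1 + x))"])
    fix x assume "min 0 u \<le> x" "x \<le> max 0 u"
    then have x: "1 / 2 \<le> 1 + x"
      using assms by (auto simp: min_def split: if_splits)
    show "((\<lambda>u. ln_remainder u - u ^ 3 / 3 + u ^ 4 / 2) has_real_derivative x ^ 3 * (2 - 1 / (1 + x))) (at x)"
      unfolding ln_remainder_def using x
      by (auto intro!: derivative_eq_intros simp: field_simps power2_eq_square power3_eq_cube)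
    have "x * (x ^ 3 * (2 - 1 / (1 + x))) = x ^ 4 * (2 - 1 / (1 + x))"
      by (simp add: power4_eq_xxxx power3_eq_cube)
    moreover have "0 \<le> 2 - 1 / (1 + x)"
      using x by (simp add: field_simps)
    then have "0 \<le> x ^ 4 * (2 - 1 / (1 + x))"
      by (intro mult_nonneg_nonneg) auto
    ultimately show "0 \<le> x * (x ^ 3 * (2 - 1 / (1 + x)))"
      by metis
  qed (simp add: ln_remainder_def)
  then show "u ^ 3 / 3 - u ^ 4 / 2 \<le> ln_remainder u"
    by simp
qed

lemma abs_ln_remainder:
  assumes "- 1 / 2 \<le> u"
  shows "\<bar>ln_remainder u\<bar> \<le> 2 / 3 * \<bar>u\<bar> ^ 3"
proof (cases "0 \<le> u")
  case True
  have "0 \<le> ln_remainder u"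
  proof (rule nonneg_of_derivative_sign[where u = u and f = ln_remainder and f' = "\<lambda>x. x\<^sup>2 / (1 + x)"])
    fix x assume "min 0 u \<le> x"
    then have x: "0 \<le> x"
      using True by simp
    show "(ln_remainder has_real_derivative x\<^sup>2 / (1 + x)) (at x)"
      unfolding ln_remainder_def[abs_def] using x
      by (auto intro!: derivative_eq_intros simp: field_simps power2_eq_square)
    show "0 \<le> x * (x\<^sup>2 / (1 + x))"
      using x by simp
  qed (simp add: ln_remainder_def)
  then show ?thesis
    using ln_remainder_cubic(1)[OF assms] True zero_le_power[OF True, of 3] by simp
next
  case False
  define v where "v = - u"
  have v: "0 < v" "v \<le> 1 / 2" "u = - v"
    using False assms by (auto simp: v_def)
  \<comment> \<open>For negative arguments the quartic term is at most v^3 / 4, and 1/3 + 1/4 is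
    below 2/3.\<close>
  have "v ^ 4 \<le> v ^ 3 * (1 / 2)"
    using v mult_left_mono[of v "1 / 2" "v ^ 3"] by (simp add: power4_eq_xxxx power3_eq_cube)
  moreover have "0 \<le> v ^ 3"
    using v by simp
  ultimately show ?thesis
    using ln_remainder_cubic[OF assms] v by (simp add: abs_le_iff)
qed

text \<open>
  The inequality \<open>dom\<close> below holds everywhere, so integrating it once controls the ratio \<open>Z\<close> of the
  normalising constants as well as the error.
\<close>

lemma first_order_error:
  fixes f g S \<psi> B2 B4 B6 :: "'a \<Rightarrow> real"
  assumes f: "integrable M f" "\<And>x. 0 \<le> f x" "(\<integral>x. f x \<partial>M) = 1"
    and g: "integrable M g" "\<And>x. 0 \<le> g x" "(\<integral>x. g x \<partial>M) = 1"
    and "0 < Z" "\<kappa> \<le> 1 / 4"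
    and ratio: "\<And>x. x \<in> A \<Longrightarrow> Z * f x = exp (\<psi> x) * g x"
    and B: "\<And>x. 0 \<le> B2 x" "\<And>x. 0 \<le> B4 x" "\<And>x. 0 \<le> B6 x"
    and B2: "\<And>x. x \<in> space M \<Longrightarrow> x \<notin> A \<Longrightarrow> 1 \<le> B2 x" and B6: "\<And>x. (S x)\<^sup>2 \<le> B6 x"
    and \<psi>: "\<And>x. x \<in> A \<Longrightarrow> (\<psi> x)\<^sup>2 \<le> B6 x" "\<And>x. x \<in> A \<Longrightarrow> \<bar>\<psi> x - S x\<bar> \<le> B4 x"
    and S: "integrable M (\<lambda>x. g x * S x)" "(\<integral>x. g x * S x \<partial>M) = 0"
    and int: "integrable M (\<lambda>x. g x * B2 x)" "integrable M (\<lambda>x. g x * B4 x)" "integrable M (\<lambda>x. g x * B6 x)"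
      "integrable M (\<lambda>x. f x * B2 x)" "integrable M (\<lambda>x. f x * B6 x)"
    and le: "(\<integral>x. g x * B2 x \<partial>M) \<le> \<kappa>" "(\<integral>x. g x * B4 x \<partial>M) \<le> \<kappa>" "(\<integral>x. g x * B6 x \<partial>M) \<le> \<kappa>"
      "(\<integral>x. f x * B2 x \<partial>M) \<le> \<kappa>" "(\<integral>x. f x * B6 x \<partial>M) \<le> \<kappa>"
  shows "\<bar>(\<integral>x. \<bar>f x - g x\<bar> \<partial>M) - (\<integral>x. g x * \<bar>S x\<bar> \<partial>M)\<bar> \<le> 24 * \<kappa>"
proof -
  define R where "R x = Z * f x - g x - g x * S x" for x
  define U where "U x = (g x * B6 x + g x * B4 x + 2 * (g x * B2 x)) + Z * (f x * B6 x + f x * B2 x)" for x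
  have dom: "\<bar>R x\<bar> \<le> U x" if x: "x \<in> space M" for x
  proof (cases "x \<in> A")
    case True
    have "R x = g x * (exp (\<psi> x) - 1 - \<psi> x) + g x * (\<psi> x - S x)"
      by (simp add: R_def ratio[OF True] algebra_simps)
    then have "\<bar>R x\<bar> \<le> g x * \<bar>exp (\<psi> x) - 1 - \<psi> x\<bar> + g x * \<bar>\<psi> x - S x\<bar>"
      using g(2)[of x] by (metis abs_mult abs_of_nonneg abs_triangle_ineq)
    also have "\<dots> \<le> g x * (B6 x * (1 + exp (\<psi> x))) + g x * B4 x"
    proof (intro add_mono mult_left_mono g(2))
      have "\<bar>exp (\<psi> x) - 1 - \<psi> x\<bar> \<le> (\<psi> x)\<^sup>2 / 2 * (1 + exp (\<psi> x))"
        by (rule exp_minus_linear_bound)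
      also have "\<dots> \<le> B6 x * (1 + exp (\<psi> x))"
        using \<psi>(1)[OF True] B(3)[of x] by (intro mult_right_mono) (auto intro: add_nonneg_nonneg)
      finally show "\<bar>exp (\<psi> x) - 1 - \<psi> x\<bar> \<le> B6 x * (1 + exp (\<psi> x))" .
    qed (use \<psi> True in auto)
    \<comment> \<open>The exponential is traded for a change of measure: e^psi times
      \<open>g\<close> is \<open>Z\<close> times \<open>f\<close>, so only a moment under
      \<open>f\<close> remains.\<close>
    also have "\<dots> = g x * B6 x + Z * (f x * B6 x) + g x * B4 x"
      using ratio[OF True] by (simp add: algebra_simps)
    also have "\<dots> \<le> U x"
      using B f(2)[of x] g(2)[of x] \<open>0 < Z\<close> by (simp add: U_def distrib_left)
    finally show ?thesis .
  next
    case False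
    \<comment> \<open>Off \<open>A\<close> no expansion is available. Here 2 |S| <= 1 + S^2, where
      the 1 is paid for by \<open>B2\<close> and the square by \<open>B6\<close>.\<close>
    have S_le: "\<bar>S x\<bar> \<le> B2 x + B6 x"
    proof -
      have "0 \<le> (1 - \<bar>S x\<bar>)\<^sup>2"
        by simp
      then have "2 * \<bar>S x\<bar> \<le> 1 + (S x)\<^sup>2"
        by (simp add: power2_diff)
      then show ?thesis
        using B2[OF x False] B6[of x] by simp
    qed
    have "g x * \<bar>S x\<bar> \<le> g x * (B2 x + B6 x)" "g x * 1 \<le> g x * B2 x" "Z * (f x * 1) \<le> Z * (f x * B2 x)"
      using mult_left_mono[OF B2[OF x False] f(2)[of x]] mult_left_mono[OF B2[OF x False] g(2)[of x]]
        S_le g(2)[of x] \<open>0 < Z\<close> by (auto intro: mult_left_mono)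
    moreover have "0 \<le> Z * f x" "0 \<le> g x" "\<bar>g x * S x\<bar> = g x * \<bar>S x\<bar>"
      using f(2)[of x] g(2)[of x] \<open>0 < Z\<close> by (auto simp: abs_mult)
    ultimately have "\<bar>R x\<bar> \<le> Z * (f x * B2 x) + g x * B2 x + (g x * B2 x + g x * B6 x)"
      unfolding R_def distrib_left by linarith
    also have "\<dots> \<le> U x"
      using B f(2)[of x] g(2)[of x] \<open>0 < Z\<close> by (simp add: U_def distrib_left)
    finally show ?thesis .
  qed
  have int_R: "integrable M R"
    unfolding R_def using f g S by (intro Bochner_Integration.integrable_diff integrable_mult_right) auto
  have int_U: "integrable M U"
    unfolding U_def using int by (intro Bochner_Integration.integrable_add integrable_mult_right) auto
  have "(\<integral>x. \<bar>R x\<bar> \<partial>M) \<le> (\<integral>x. U x \<partial>M)"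
    using dom int_R int_U by (intro integral_mono) auto
  also have "(\<integral>x. U x \<partial>M) = ((\<integral>x. g x * B6 x \<partial>M) + (\<integral>x. g x * B4 x \<partial>M) + 2 * (\<integral>x. g x * B2 x \<partial>M))
      + Z * ((\<integral>x. f x * B6 x \<partial>M) + (\<integral>x. f x * B2 x \<partial>M))"
    unfolding U_def using int by simp
  also have "\<dots> \<le> 4 * \<kappa> + Z * (2 * \<kappa>)"
    using le \<open>0 < Z\<close> by (intro add_mono mult_left_mono) auto
  finally have R_le: "(\<integral>x. \<bar>R x\<bar> \<partial>M) \<le> 4 * \<kappa> + 2 * (Z * \<kappa>)"
    by simp
  \<comment> \<open>Both densities have mass 1 and \<open>S\<close> has mean 0 under
    \<open>g\<close>, so the integral of the remainder measures the normalisation error.\<close>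
  have "(\<integral>x. R x \<partial>M) = Z - 1"
    unfolding R_def using f g S by simp
  then have Z1: "\<bar>Z - 1\<bar> \<le> 4 * \<kappa> + 2 * (Z * \<kappa>)"
    using integral_abs_bound[of M R] R_le by simp
  have \<kappa>: "0 \<le> \<kappa>"
    using le(1) B(1) g(2) by (intro order_trans[OF Bochner_Integration.integral_nonneg le(1)]) auto
  \<comment> \<open>Bootstrap: with \<kappa> <= 1/4 the bound reads |Z - 1| <= 1 + Z / 2, hence Z <=
    4, and inserting this gives 4 \<kappa> + 8 \<kappa> = 12 \<kappa>.\<close>
  have "Z * \<kappa> \<le> Z * (1 / 4)"
    using \<open>\<kappa> \<le> 1 / 4\<close> \<open>0 < Z\<close> by (intro mult_left_mono) auto
  then have "Z \<le> 4"
    using Z1 \<open>\<kappa> \<le> 1 / 4\<close> by simp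
  then have "Z * \<kappa> \<le> 4 * \<kappa>"
    using \<kappa> by (rule mult_right_mono)
  then have bounds: "\<bar>Z - 1\<bar> \<le> 12 * \<kappa>" "(\<integral>x. \<bar>R x\<bar> \<partial>M) \<le> 12 * \<kappa>"
    using Z1 R_le by auto
  have int_fg: "integrable M (\<lambda>x. \<bar>f x - g x\<bar>)" "integrable M (\<lambda>x. g x * \<bar>S x\<bar>)"
  proof -
    have "integrable M (\<lambda>x. \<bar>g x * S x\<bar>)"
      using S(1) by (rule integrable_abs)
    then show "integrable M (\<lambda>x. g x * \<bar>S x\<bar>)"
      using g(2) by (simp add: abs_mult)
  qed (use f g in auto)
  have "\<bar>(\<integral>x. \<bar>f x - g x\<bar> \<partial>M) - (\<integral>x. g x * \<bar>S x\<bar> \<partial>M)\<bar> = \<bar>\<integral>x. \<bar>f x - g x\<bar> - g x * \<bar>S x\<bar> \<partial>M\<bar>"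
    using int_fg by simp
  also have "\<dots> \<le> (\<integral>x. \<bar>\<bar>f x - g x\<bar> - g x * \<bar>S x\<bar>\<bar> \<partial>M)"
    by (rule integral_abs_bound)
  also have "\<dots> \<le> (\<integral>x. \<bar>Z - 1\<bar> * f x + \<bar>R x\<bar> \<partial>M)"
  proof (rule integral_mono)
    fix x
    have "\<bar>\<bar>f x - g x\<bar> - \<bar>g x * S x\<bar>\<bar> \<le> \<bar>(f x - g x) - g x * S x\<bar>"
      by (rule abs_triangle_ineq3)
    \<comment> \<open>The error splits into the normalisation error times \<open>f\<close> and the
      remainder \<open>R\<close>; each contributes 12 \<kappa>.\<close>
    also have "(f x - g x) - g x * S x = - ((Z - 1) * f x) + R x"
      by (simp add: R_def algebra_simps)
    also have "\<bar>- ((Z - 1) * f x) + R x\<bar> \<le> \<bar>Z - 1\<bar> * f x + \<bar>R x\<bar>"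
      using f(2)[of x] abs_triangle_ineq[of "- ((Z - 1) * f x)" "R x"] by (simp add: abs_mult)
    finally show "\<bar>\<bar>f x - g x\<bar> - g x * \<bar>S x\<bar>\<bar> \<le> \<bar>Z - 1\<bar> * f x + \<bar>R x\<bar>"
      using g(2)[of x] by (simp add: abs_mult)
  qed (use int_fg int_R f in auto)
  also have "\<dots> = \<bar>Z - 1\<bar> + (\<integral>x. \<bar>R x\<bar> \<partial>M)"
    using f int_R by simp
  finally show ?thesis
    using bounds by simp
qed

section \<open>The Laplace approximation of the multinomial posterior\<close>

text \<open>Contracting a sum of rank-one tensors factorises for each l. This is the form taken by
  all third derivatives below.\<close>

lemma sum_triple_product:
  fixes u v w :: "'a \<Rightarrow> nat \<Rightarrow> real"
  shows "(\<Sum>i<d. \<Sum>j<d. \<Sum>k<d. \<Sum>l\<in>L. c l * (u l i * v l j * w l k))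
    = (\<Sum>l\<in>L. c l * ((\<Sum>i<d. u l i) * (\<Sum>j<d. v l j) * (\<Sum>k<d. w l k)))"
proof -
  have "(\<Sum>i<d. \<Sum>j<d. \<Sum>k<d. \<Sum>l\<in>L. c l * (u l i * v l j * w l k))
      = (\<Sum>l\<in>L. \<Sum>i<d. \<Sum>j<d. \<Sum>k<d. c l * (u l i * v l j * w l k))"
    by (simp only: sum.swap[of _ L])
  also have "\<dots> = (\<Sum>l\<in>L. c l * ((\<Sum>i<d. u l i) * (\<Sum>j<d. v l j) * (\<Sum>k<d. w l k)))"
    by (simp add: sum_distrib_left[symmetric] sum_distrib_right[symmetric] mult.assoc)
  finally show ?thesis .
qed

text \<open>Gradient of the l-th simplex coordinate as an affine function of the d free
  coordinates.\<close>

definition coord_sign :: "nat \<Rightarrow> nat \<Rightarrow> real" where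
  "coord_sign l k = (case l of 0 \<Rightarrow> - 1 | Suc i \<Rightarrow> if k = i then 1 else 0)"

lemma sum_coord_sign:
  assumes "l \<le> d"
  shows "(\<Sum>k<d. coord_sign l k * x k) = (case l of 0 \<Rightarrow> - (\<Sum>k<d. x k) | Suc i \<Rightarrow> x i)"
  using assms by (auto simp: coord_sign_def sum_negf if_distrib[of "\<lambda>y. y * _"] split: nat.split cong: if_cong)

context simplex_weights
begin

lemma V_fun_eq:
  "V_fun d n p = (\<lambda>\<theta>. - (\<Sum>l\<le>d. (real n * p l) * ln (affine_form d (\<lambda>l. if l = 0 then 1 else 0) coord_sign l \<theta>)))"
proof
  fix \<theta>
  have aff: "affine_form d (\<lambda>l. if l = 0 then 1 else 0) coord_sign 0 \<theta> = 1 - (\<Sum>i<d. \<theta> i)"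
    "\<And>i. i < d \<Longrightarrow> affine_form d (\<lambda>l. if l = 0 then 1 else 0) coord_sign (Suc i) \<theta> = \<theta> i"
    by (simp_all add: affine_form_def sum_coord_sign)
  show "V_fun d n p \<theta> = - (\<Sum>l\<le>d. (real n * p l) * ln (affine_form d (\<lambda>l. if l = 0 then 1 else 0) coord_sign l \<theta>))"
    by (simp add: aff V_fun_def v_fun_def p_tail_def sum.atMost_shift sum_distrib_left right_diff_distrib mult.assoc)
qed

lemma p_sum_tail: "(\<Sum>i<d. p (Suc i)) = 1 - p 0"
  using p_sum by (simp add: sum.atMost_shift)

lemma affine_form_p_tail:
  assumes "l \<le> d"
  shows "affine_form d (\<lambda>l. if l = 0 then 1 else 0) coord_sign l (p_tail p) = p l"
  using assms p_sum_tail by (cases l) (auto simp: affine_form_def sum_coord_sign p_tail_def)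

lemma H_V_index:
  assumes "i < d" "j < d"
  shows "H_V d n p $$ (i, j) = real n * ((if i = j then 1 / p (Suc i) else 0) + 1 / p 0)"
proof -
  have "H_V d n p $$ (i, j) = (\<Sum>l\<le>d. real n * p l * coord_sign l j * coord_sign l i / p l ^ 2)"
    unfolding H_V_def hessian_def V_fun_eq using assms
    by (simp add: partial_deriv2_sum_ln[where m = d] affine_form_p_tail p_pos)
  also have "\<dots> = (\<Sum>l\<le>d. real n * (coord_sign l j * (coord_sign l i / p l)))"
    using p_nz by (intro sum.cong) (auto simp: power2_eq_square)
  also have "\<dots> = real n * ((\<Sum>l<d. coord_sign (Suc l) j * (coord_sign (Suc l) i / p (Suc l))) + 1 / p 0)"
    by (simp add: sum.atMost_shift coord_sign_def sum_distrib_left distrib_left)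
  also have "(\<Sum>l<d. coord_sign (Suc l) j * (coord_sign (Suc l) i / p (Suc l))) = (\<Sum>l<d. if l = i then (if i = j then 1 / p (Suc i) else 0) else 0)"
    by (intro sum.cong) (auto simp: coord_sign_def)
  finally show ?thesis
    using assms by simp
qed

lemma H_V_carrier: "H_V d n p \<in> carrier_mat d d"
  by (simp add: H_V_def hessian_def)

definition cov_mat :: "real mat" where
  "cov_mat = mat d d (\<lambda>(i, j). cov (Suc i) (Suc j))"

lemma cov_mat_index: "i < d \<Longrightarrow> j < d \<Longrightarrow> cov_mat $$ (i, j) = cov (Suc i) (Suc j)"
  by (simp add: cov_mat_def)

lemma H_V_mult_cov_mat: "H_V d n p * cov_mat = 1\<^sub>m d"
proof (rule eq_matI)
  fix i j assume "i < dim_row (1\<^sub>m d :: real mat)" "j < dim_col (1\<^sub>m d :: real mat)"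
  then have ij: "i < d" "j < d" by auto
  have "(H_V d n p * cov_mat) $$ (i, j) = (\<Sum>k<d. H_V d n p $$ (i, k) * cov_mat $$ (k, j))"
    by (rule index_mult_mat_sum[OF H_V_carrier]) (auto simp: cov_mat_def ij)
  also have "\<dots> = (\<Sum>k<d. (if i = k then ((if k = j then p (Suc k) else 0) - p (Suc k) * p (Suc j)) / p (Suc k) else 0)
      + ((if k = j then p (Suc j) / p 0 else 0) - p (Suc k) * p (Suc j) / p 0))"
    using n_pos p_nz ij by (intro sum.cong) (auto simp: H_V_index cov_mat_def cov_def field_simps)
  also have "\<dots> = ((if i = j then p (Suc i) else 0) - p (Suc i) * p (Suc j)) / p (Suc i)
      + (p (Suc j) / p 0 - (1 - p 0) * p (Suc j) / p 0)"
    using ij by (simp add: sum.distrib sum_subtractf sum_divide_distrib[symmetric] sum_distrib_right[symmetric] p_sum_tail)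
  also have "\<dots> = (if i = j then 1 else 0)"
    using p_nz[of 0] p_nz[of "Suc i"] ij by (simp add: field_simps)
  finally show "(H_V d n p * cov_mat) $$ (i, j) = 1\<^sub>m d $$ (i, j)"
    using ij by simp
qed (use H_V_carrier in \<open>auto simp: cov_mat_def\<close>)

lemma cov_mat_carrier: "cov_mat \<in> carrier_mat d d"
  by (simp add: cov_mat_def)

lemma minv_H_V: "minv (H_V d n p) = cov_mat" and minv_cov_mat: "minv cov_mat = H_V d n p"
  using H_V_mult_cov_mat mat_mult_left_right_inverse[OF H_V_carrier cov_mat_carrier]
  by (auto intro!: minv_eqI H_V_carrier cov_mat_carrier)

lemma cov_mat_eq_smult:
  "cov_mat = (1 / real n) \<cdot>\<^sub>m mat d d (\<lambda>(i, j). (if i = j then p (Suc i) else 0) - p (Suc i) * p (Suc j))"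
  by (rule eq_matI) (auto simp: cov_mat_def cov_def)

lemma det_cov_mat: "Determinant.det cov_mat = (1 / real n) ^ d * (\<Prod>l\<le>d. p l)"
  unfolding cov_mat_eq_smult det_smult
  using det_diag_minus_rank_one[of d "\<lambda>i. p (Suc i)"] by (simp add: p_sum_tail prod.atMost_shift)

lemma laplace_approx_eq: "laplace_approx d n p = gauss_measure"
proof -
  have quad: "(\<Sum>i<d. \<Sum>j<d. H_V d n p $$ (i, j) * (\<theta> i - p_tail p i) * (\<theta> j - p_tail p j))
      = real n * (\<Sum>l\<le>d. (z \<theta> l)\<^sup>2 / p l)" for \<theta>
  proof -
    define x where "x i = \<theta> i - p (Suc i)" for i
    have "(\<Sum>i<d. \<Sum>j<d. H_V d n p $$ (i, j) * (\<theta> i - p_tail p i) * (\<theta> j - p_tail p j))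
        = (\<Sum>i<d. \<Sum>j<d. real n * ((if i = j then (x i)\<^sup>2 / p (Suc i) else 0) + x i * x j / p 0))"
      by (intro sum.cong refl) (auto simp: H_V_index p_tail_def x_def[symmetric] power2_eq_square algebra_simps)
    also have "\<dots> = real n * ((\<Sum>i<d. (x i)\<^sup>2 / p (Suc i)) + (\<Sum>i<d. \<Sum>j<d. x i * x j) / p 0)"
      by (simp add: sum_distrib_left[symmetric] sum.distrib sum_divide_distrib[symmetric])
    also have "(\<Sum>i<d. \<Sum>j<d. x i * x j) = (z \<theta> 0)\<^sup>2"
      by (simp add: power2_eq_square sum_product x_def)
    finally show ?thesis
      by (simp add: sum.atMost_shift x_def)
  qed
  have "exp (- (\<Sum>i<d. \<Sum>j<d. H_V d n p $$ (i, j) * (\<theta> i - p_tail p i) * (\<theta> j - p_tail p j)) / 2)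
      / sqrt ((2 * pi) ^ d * Determinant.det cov_mat) = g \<theta>" for \<theta>
    unfolding quad det_cov_mat gauss_density_def by (simp add: power_divide power_mult_distrib)
  then show ?thesis
    unfolding laplace_approx_def normal_d_def minv_H_V minv_cov_mat gauss_measure_def by simp
qed

lemma S_fun_eq: "S_fun d n p = cubic"
proof
  fix \<theta>
  define x where "x i = \<theta> i - p_tail p i" for i
  have zx: "(\<Sum>i<d. coord_sign l i * x i) = z \<theta> l" if "l \<le> d" for l
    using sum_coord_sign[OF that, of x] that by (auto simp: x_def p_tail_def split: nat.split)
  have "(\<Sum>i<d. \<Sum>j<d. \<Sum>k<d. third_deriv (V_fun d n p) (p_tail p) i j k * x i * x j * x k)
      = (\<Sum>i<d. \<Sum>j<d. \<Sum>k<d. \<Sum>l\<le>d. (- 2 * real n / (p l)\<^sup>2) * ((coord_sign l i * x i) * (coord_sign l j * x j) * (coord_sign l k * x k)))"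
  proof (intro sum.cong refl)
    fix i j k assume "i \<in> {..<d}" "j \<in> {..<d}" "k \<in> {..<d}"
    then have "third_deriv (V_fun d n p) (p_tail p) i j k
        = - 2 * (\<Sum>l\<le>d. real n * p l * coord_sign l i * coord_sign l j * coord_sign l k / p l ^ 3)"
      unfolding V_fun_eq by (subst third_deriv_sum_ln) (auto simp: affine_form_p_tail p_pos)
    then show "third_deriv (V_fun d n p) (p_tail p) i j k * x i * x j * x k
        = (\<Sum>l\<le>d. (- 2 * real n / (p l)\<^sup>2) * ((coord_sign l i * x i) * (coord_sign l j * x j) * (coord_sign l k * x k)))"
      using p_nz by (auto simp: sum_distrib_left sum_distrib_right power2_eq_square power3_eq_cube intro!: sum.cong)
  qed
  also have "\<dots> = (\<Sum>l\<le>d. (- 2 * real n / (p l)\<^sup>2) * (z \<theta> l * z \<theta> l * z \<theta> l))"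
    unfolding sum_triple_product by (intro sum.cong) (auto simp: zx)
  also have "\<dots> = - 2 * real n * (\<Sum>l\<le>d. z \<theta> l ^ 3 / (p l)\<^sup>2)"
    by (simp add: sum_distrib_left power3_eq_cube)
  finally show "S_fun d n p \<theta> = cubic \<theta>"
    unfolding S_fun_def cubic_def x_def by simp
qed

lemma sum_cov: "m \<le> d \<Longrightarrow> (\<Sum>l\<le>d. cov l m) = 0"
  by (simp add: cov_def sum_divide_distrib[symmetric] sum_subtractf sum_distrib_right[symmetric] p_sum)

lemma cov_sym: "cov l m = cov m l"
  by (simp add: cov_def mult.commute)

text \<open>Gradient of the l-th simplex coordinate in the whitened variable of
  \<open>W_fun\<close>: the rows of the covariance root, completed by a row 0 that makes each column
  sum to 0.\<close>

definition root_row :: "nat \<Rightarrow> nat \<Rightarrow> real" where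
  "root_row l k = (case l of 0 \<Rightarrow> - (\<Sum>i<d. mat_sqrt cov_mat $$ (i, k)) | Suc i \<Rightarrow> mat_sqrt cov_mat $$ (i, k))"

lemma p_le_1: "l \<le> d \<Longrightarrow> p l \<le> 1"
  using member_le_sum[of l "{..d}" p] p_sum p_pos by (auto intro: less_imp_le)

text \<open>Up to the factor 1 / n the covariance is 1 - X, where X is diag(1 - p) + p p^T on the
  tail indices. This \<open>X\<close> is entrywise nonnegative with row sums 1 - p_i p_0, so the
  iteration for square roots applies.\<close>

lemma mat_sqrt_cov_mat:
  "mat_sqrt cov_mat \<in> carrier_mat d d" "transpose_mat (mat_sqrt cov_mat) = mat_sqrt cov_mat"
  "mat_sqrt cov_mat * mat_sqrt cov_mat = cov_mat"
proof -
  define X where "X = mat d d (\<lambda>(i, j). (if i = j then 1 - p (Suc i) else 0) + p (Suc i) * p (Suc j))"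
  have eq: "cov_mat = (1 / real n) \<cdot>\<^sub>m (1\<^sub>m d - X)"
    by (rule eq_matI) (auto simp: cov_mat_def cov_def X_def)
  have X: "X \<in> carrier_mat d d" "transpose_mat X = X"
    by (auto simp: X_def intro!: eq_matI)
  have nonneg: "0 \<le> X $$ (i, j)" if "i < d" "j < d" for i j
    using that p_le_1 p_pos by (auto simp: X_def less_imp_le intro!: add_nonneg_nonneg mult_nonneg_nonneg)
  have row: "(\<Sum>j<d. X $$ (i, j)) \<le> 1" if "i < d" for i
  proof -
    have "(\<Sum>j<d. X $$ (i, j)) = (1 - p (Suc i)) + p (Suc i) * (1 - p 0)"
      using that by (simp add: X_def sum.distrib sum_distrib_left[symmetric] p_sum_tail)
    also have "\<dots> \<le> 1"
      using p_pos[of "Suc i"] p_pos[of 0] that by (simp add: algebra_simps)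
    finally show ?thesis .
  qed
  show "mat_sqrt cov_mat \<in> carrier_mat d d" "transpose_mat (mat_sqrt cov_mat) = mat_sqrt cov_mat"
    "mat_sqrt cov_mat * mat_sqrt cov_mat = cov_mat"
    using mat_sqrt_smult_one_minus[OF X nonneg row, of "1 / real n"] n_pos unfolding eq by auto
qed

text \<open>The completed rows factor the full covariance of z_0, ..., z_d. Entries involving index
  0 follow from those of the tail since the covariances sum to 0. The square root then disappears
  from all contractions of derivatives of W.\<close>

lemma root_row_cov:
  assumes "l \<le> d" "m \<le> d"
  shows "(\<Sum>k<d. root_row l k * root_row m k) = cov l m"
proof -
  let ?B = "mat_sqrt cov_mat"
  have B: "?B $$ (j, k) = ?B $$ (k, j)" if "j < d" "k < d" for j k
    using arg_cong[OF mat_sqrt_cov_mat(2), of "\<lambda>M. M $$ (j, k)"] mat_sqrt_cov_mat(1) that by auto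
  have inner: "(\<Sum>k<d. ?B $$ (i, k) * ?B $$ (j, k)) = cov (Suc i) (Suc j)" if "i < d" "j < d" for i j
  proof -
    have "(\<Sum>k<d. ?B $$ (i, k) * ?B $$ (j, k)) = (?B * ?B) $$ (i, j)"
      using that B unfolding index_mult_mat_sum[OF mat_sqrt_cov_mat(1,1) that] by (intro sum.cong) auto
    then show ?thesis
      using that by (simp only: mat_sqrt_cov_mat(3) cov_mat_index)
  qed
  have cov0: "cov 0 m = - (\<Sum>i<d. cov (Suc i) m)" if "m \<le> d" for m
    using sum_cov[OF that] by (simp add: sum.atMost_shift)
  have right: "(\<Sum>k<d. ?B $$ (i, k) * root_row m k) = cov (Suc i) m" if "i < d" "m \<le> d" for i m
  proof (cases m)
    case 0
    have "(\<Sum>k<d. ?B $$ (i, k) * root_row 0 k) = - (\<Sum>k<d. \<Sum>j<d. ?B $$ (i, k) * ?B $$ (j, k))"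
      by (simp add: root_row_def sum_negf sum_distrib_left)
    also have "\<dots> = - (\<Sum>j<d. cov (Suc j) (Suc i))"
      by (subst sum.swap) (use that inner in \<open>simp add: cov_sym\<close>)
    also have "\<dots> = cov (Suc i) 0"
      using cov0[of "Suc i"] that by (simp add: cov_sym)
    finally show ?thesis
      by (simp add: 0)
  qed (use that inner in \<open>simp add: root_row_def\<close>)
  show ?thesis
  proof (cases l)
    case 0
    have "(\<Sum>k<d. root_row 0 k * root_row m k) = - (\<Sum>k<d. \<Sum>i<d. ?B $$ (i, k) * root_row m k)"
      by (simp add: root_row_def sum_negf sum_distrib_right)
    also have "\<dots> = - (\<Sum>i<d. cov (Suc i) m)"
      by (subst sum.swap) (use assms right in simp)
    finally show ?thesis
      using cov0[OF assms(2)] by (simp add: 0)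
  next
    case (Suc i)
    then show ?thesis
      using right[of i m] assms by (simp add: root_row_def)
  qed
qed

lemma W_fun_eq: "W_fun d n p = (\<lambda>x. - (\<Sum>l\<le>d. (real n * p l) * ln (affine_form d p root_row l x)))"
proof
  fix x
  define \<theta> where "\<theta> = (\<lambda>i. p_tail p i + (\<Sum>k<d. mat_sqrt cov_mat $$ (i, k) * x k))"
  have "affine_form d (\<lambda>l. if l = 0 then 1 else 0) coord_sign l \<theta> = affine_form d p root_row l x" if "l \<le> d" for l
  proof (cases l)
    case 0
    have "(\<Sum>k<d. \<theta> k) = (1 - p 0) + (\<Sum>k<d. \<Sum>i<d. mat_sqrt cov_mat $$ (i, k) * x k)"
      by (subst sum.swap) (simp add: \<theta>_def sum.distrib p_tail_def p_sum_tail)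
    then show ?thesis
      by (simp add: 0 affine_form_def sum_coord_sign root_row_def sum_negf sum_distrib_right)
  qed (use that in \<open>simp add: affine_form_def sum_coord_sign root_row_def \<theta>_def p_tail_def\<close>)
  then show "W_fun d n p x = - (\<Sum>l\<le>d. (real n * p l) * ln (affine_form d p root_row l x))"
    unfolding W_fun_def minv_H_V \<theta>_def[symmetric] unfolding V_fun_eq by simp
qed

definition third_mean_square :: real where
  "third_mean_square = (real n)\<^sup>2 / 9 *
     (\<Sum>l\<le>d. \<Sum>m\<le>d. (9 * cov l l * cov m m * cov l m + 6 * cov l m ^ 3) / ((p l)\<^sup>2 * (p m)\<^sup>2))"

text \<open>The Frobenius norm collects the 6 Isserlis pairings that match all three factors of z_l
  with those of z_m; the trace term collects the 9 pairings with a single cross pair.\<close>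

lemma eps3_eq: "eps3 d n p = sqrt third_mean_square"
proof -
  define T where "T = third_deriv (W_fun d n p) (\<lambda>_. 0)"
  define c where "c l = - 2 * real n / (p l)\<^sup>2" for l
  have T: "T i j k = (\<Sum>l\<le>d. c l * (root_row l i * root_row l j * root_row l k))"
    if "i < d" "j < d" "k < d" for i j k
  proof -
    have "T i j k = - 2 * (\<Sum>l\<le>d. real n * p l * root_row l i * root_row l j * root_row l k / p l ^ 3)"
      unfolding T_def W_fun_eq using that by (subst third_deriv_sum_ln) (auto simp: affine_form_def p_pos)
    then show ?thesis
      using p_nz by (auto simp: c_def sum_distrib_left power2_eq_square power3_eq_cube intro!: sum.cong)
  qed
  have frob: "(\<Sum>i<d. \<Sum>j<d. \<Sum>k<d. (T i j k)\<^sup>2) = (\<Sum>l\<le>d. \<Sum>m\<le>d. c l * c m * cov l m ^ 3)"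
  proof -
    have "(\<Sum>i<d. \<Sum>j<d. \<Sum>k<d. (T i j k)\<^sup>2) = (\<Sum>i<d. \<Sum>j<d. \<Sum>k<d. \<Sum>q\<in>{..d} \<times> {..d}. (c (fst q) * c (snd q)) *
        ((root_row (fst q) i * root_row (snd q) i) * (root_row (fst q) j * root_row (snd q) j) * (root_row (fst q) k * root_row (snd q) k)))"
      by (intro sum.cong refl)
        (simp add: T power2_eq_square sum_product sum.cartesian_product split_beta mult_ac)
    also have "\<dots> = (\<Sum>q\<in>{..d} \<times> {..d}. (c (fst q) * c (snd q)) * (cov (fst q) (snd q) * cov (fst q) (snd q) * cov (fst q) (snd q)))"
      unfolding sum_triple_product by (intro sum.cong refl) (auto simp: root_row_cov)
    also have "\<dots> = (\<Sum>l\<le>d. \<Sum>m\<le>d. c l * c m * cov l m ^ 3)"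
      by (simp add: sum.cartesian_product split_beta power3_eq_cube)
    finally show ?thesis .
  qed
  have contr: "(\<Sum>j<d. \<Sum>k<d. T i j k * 1\<^sub>m d $$ (j, k)) = (\<Sum>l\<le>d. c l * cov l l * root_row l i)" if "i < d" for i
  proof -
    have "(\<Sum>j<d. \<Sum>k<d. T i j k * 1\<^sub>m d $$ (j, k)) = (\<Sum>j<d. T i j j)"
      by (intro sum.cong refl) (auto simp: if_distrib[of "\<lambda>y. _ * y"] cong: if_cong)
    also have "\<dots> = (\<Sum>j<d. \<Sum>l\<le>d. c l * root_row l i * (root_row l j * root_row l j))"
      using that by (intro sum.cong) (auto simp: T mult.assoc)
    also have "\<dots> = (\<Sum>l\<le>d. c l * root_row l i * (\<Sum>j<d. root_row l j * root_row l j))"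
      by (subst sum.swap) (simp add: sum_distrib_left)
    also have "\<dots> = (\<Sum>l\<le>d. c l * cov l l * root_row l i)"
      by (intro sum.cong) (auto simp: root_row_cov)
    finally show ?thesis .
  qed
  have trace: "(\<Sum>i<d. (\<Sum>j<d. \<Sum>k<d. T i j k * 1\<^sub>m d $$ (j, k))\<^sup>2)
      = (\<Sum>l\<le>d. \<Sum>m\<le>d. c l * c m * (cov l l * cov m m * cov l m))"
  proof -
    have "(\<Sum>i<d. (\<Sum>j<d. \<Sum>k<d. T i j k * 1\<^sub>m d $$ (j, k))\<^sup>2)
        = (\<Sum>i<d. \<Sum>l\<le>d. \<Sum>m\<le>d. c l * c m * cov l l * cov m m * (root_row l i * root_row m i))"
    proof (intro sum.cong[OF refl])
      fix i assume "i \<in> {..<d}"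
      then have "(\<Sum>j<d. \<Sum>k<d. T i j k * 1\<^sub>m d $$ (j, k))\<^sup>2 = (\<Sum>l\<le>d. c l * cov l l * root_row l i)\<^sup>2"
        by (simp only: contr lessThan_iff)
      also have "\<dots> = (\<Sum>l\<le>d. \<Sum>m\<le>d. c l * c m * cov l l * cov m m * (root_row l i * root_row m i))"
        by (simp add: power2_eq_square sum_product mult_ac)
      finally show "(\<Sum>j<d. \<Sum>k<d. T i j k * 1\<^sub>m d $$ (j, k))\<^sup>2
          = (\<Sum>l\<le>d. \<Sum>m\<le>d. c l * c m * cov l l * cov m m * (root_row l i * root_row m i))" .
    qed
    also have "\<dots> = (\<Sum>l\<le>d. \<Sum>m\<le>d. \<Sum>i<d. c l * c m * cov l l * cov m m * (root_row l i * root_row m i))"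
      by (simp only: sum.swap[of _ "{..d}" "{..<d}"])
    also have "\<dots> = (\<Sum>l\<le>d. \<Sum>m\<le>d. c l * c m * (cov l l * cov m m * cov l m))"
      by (intro sum.cong refl) (simp add: sum_distrib_left[symmetric] root_row_cov)
    finally show ?thesis .
  qed
  \<comment> \<open>Each product of two coefficients \<open>c\<close> carries 4 n^2, and 4/6 = 6/9
    while 4/4 = 9/9.\<close>
  have "1 / 6 * (\<Sum>l\<le>d. \<Sum>m\<le>d. c l * c m * cov l m ^ 3) + 1 / 4 * (\<Sum>l\<le>d. \<Sum>m\<le>d. c l * c m * (cov l l * cov m m * cov l m))
      = third_mean_square"
    unfolding third_mean_square_def sum_distrib_left sum.distrib[symmetric] using p_nz
    by (intro sum.cong refl) (auto simp: c_def field_simps power2_eq_square)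
  then show ?thesis
    unfolding eps3_def T_def[symmetric] Let_def frob trace by simp
qed

text \<open>Off-diagonal covariances are negative, so their cubes may be dropped. The trace part is
  the variance of (1 - p_l) / p_l under the weights \<open>p\<close>, up to a power of
  \<open>n\<close>, and is at most the second moment. Together this gives (9 + 6) / 9 = 5/3, which
  is below 2.\<close>

lemma third_mean_square_le: "third_mean_square \<le> 2 / real n * (\<Sum>l\<le>d. 1 / p l)"
proof -
  let ?s = "\<Sum>l\<le>d. 1 / p l"
  have s: "0 \<le> ?s"
    using p_pos by (intro sum_nonneg) (auto intro: less_imp_le)
  have cube: "(\<Sum>l\<le>d. \<Sum>m\<le>d. cov l m ^ 3 / ((p l)\<^sup>2 * (p m)\<^sup>2)) \<le> ?s / real n ^ 3"
  proof -
    have "(\<Sum>l\<le>d. \<Sum>m\<le>d. cov l m ^ 3 / ((p l)\<^sup>2 * (p m)\<^sup>2)) \<le> (\<Sum>l\<le>d. \<Sum>m\<le>d. if m = l then 1 / p l / real n ^ 3 else 0)"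
    proof (intro sum_mono)
      fix l m assume "l \<in> {..d}" "m \<in> {..d}"
      then have lm: "0 < p l" "0 < p m" "p l \<le> 1"
        using p_pos p_le_1 by auto
      show "cov l m ^ 3 / ((p l)\<^sup>2 * (p m)\<^sup>2) \<le> (if m = l then 1 / p l / real n ^ 3 else 0)"
      proof (cases "m = l")
        case True
        have "cov l l ^ 3 / ((p l)\<^sup>2 * (p l)\<^sup>2) = (1 - p l) ^ 3 * (1 / p l / real n ^ 3)"
          using lm n_pos by (simp add: cov_def field_simps eval_nat_numeral)
        also have "\<dots> \<le> 1 * (1 / p l / real n ^ 3)"
          using lm by (intro mult_right_mono power_le_one) auto
        finally show ?thesis
          using True by simp
      next
        case False
        have "cov l m ^ 3 = - ((p l * p m / real n) ^ 3)"
          using False by (simp add: cov_def power3_eq_cube)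
        then show ?thesis
          using lm False by simp
      qed
    qed
    then show ?thesis
      by (simp add: sum_divide_distrib)
  qed
  define q where "q l = (1 - p l) / p l" for l
  have trace: "(\<Sum>l\<le>d. \<Sum>m\<le>d. cov l l * cov m m * cov l m / ((p l)\<^sup>2 * (p m)\<^sup>2)) \<le> ?s / real n ^ 3"
  proof -
    have "(\<Sum>l\<le>d. \<Sum>m\<le>d. cov l l * cov m m * cov l m / ((p l)\<^sup>2 * (p m)\<^sup>2))
        = (\<Sum>l\<le>d. \<Sum>m\<le>d. ((if m = l then p l * (q l)\<^sup>2 else 0) - (p l * q l) * (p m * q m)) / real n ^ 3)"
    proof (intro sum.cong refl)
      fix l m assume "l \<in> {..d}" "m \<in> {..d}"
      then have lm: "p l \<noteq> 0" "p m \<noteq> 0"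
        using p_nz by auto
      have "cov l l / (p l)\<^sup>2 = q l / real n" "cov m m / (p m)\<^sup>2 = q m / real n"
        using lm n_pos by (auto simp: cov_def q_def field_simps power2_eq_square)
      then have "cov l l * cov m m * cov l m / ((p l)\<^sup>2 * (p m)\<^sup>2) = (q l / real n) * (q m / real n) * cov l m"
        by (metis (no_types, lifting) times_divide_times_eq times_divide_eq_left)
      also have "\<dots> = ((if m = l then p l * (q l)\<^sup>2 else 0) - (p l * q l) * (p m * q m)) / real n ^ 3"
        by (simp add: cov_def power2_eq_square power3_eq_cube diff_divide_distrib algebra_simps)
      finally show "cov l l * cov m m * cov l m / ((p l)\<^sup>2 * (p m)\<^sup>2)
        = ((if m = l then p l * (q l)\<^sup>2 else 0) - (p l * q l) * (p m * q m)) / real n ^ 3" .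
    qed
    also have "\<dots> = ((\<Sum>l\<le>d. p l * (q l)\<^sup>2) - (\<Sum>l\<le>d. p l * q l)\<^sup>2) / real n ^ 3"
      by (simp add: sum_divide_distrib[symmetric] sum_subtractf sum_product power2_eq_square)
    also have "\<dots> \<le> (\<Sum>l\<le>d. p l * (q l)\<^sup>2) / real n ^ 3"
      by (intro divide_right_mono) auto
    also have "\<dots> \<le> ?s / real n ^ 3"
    proof (intro divide_right_mono sum_mono)
      fix l assume "l \<in> {..d}"
      then have l: "0 < p l" "p l \<le> 1"
        using p_pos p_le_1 by auto
      have "p l * (q l)\<^sup>2 = (1 - p l)\<^sup>2 * (1 / p l)"
        using l by (simp add: q_def field_simps power2_eq_square)
      also have "\<dots> \<le> 1 * (1 / p l)"
        using l by (intro mult_right_mono power_le_one) auto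
      finally show "p l * (q l)\<^sup>2 \<le> 1 / p l"
        by simp
    qed simp
    finally show ?thesis .
  qed
  have "third_mean_square = (real n)\<^sup>2 / 9 * (9 * (\<Sum>l\<le>d. \<Sum>m\<le>d. cov l l * cov m m * cov l m / ((p l)\<^sup>2 * (p m)\<^sup>2))
      + 6 * (\<Sum>l\<le>d. \<Sum>m\<le>d. cov l m ^ 3 / ((p l)\<^sup>2 * (p m)\<^sup>2)))"
    by (simp add: third_mean_square_def sum_distrib_left sum.distrib[symmetric] add_divide_distrib mult.assoc)
  also have "\<dots> \<le> (real n)\<^sup>2 / 9 * (9 * (?s / real n ^ 3) + 6 * (?s / real n ^ 3))"
    using cube trace by (intro mult_left_mono add_mono) auto
  also have "\<dots> = 5 / 3 / real n * ?s"
    using n_pos by (simp add: field_simps power2_eq_square power3_eq_cube)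
  also have "\<dots> \<le> 2 / real n * ?s"
    using s by (intro mult_right_mono divide_right_mono) auto
  finally show ?thesis .
qed

end

section \<open>The posterior density and its moments about the mode\<close>

locale multinomial_posterior = simplex_weights d n p for d n p +
  fixes N :: "nat \<Rightarrow> nat"
  assumes N_sum: "(\<Sum>l\<le>d. N l) = n" and N_eq: "\<And>l. l \<le> d \<Longrightarrow> real (N l) = real n * p l"
begin

definition f :: "(nat \<Rightarrow> real) \<Rightarrow> real" where
  "f \<theta> = simplex_monomial d N \<theta> / simplex_moment d N"

lemma f_nonneg: "0 \<le> f \<theta>"
  using simplex_monomial_nonneg[OF d_pos] simplex_moment_pos[OF d_pos, of N] by (simp add: f_def less_imp_le)

lemma f_integral: "integrable (lebesgue_d d) f" "(\<integral>\<theta>. f \<theta> \<partial>lebesgue_d d) = 1"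
  using integrable_simplex_monomial[OF d_pos, of N] simplex_moment_pos[OF d_pos, of N]
  by (auto simp: f_def[abs_def] simplex_moment_def)

lemma measurable_f [measurable]: "f \<in> borel_measurable (lebesgue_d d)"
  using f_integral(1) by auto

lemma post_density: "post d N = density (lebesgue_d d) (\<lambda>\<theta>. ennreal (f \<theta>))"
  unfolding post_eq_density[OF d_pos] f_def ..

sublocale post: prob_space "post d N"
  by standard (simp add: post_density emeasure_density nn_integral_eq_integral f_integral f_nonneg cong: nn_integral_cong)

lemma sets_post [measurable_cong, simp]: "sets (post d N) = sets (lebesgue_d d)"
  by (simp add: post_density)

lemma integral_post:
  fixes h :: "(nat \<Rightarrow> real) \<Rightarrow> real"
  assumes [measurable]: "h \<in> borel_measurable (lebesgue_d d)"
  shows "(\<integral>\<theta>. h \<theta> \<partial>post d N) = (\<integral>\<theta>. f \<theta> * h \<theta> \<partial>lebesgue_d d)"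
    "integrable (post d N) h \<longleftrightarrow> integrable (lebesgue_d d) (\<lambda>\<theta>. f \<theta> * h \<theta>)"
  unfolding post_density by (subst integral_density integrable_density; auto simp: f_nonneg)+

lemma z_eq: "l \<le> d \<Longrightarrow> z \<theta> l = sp d \<theta> l - p l"
  using p_sum_tail by (cases l) (auto simp: simplex_point_simps sum_subtractf)

lemma AE_post_Theta: "AE \<theta> in post d N. \<theta> \<in> Theta d"
  unfolding post_density
  by (subst AE_density, measurable) (auto simp: f_def simplex_monomial_def indicator_def)

lemma integrable_post_z_power:
  assumes "l \<le> d"
  shows "integrable (post d N) (\<lambda>\<theta>. z \<theta> l ^ k)"
proof (rule post.integrable_const_bound)
  show "AE \<theta> in post d N. norm (z \<theta> l ^ k) \<le> 1"
    using AE_post_Theta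
  proof eventually_elim
    case (elim \<theta>)
    then have "0 < sp d \<theta> l" "sp d \<theta> l \<le> 1"
      using assms d_pos by (auto simp: Theta_iff simplex_point_le_1)
    then have "\<bar>z \<theta> l\<bar> \<le> 1"
      using p_pos[OF assms] p_le_1[OF assms] by (simp add: z_eq[OF assms])
    then show ?case
      by (simp add: power_abs power_le_one)
  qed
qed (use assms in measurable)

lemma simplex_monomial_power:
  assumes "l \<le> d"
  shows "simplex_monomial d (N(l := N l + k)) \<theta> = sp d \<theta> l ^ k * simplex_monomial d N \<theta>"
proof (induction k)
  case (Suc k)
  have "N(l := N l + Suc k) = incr (N(l := N l + k)) l"
    by simp
  then have "simplex_monomial d (N(l := N l + Suc k)) \<theta> = sp d \<theta> l * simplex_monomial d (N(l := N l + k)) \<theta>"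
    using simplex_monomial_incr[OF assms, of "N(l := N l + k)" \<theta>] by (simp only:)
  then show ?case
    by (simp only: Suc power_Suc mult.assoc)
qed simp

lemma post_moment:
  assumes "l \<le> d"
  shows "(\<integral>\<theta>. sp d \<theta> l ^ k \<partial>post d N) = simplex_moment d (N(l := N l + k)) / simplex_moment d N"
proof -
  have "(\<integral>\<theta>. sp d \<theta> l ^ k \<partial>post d N) = (\<integral>\<theta>. simplex_monomial d (N(l := N l + k)) \<theta> / simplex_moment d N \<partial>lebesgue_d d)"
    using assms by (subst integral_post(1)) (auto simp: f_def simplex_monomial_power mult.commute)
  then show ?thesis
    by (simp add: simplex_moment_def)
qed

text \<open>Each coordinate is Beta distributed with parameters N_l + 1 and n + d - N_l. The
  recursion required by the locale is \<open>simplex_moment_incr\<close> with the l-th exponent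
  raised by \<open>k\<close>.\<close>

lemma beta_moments_coord:
  assumes l: "l \<le> d"
  shows "beta_moments (post d N) (\<lambda>\<theta>. sp d \<theta> l) (real (N l) + 1) (real (n + d + 1))"
proof
  show "(\<lambda>\<theta>. sp d \<theta> l) \<in> borel_measurable (post d N)"
    using l by measurable
  show "AE \<theta> in post d N. 0 \<le> sp d \<theta> l \<and> sp d \<theta> l \<le> 1"
    using AE_post_Theta by eventually_elim (use l d_pos in \<open>auto simp: Theta_iff simplex_point_le_1 less_imp_le\<close>)
  have "N l \<le> n"
    using member_le_sum[of l "{..d}" N] l N_sum by auto
  then show "real (N l) + 1 \<le> real (n + d + 1)"
    by simp
  fix k
  have "(\<Sum>j\<le>d. (N(l := N l + k)) j) = N l + k + (\<Sum>j\<in>{..d} - {l}. N j)"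
    using l by (subst sum.remove[of _ l]) auto
  then have "(\<Sum>j\<le>d. (N(l := N l + k)) j) = n + k"
    using N_sum l sum.remove[of "{..d}" l N] by simp
  moreover have "incr (N(l := N l + k)) l = N(l := N l + Suc k)"
    by simp
  ultimately have "real (n + k + d + 1) * simplex_moment d (N(l := N l + Suc k))
      = real (Suc (N l + k)) * simplex_moment d (N(l := N l + k))"
    using simplex_moment_incr[OF d_pos l, of "N(l := N l + k)"] by simp
  then show "(real (n + d + 1) + real k) * (\<integral>\<theta>. sp d \<theta> l ^ Suc k \<partial>post d N)
      = (real (N l) + 1 + real k) * (\<integral>\<theta>. sp d \<theta> l ^ k \<partial>post d N)"
    unfolding post_moment[OF l] times_divide_eq_right by (simp add: add_ac)
qed simp

text \<open>The deviation from p_l is the deviation from the posterior mean plus the bias e = (1 -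
  p_l (d + 1)) / T, and (d + 1)^2 <= n gives e^2 <= 4 p_l / n. The constants are 12 = 2 (2 + 4) and
  136448 = 32 (525 * 8 + 64).\<close>

lemma post_z_moments:
  assumes l: "l \<le> d" and small: "(real d + 1)\<^sup>2 \<le> real n"
  shows "(\<integral>\<theta>. (z \<theta> l)\<^sup>2 \<partial>post d N) \<le> 12 * (p l / real n)"
    "(\<integral>\<theta>. z \<theta> l ^ 6 \<partial>post d N) \<le> 136448 * (p l / real n) ^ 3"
proof -
  interpret B: beta_moments "post d N" "\<lambda>\<theta>. sp d \<theta> l" "real (N l) + 1" "real (n + d + 1)"
    by (rule beta_moments_coord[OF l])
  define T where "T = real (n + d + 1)"
  define r where "r = p l / real n"
  have n: "0 < real n" and pl: "0 < p l" "p l \<le> 1"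
    using n_pos p_pos p_le_1 l by auto
  have T: "real n \<le> T" "0 < T"
    by (auto simp: T_def)
  \<comment> \<open>Positivity of p_l makes the integer N_l at least 1; this absorbs the prior's
    extra count into a factor 2 and bounds 1 / n^2 by p_l / n.\<close>
  have "1 \<le> real (N l)"
    using N_eq[OF l] n pl by (metis mult_pos_pos of_nat_0_less_iff of_nat_1 of_nat_le_iff One_nat_def Suc_leI)
  then have np: "1 \<le> real n * p l"
    using N_eq[OF l] by simp
  have r: "0 \<le> r" "1 / (real n)\<^sup>2 \<le> r"
    using n pl np by (auto simp: r_def field_simps power2_eq_square)
  have m_eq: "B.m = (real n * p l + 1) / T"
    unfolding B.m_def T_def using N_eq[OF l] by simp
  have mT: "B.m / T \<le> 2 * r" "0 \<le> B.m / T"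
  proof -
    have "B.m / T \<le> (2 * (real n * p l)) / T / T"
      unfolding m_eq using np T by (intro divide_right_mono) auto
    also have "\<dots> \<le> (2 * (real n * p l)) / real n / real n"
      using n pl T by (intro frac_le divide_nonneg_nonneg) auto
    finally show "B.m / T \<le> 2 * r"
      using n by (simp add: r_def)
    show "0 \<le> B.m / T"
      using B.m_bounds T by simp
  qed
  define e where "e = B.m - p l"
  have e: "e\<^sup>2 \<le> 4 * r"
  proof -
    have "e = (1 - p l * (real d + 1)) / T"
      unfolding e_def m_eq using T(2) by (simp add: field_simps T_def)
    then have "e\<^sup>2 = (1 - p l * (real d + 1))\<^sup>2 / T\<^sup>2"
      by (simp add: power_divide)
    also have "\<dots> \<le> (2 + 2 * (p l * (real d + 1))\<^sup>2) / (real n)\<^sup>2"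
    proof (rule frac_le)
      have "0 \<le> (1 + p l * (real d + 1))\<^sup>2"
        by simp
      then show "(1 - p l * (real d + 1))\<^sup>2 \<le> 2 + 2 * (p l * (real d + 1))\<^sup>2"
        by (simp add: power2_sum power2_diff)
      show "(real n)\<^sup>2 \<le> T\<^sup>2"
        using T by (intro power_mono) auto
    qed (use n in auto)
    also have "\<dots> = 2 * (1 / (real n)\<^sup>2) + 2 * ((p l)\<^sup>2 * (real d + 1)\<^sup>2 / (real n)\<^sup>2)"
      by (simp add: add_divide_distrib power_mult_distrib)
    also have "(p l)\<^sup>2 * (real d + 1)\<^sup>2 / (real n)\<^sup>2 \<le> p l * real n / (real n)\<^sup>2"
      using pl small by (intro divide_right_mono mult_mono) (auto simp: power2_eq_square mult_le_one)
    also have "p l * real n / (real n)\<^sup>2 = r"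
      using n by (simp add: r_def power2_eq_square)
    finally show ?thesis
      using r by simp
  qed
  have e6: "e ^ 6 \<le> 64 * r ^ 3"
    using power_mono[OF e, of 3] by (simp add: power_mult[symmetric] power_mult_distrib)
  have z: "z \<theta> l = (sp d \<theta> l - B.m) + e" for \<theta>
    by (simp add: z_eq[OF l] e_def)
  have int: "integrable (post d N) (\<lambda>\<theta>. (sp d \<theta> l - B.m) ^ k)" for k
    using B.integrable_mono[of 0 k] by simp
  have sq: "(x + y)\<^sup>2 \<le> 2 * (x\<^sup>2 + y\<^sup>2)" for x y :: real
    using zero_le_power2[of "x - y"] by (simp add: power2_sum power2_diff)
  have six: "(x + y) ^ 6 \<le> 32 * (x ^ 6 + y ^ 6)" for x y :: real
  proof -
    have cube: "(a + b) ^ 3 \<le> 4 * (a ^ 3 + b ^ 3)" if "0 \<le> a" "0 \<le> b" for a b :: real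
    proof -
      have "0 \<le> 3 * ((a + b) * (a - b)\<^sup>2)"
        using that by simp
      also have "\<dots> = 4 * (a ^ 3 + b ^ 3) - (a + b) ^ 3"
        by (simp add: power2_eq_square power3_eq_cube algebra_simps)
      finally show ?thesis by simp
    qed
    have "(x + y) ^ 6 = ((x + y)\<^sup>2) ^ 3"
      by (simp add: power_mult[symmetric])
    also have "\<dots> \<le> (2 * (x\<^sup>2 + y\<^sup>2)) ^ 3"
      by (intro power_mono sq) auto
    also have "\<dots> \<le> 8 * (4 * ((x\<^sup>2) ^ 3 + (y\<^sup>2) ^ 3))"
      unfolding power_mult_distrib using cube[of "x\<^sup>2" "y\<^sup>2"] by simp
    finally show ?thesis
      by (simp add: power_mult[symmetric])
  qed
  have "(\<integral>\<theta>. (z \<theta> l)\<^sup>2 \<partial>post d N) \<le> (\<integral>\<theta>. 2 * ((sp d \<theta> l - B.m)\<^sup>2 + e\<^sup>2) \<partial>post d N)"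
    using int[of 2] integrable_post_z_power[OF l, of 2] sq unfolding z by (intro integral_mono) auto
  also have "\<dots> = 2 * ((\<integral>\<theta>. (sp d \<theta> l - B.m)\<^sup>2 \<partial>post d N) + e\<^sup>2)"
    using int[of 2] by (simp add: post.prob_space)
  also have "\<dots> \<le> 2 * (2 * r + 4 * r)"
    using B.central_moments(1) mT(1) e unfolding T_def by (intro mult_left_mono add_mono) auto
  finally show "(\<integral>\<theta>. (z \<theta> l)\<^sup>2 \<partial>post d N) \<le> 12 * (p l / real n)"
    by (simp add: r_def)
  have "(\<integral>\<theta>. z \<theta> l ^ 6 \<partial>post d N) \<le> (\<integral>\<theta>. 32 * ((sp d \<theta> l - B.m) ^ 6 + e ^ 6) \<partial>post d N)"
    using int[of 6] integrable_post_z_power[OF l, of 6] six unfolding z by (intro integral_mono) auto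
  also have "\<dots> = 32 * ((\<integral>\<theta>. (sp d \<theta> l - B.m) ^ 6 \<partial>post d N) + e ^ 6)"
    using int[of 6] by (simp add: post.prob_space)
  also have "\<dots> \<le> 32 * (525 * (2 * r) ^ 3 + 64 * r ^ 3)"
    using B.central_moments(2) power_mono[OF mT, of 3] e6 unfolding T_def
    by (intro mult_left_mono add_mono) auto
  finally show "(\<integral>\<theta>. z \<theta> l ^ 6 \<partial>post d N) \<le> 136448 * (p l / real n) ^ 3"
    by (simp add: r_def[symmetric] power_mult_distrib)
qed


section \<open>Density ratio, dominating functions and the total variation error\<close>

definition \<psi> :: "(nat \<Rightarrow> real) \<Rightarrow> real" where
  "\<psi> \<theta> = (\<Sum>l\<le>d. real n * p l * ln_remainder (z \<theta> l / p l))"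

definition bulk :: "(nat \<Rightarrow> real) set" where
  "bulk = {\<theta>. \<forall>l\<le>d. - 1 / 2 \<le> z \<theta> l / p l}"

text \<open>The Dirichlet integral divided by its own Laplace approximation, that is, by the
  integrand at the mode times the Gaussian integral.\<close>

definition "Z = simplex_moment d N / ((\<Prod>l\<le>d. p l ^ N l) * sqrt ((2 * pi / real n) ^ d * (\<Prod>l\<le>d. p l)))"

lemma Z_pos: "0 < Z"
proof -
  have "0 < (\<Prod>l\<le>d. p l ^ N l)" "0 < (\<Prod>l\<le>d. p l)"
    using p_pos by (auto intro!: prod_pos)
  then show ?thesis
    unfolding Z_def using n_pos simplex_moment_pos[OF d_pos, of N] by simp
qed

lemma density_ratio:
  assumes "\<theta> \<in> bulk"
  shows "Z * f \<theta> = exp (\<psi> \<theta>) * g \<theta>"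
proof -
  let ?u = "\<lambda>l. z \<theta> l / p l"
  let ?G = "sqrt ((2 * pi / real n) ^ d * (\<Prod>l\<le>d. p l))"
  have u: "0 < 1 + ?u l" if "l \<le> d" for l
    using assms that by (auto simp: bulk_def)
  have sp: "sp d \<theta> l = p l * (1 + ?u l)" if "l \<le> d" for l
    using p_nz[OF that] by (simp add: z_eq[OF that] field_simps)
  \<comment> \<open>The coordinates are p_l (1 + u_l) with u_l >= -1/2, so the bulk lies inside the
    simplex and the indicator in the Dirichlet density equals 1.\<close>
  have "\<theta> \<in> Theta d"
    using u sp p_pos by (simp add: Theta_iff[OF d_pos])
  then have "simplex_monomial d N \<theta> = (\<Prod>l\<le>d. p l ^ N l * (1 + ?u l) ^ N l)"
    using sp by (simp add: simplex_monomial_def power_mult_distrib)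
  also have "\<dots> = (\<Prod>l\<le>d. p l ^ N l) * (\<Prod>l\<le>d. exp (real (N l) * ln (1 + ?u l)))"
    using u by (simp add: prod.distrib exp_of_nat_mult)
  also have "(\<Prod>l\<le>d. exp (real (N l) * ln (1 + ?u l))) = exp (\<Sum>l\<le>d. real (N l) * ln (1 + ?u l))"
    by (simp add: exp_sum)
  also have "(\<Sum>l\<le>d. real (N l) * ln (1 + ?u l))
      = (\<Sum>l\<le>d. real n * z \<theta> l + - real n / 2 * ((z \<theta> l)\<^sup>2 / p l) + real n * p l * ln_remainder (?u l))"
    using p_nz by (intro sum.cong) (auto simp: N_eq ln_remainder_def field_simps power2_eq_square)
  \<comment> \<open>The linear terms n z_l add up to 0, which is criticality of the mode; the
    quadratic ones form the Gaussian exponent.\<close>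
  also have "\<dots> = - real n / 2 * (\<Sum>l\<le>d. (z \<theta> l)\<^sup>2 / p l) + \<psi> \<theta>"
    by (simp only: sum.distrib sum_distrib_left[symmetric] sum_full_dev \<psi>_def mult_zero_right add_0)
  finally have eq: "simplex_monomial d N \<theta>
      = (\<Prod>l\<le>d. p l ^ N l) * exp (- real n / 2 * (\<Sum>l\<le>d. (z \<theta> l)\<^sup>2 / p l) + \<psi> \<theta>)" .
  have K: "(\<Prod>l\<le>d. p l ^ N l) \<noteq> 0"
    using p_nz by simp
  have "simplex_monomial d N \<theta> / (\<Prod>l\<le>d. p l ^ N l) = exp (\<psi> \<theta>) * exp (- real n / 2 * (\<Sum>l\<le>d. (z \<theta> l)\<^sup>2 / p l))"
    unfolding eq nonzero_mult_div_cancel_left[OF K] exp_add by (rule mult.commute)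
  then have "simplex_monomial d N \<theta> / (\<Prod>l\<le>d. p l ^ N l) / ?G = exp (\<psi> \<theta>) * g \<theta>"
    by (simp add: gauss_density_def)
  then show ?thesis
    using simplex_moment_pos[OF d_pos, of N] by (simp add: Z_def f_def)
qed

text \<open>Applied with j = 2 i and e = i + 1 for i = 1, 2, 3: a moment of order (p_l / n)^i then
  leaves n^(-i) times the sum of 1 / p_l.\<close>

definition "dominator j e c \<theta> = c * (\<Sum>l\<le>d. z \<theta> l ^ j / p l ^ e)"

lemma dominator_nonneg: "even j \<Longrightarrow> 0 \<le> c \<Longrightarrow> 0 \<le> dominator j e c \<theta>"
  unfolding dominator_def using p_pos
  by (intro mult_nonneg_nonneg sum_nonneg divide_nonneg_nonneg zero_le_even_power zero_le_power) (auto intro: less_imp_le)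

text \<open>Cauchy-Schwarz over the d + 1 categories. This factor d + 1 is what raises the error
  from d / (n p_min) to d^2 / (n p_min). The constant 4/9 is the square of the 2/3 in the cubic
  bound for \<open>ln_remainder\<close>.\<close>

lemma square_sum_le:
  assumes "\<And>l. l \<le> d \<Longrightarrow> (a l)\<^sup>2 \<le> 4 / 9 * (real n)\<^sup>2 * (z \<theta> l ^ 6 / p l ^ 4)"
  shows "(\<Sum>l\<le>d. a l)\<^sup>2 \<le> dominator 6 4 (4 / 9 * (real d + 1) * (real n)\<^sup>2) \<theta>"
proof -
  have "(\<Sum>l\<le>d. a l)\<^sup>2 \<le> (\<Sum>l\<le>d. (a l)\<^sup>2) * real (card {..d})"
    by (rule sum_squared_le_sum_of_squares)
  also have "\<dots> \<le> (\<Sum>l\<le>d. 4 / 9 * (real n)\<^sup>2 * (z \<theta> l ^ 6 / p l ^ 4)) * real (card {..d})"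
    using assms by (intro mult_right_mono sum_mono) auto
  also have "\<dots> = dominator 6 4 (4 / 9 * (real d + 1) * (real n)\<^sup>2) \<theta>"
    by (simp only: dominator_def sum_distrib_left[symmetric] card_atMost of_nat_Suc) simp
  finally show ?thesis .
qed

lemma cubic_sq_le: "(cubic \<theta>)\<^sup>2 \<le> dominator 6 4 (4 / 9 * (real d + 1) * (real n)\<^sup>2) \<theta>"
  unfolding cubic_def sum_distrib_left
proof (rule square_sum_le)
  fix l
  have "(real n / 3 * (z \<theta> l ^ 3 / (p l)\<^sup>2))\<^sup>2 = 1 / 9 * (real n)\<^sup>2 * (z \<theta> l ^ 6 / p l ^ 4)"
    by (simp add: power_mult_distrib power_divide power_mult[symmetric])
  also have "\<dots> \<le> 4 / 9 * (real n)\<^sup>2 * (z \<theta> l ^ 6 / p l ^ 4)"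
    by (intro mult_right_mono) auto
  finally show "(real n / 3 * (z \<theta> l ^ 3 / (p l)\<^sup>2))\<^sup>2 \<le> 4 / 9 * (real n)\<^sup>2 * (z \<theta> l ^ 6 / p l ^ 4)" .
qed

lemma \<psi>_sq_le:
  assumes "\<theta> \<in> bulk"
  shows "(\<psi> \<theta>)\<^sup>2 \<le> dominator 6 4 (4 / 9 * (real d + 1) * (real n)\<^sup>2) \<theta>"
  unfolding \<psi>_def
proof (rule square_sum_le)
  fix l assume l: "l \<le> d"
  define u where "u = z \<theta> l / p l"
  have "\<bar>ln_remainder u\<bar> \<le> 2 / 3 * \<bar>u\<bar> ^ 3"
    using assms l by (intro abs_ln_remainder) (auto simp: bulk_def u_def)
  then have "\<bar>ln_remainder u\<bar>\<^sup>2 \<le> (2 / 3 * \<bar>u\<bar> ^ 3)\<^sup>2"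
    by (intro power_mono) auto
  then have "(ln_remainder u)\<^sup>2 \<le> 4 / 9 * u ^ 6"
    by (simp add: power_mult_distrib power_divide power_mult[symmetric])
  then have "(real n * p l)\<^sup>2 * (ln_remainder u)\<^sup>2 \<le> (real n * p l)\<^sup>2 * (4 / 9 * u ^ 6)"
    by (intro mult_left_mono) auto
  also have "\<dots> = 4 / 9 * (real n)\<^sup>2 * (z \<theta> l ^ 6 / p l ^ 4)"
    using p_nz[OF l] by (simp add: u_def power_divide power_mult_distrib field_simps eval_nat_numeral)
  finally show "(real n * p l * ln_remainder (z \<theta> l / p l))\<^sup>2 \<le> 4 / 9 * (real n)\<^sup>2 * (z \<theta> l ^ 6 / p l ^ 4)"
    by (simp add: u_def power_mult_distrib)
qed

lemma \<psi>_minus_cubic_le: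
  assumes "\<theta> \<in> bulk"
  shows "\<bar>\<psi> \<theta> - cubic \<theta>\<bar> \<le> dominator 4 3 (real n / 2) \<theta>"
proof -
  have cube: "real n / 3 * (z \<theta> l ^ 3 / (p l)\<^sup>2) = real n * p l * ((z \<theta> l / p l) ^ 3 / 3)" if "l \<le> d" for l
    using p_nz[OF that] by (simp add: power_divide power2_eq_square power3_eq_cube)
  have "\<psi> \<theta> - cubic \<theta> = (\<Sum>l\<le>d. real n * p l * ln_remainder (z \<theta> l / p l) - real n / 3 * (z \<theta> l ^ 3 / (p l)\<^sup>2))"
    by (simp only: \<psi>_def cubic_def sum_distrib_left sum_subtractf)
  also have "\<dots> = (\<Sum>l\<le>d. real n * p l * (ln_remainder (z \<theta> l / p l) - (z \<theta> l / p l) ^ 3 / 3))" (is "_ = ?sum")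
    by (intro sum.cong refl) (simp only: cube atMost_iff right_diff_distrib)
  finally have diff: "\<psi> \<theta> - cubic \<theta> = ?sum" .
  have "\<bar>?sum\<bar> \<le> (\<Sum>l\<le>d. real n / 2 * (z \<theta> l ^ 4 / p l ^ 3))"
  proof (rule order_trans[OF sum_abs], rule sum_mono)
    fix l assume "l \<in> {..d}"
    then have l: "l \<le> d" by simp
    define u where "u = z \<theta> l / p l"
    have "- 1 / 2 \<le> u"
      using assms l by (auto simp: bulk_def u_def)
    from ln_remainder_cubic[OF this] have "\<bar>ln_remainder u - u ^ 3 / 3\<bar> \<le> u ^ 4 / 2"
      by (simp add: abs_le_iff)
    then have "real n * p l * \<bar>ln_remainder u - u ^ 3 / 3\<bar> \<le> real n * p l * (u ^ 4 / 2)"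
      using p_pos[OF l] by (intro mult_left_mono) auto
    also have "\<dots> = real n / 2 * (p l * u ^ 4)"
      by simp
    also have "p l * u ^ 4 = z \<theta> l ^ 4 / p l ^ 3"
      using p_nz[OF l] by (simp add: u_def power_divide power4_eq_xxxx power3_eq_cube)
    finally show "\<bar>real n * p l * (ln_remainder (z \<theta> l / p l) - (z \<theta> l / p l) ^ 3 / 3)\<bar> \<le> real n / 2 * (z \<theta> l ^ 4 / p l ^ 3)"
      using p_pos[OF l] by (simp add: abs_mult u_def)
  qed
  then show ?thesis
    unfolding diff by (simp only: dominator_def sum_distrib_left)
qed

lemma outside_bulk:
  assumes "\<theta> \<notin> bulk"
  shows "1 \<le> dominator 2 2 4 \<theta>"
proof -
  obtain l where l: "l \<le> d" "z \<theta> l / p l < - 1 / 2"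
    using assms by (auto simp: bulk_def not_le)
  have "(1 / 2)\<^sup>2 \<le> (- (z \<theta> l / p l))\<^sup>2"
    using l(2) by (intro power_mono) linarith+
  then have "1 \<le> 4 * ((z \<theta> l)\<^sup>2 / (p l)\<^sup>2)"
    by (simp add: power_divide mult.commute)
  also have "\<dots> \<le> dominator 2 2 4 \<theta>"
    unfolding dominator_def using l by (intro mult_left_mono member_le_sum) auto
  finally show ?thesis .
qed

lemma integral_dominator:
  fixes w :: "(nat \<Rightarrow> real) \<Rightarrow> real"
  assumes int: "\<And>l. l \<le> d \<Longrightarrow> integrable (lebesgue_d d) (\<lambda>\<theta>. w \<theta> * z \<theta> l ^ j)"
    and le: "\<And>l. l \<le> d \<Longrightarrow> (\<integral>\<theta>. w \<theta> * z \<theta> l ^ j \<partial>lebesgue_d d) \<le> C * (p l / real n) ^ i" and "0 \<le> c"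
  shows "integrable (lebesgue_d d) (\<lambda>\<theta>. w \<theta> * dominator j (Suc i) c \<theta>)"
    "(\<integral>\<theta>. w \<theta> * dominator j (Suc i) c \<theta> \<partial>lebesgue_d d) \<le> c * C / real n ^ i * (\<Sum>l\<le>d. 1 / p l)"
proof -
  have eq: "w \<theta> * dominator j (Suc i) c \<theta> = (\<Sum>l\<le>d. c / p l ^ Suc i * (w \<theta> * z \<theta> l ^ j))" for \<theta>
    by (simp add: dominator_def sum_distrib_left mult_ac)
  show "integrable (lebesgue_d d) (\<lambda>\<theta>. w \<theta> * dominator j (Suc i) c \<theta>)"
    unfolding eq by (intro Bochner_Integration.integrable_sum integrable_mult_right int) auto
  have "(\<integral>\<theta>. w \<theta> * dominator j (Suc i) c \<theta> \<partial>lebesgue_d d) = (\<Sum>l\<le>d. c / p l ^ Suc i * (\<integral>\<theta>. w \<theta> * z \<theta> l ^ j \<partial>lebesgue_d d))"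
    unfolding eq using int by (subst Bochner_Integration.integral_sum) (auto intro!: integrable_mult_right)
  also have "\<dots> \<le> (\<Sum>l\<le>d. c / p l ^ Suc i * (C * (p l / real n) ^ i))"
    using le p_pos \<open>0 \<le> c\<close> by (intro sum_mono mult_left_mono divide_nonneg_nonneg zero_le_power) (auto intro: less_imp_le)
  also have "\<dots> = c * C / real n ^ i * (\<Sum>l\<le>d. 1 / p l)"
    unfolding sum_distrib_left using p_nz by (intro sum.cong) (auto simp: power_divide field_simps)
  finally show "(\<integral>\<theta>. w \<theta> * dominator j (Suc i) c \<theta> \<partial>lebesgue_d d) \<le> c * C / real n ^ i * (\<Sum>l\<le>d. 1 / p l)" .
qed

lemma gauss_dominator:
  assumes "0 \<le> c"
  shows "integrable (lebesgue_d d) (\<lambda>\<theta>. g \<theta> * dominator (2 * i) (Suc i) c \<theta>)"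
    "(\<integral>\<theta>. g \<theta> * dominator (2 * i) (Suc i) c \<theta> \<partial>lebesgue_d d)
      \<le> c * (fact (2 * i) / (2 ^ i * fact i)) / real n ^ i * (\<Sum>l\<le>d. 1 / p l)"
proof -
  have mom: "integrable (lebesgue_d d) (\<lambda>\<theta>. g \<theta> * z \<theta> l ^ (2 * i)) \<and>
      (\<integral>\<theta>. g \<theta> * z \<theta> l ^ (2 * i) \<partial>lebesgue_d d) \<le> fact (2 * i) / (2 ^ i * fact i) * (p l / real n) ^ i" if l: "l \<le> d" for l
  proof -
    have m: "(\<lambda>\<theta>. z \<theta> l ^ (2 * i)) \<in> borel_measurable (lebesgue_d d)"
      using l by measurable
    have "0 \<le> cov l l" "cov l l \<le> p l / real n"
      using p_pos[OF l] p_le_1[OF l] by (auto simp: cov_def divide_right_mono mult_left_le)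
    then have "cov l l ^ i \<le> (p l / real n) ^ i"
      by (intro power_mono) auto
    then have "fact (2 * i) / (2 ^ i * fact i) * cov l l ^ i \<le> fact (2 * i) / (2 ^ i * fact i) * (p l / real n) ^ i"
      by (intro mult_left_mono) auto
    then show ?thesis
      using gauss_even_moment_coord[OF l, of i]
      unfolding has_bochner_integral_iff integral_gauss_measure[OF m] by simp
  qed
  show "integrable (lebesgue_d d) (\<lambda>\<theta>. g \<theta> * dominator (2 * i) (Suc i) c \<theta>)"
    "(\<integral>\<theta>. g \<theta> * dominator (2 * i) (Suc i) c \<theta> \<partial>lebesgue_d d)
      \<le> c * (fact (2 * i) / (2 ^ i * fact i)) / real n ^ i * (\<Sum>l\<le>d. 1 / p l)"
    by (rule integral_dominator; use mom assms in blast)+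
qed

lemma total_variation_error:
  assumes small: "(real d + 1)\<^sup>2 \<le> real n"
    and \<kappa>: "\<kappa> = 61000 * ((real d + 1) / real n * (\<Sum>l\<le>d. 1 / p l))" "\<kappa> \<le> 1 / 4"
  shows "\<bar>tv_dist (post d N) (laplace_approx d n p) - L_TV d n p\<bar> \<le> 12 * \<kappa>"
proof -
  define s where "s = (\<Sum>l\<le>d. 1 / p l)"
  define c6 where "c6 = 4 / 9 * (real d + 1) * (real n)\<^sup>2"
  have c6: "0 \<le> c6"
    by (simp add: c6_def)
  have s: "0 \<le> s"
    unfolding s_def using p_pos by (intro sum_nonneg) (auto intro: less_imp_le)
  have n: "0 < real n"
    using n_pos by simp
  define a b where "a = 1 / real n * s" and "b = (real d + 1) / real n * s"
  have c6_s: "c6 * K / real n ^ 3 * s = 4 / 9 * K * b" for K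
    using n by (simp add: c6_def b_def field_simps power2_eq_square power3_eq_cube)
  have "0 \<le> a" "0 \<le> b" "a \<le> b"
    unfolding a_def b_def using s by (intro mult_right_mono divide_right_mono mult_nonneg_nonneg divide_nonneg_nonneg; simp)+
  moreover have "\<kappa> = 61000 * b"
    by (simp add: \<kappa> s_def b_def)
  \<comment> \<open>The largest of the five bounds is the sixth-moment one under the posterior; 4/9
    * 136448 is about 60644, which explains 61000.\<close>
  ultimately have le_\<kappa>: "x \<le> 48 * a \<or> x \<le> 4 / 9 * 136448 * b \<Longrightarrow> x \<le> \<kappa>" for x
    by auto
  have fact_simps: "fact (2 * 1) / (2 ^ 1 * fact 1) = (1 :: real)" "fact (2 * 2) / (2 ^ 2 * fact 2) = (3 :: real)"
    "fact (2 * 3) / (2 ^ 3 * fact 3) = (15 :: real)"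
    by (simp_all add: fact_numeral)
  have G2: "integrable (lebesgue_d d) (\<lambda>\<theta>. g \<theta> * dominator 2 2 4 \<theta>)"
    "(\<integral>\<theta>. g \<theta> * dominator 2 2 4 \<theta> \<partial>lebesgue_d d) \<le> 4 * a"
    using gauss_dominator[of 4 1, unfolded fact_simps, folded s_def] by (simp_all add: numeral_2_eq_2 a_def)
  have G4: "integrable (lebesgue_d d) (\<lambda>\<theta>. g \<theta> * dominator 4 3 (real n / 2) \<theta>)"
    "(\<integral>\<theta>. g \<theta> * dominator 4 3 (real n / 2) \<theta> \<partial>lebesgue_d d) \<le> 3 / 2 * a"
    using gauss_dominator[of "real n / 2" 2, unfolded fact_simps, folded s_def] n
    by (simp_all add: a_def power2_eq_square)
  have G6: "integrable (lebesgue_d d) (\<lambda>\<theta>. g \<theta> * dominator 6 4 c6 \<theta>)"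
    "(\<integral>\<theta>. g \<theta> * dominator 6 4 c6 \<theta> \<partial>lebesgue_d d) \<le> 4 / 9 * 15 * b"
    using gauss_dominator[of c6 3, unfolded fact_simps, folded s_def, OF c6, unfolded c6_s] by simp_all
  have P: "integrable (lebesgue_d d) (\<lambda>\<theta>. f \<theta> * z \<theta> l ^ k)"
    "(\<integral>\<theta>. f \<theta> * z \<theta> l ^ k \<partial>lebesgue_d d) = (\<integral>\<theta>. z \<theta> l ^ k \<partial>post d N)" if "l \<le> d" for l k
    using integrable_post_z_power[OF that, of k] integral_post[of "\<lambda>\<theta>. z \<theta> l ^ k"] that by auto
  have P2: "integrable (lebesgue_d d) (\<lambda>\<theta>. f \<theta> * dominator 2 2 4 \<theta>)"
    "(\<integral>\<theta>. f \<theta> * dominator 2 2 4 \<theta> \<partial>lebesgue_d d) \<le> 48 * a"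
    using integral_dominator[of f 2 12 1 4] P post_z_moments(1)[OF _ small]
    by (simp_all add: s_def[symmetric] a_def del: One_nat_def)
  have P6: "integrable (lebesgue_d d) (\<lambda>\<theta>. f \<theta> * dominator 6 4 c6 \<theta>)"
    "(\<integral>\<theta>. f \<theta> * dominator 6 4 c6 \<theta> \<partial>lebesgue_d d) \<le> 4 / 9 * 136448 * b"
    using integral_dominator[of f 6 136448 3 c6, folded s_def, unfolded c6_s] P post_z_moments(2)[OF _ small] c6
    by simp_all
  have S: "integrable (lebesgue_d d) (\<lambda>\<theta>. g \<theta> * cubic \<theta>)" "(\<integral>\<theta>. g \<theta> * cubic \<theta> \<partial>lebesgue_d d) = 0"
    using cubic_mean integral_gauss_measure[OF measurable_cubic] by auto
  have g: "integrable (lebesgue_d d) g" "(\<integral>\<theta>. g \<theta> \<partial>lebesgue_d d) = 1"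
    using integral_gauss_measure[of "\<lambda>_. 1"] gauss.prob_space by auto
  have err: "\<bar>(\<integral>\<theta>. \<bar>f \<theta> - g \<theta>\<bar> \<partial>lebesgue_d d) - (\<integral>\<theta>. g \<theta> * \<bar>cubic \<theta>\<bar> \<partial>lebesgue_d d)\<bar> \<le> 24 * \<kappa>"
  proof (rule first_order_error[where A = bulk and \<psi> = \<psi> and Z = Z and ?B2.0 = "dominator 2 2 4"
        and ?B4.0 = "dominator 4 3 (real n / 2)" and ?B6.0 = "dominator 6 4 c6"])
    show "(\<integral>\<theta>. g \<theta> * dominator 2 2 4 \<theta> \<partial>lebesgue_d d) \<le> \<kappa>"
      "(\<integral>\<theta>. g \<theta> * dominator 4 3 (real n / 2) \<theta> \<partial>lebesgue_d d) \<le> \<kappa>"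
      "(\<integral>\<theta>. g \<theta> * dominator 6 4 c6 \<theta> \<partial>lebesgue_d d) \<le> \<kappa>"
      "(\<integral>\<theta>. f \<theta> * dominator 2 2 4 \<theta> \<partial>lebesgue_d d) \<le> \<kappa>"
      "(\<integral>\<theta>. f \<theta> * dominator 6 4 c6 \<theta> \<partial>lebesgue_d d) \<le> \<kappa>"
      using G2(2) G4(2) G6(2) P2(2) P6(2) \<open>0 \<le> a\<close> \<open>0 \<le> b\<close> by (intro le_\<kappa>; linarith)+
    show "1 \<le> dominator 2 2 4 \<theta>" if "\<theta> \<notin> bulk" for \<theta>
      using that by (rule outside_bulk)
    show "\<bar>\<psi> \<theta> - cubic \<theta>\<bar> \<le> dominator 4 3 (real n / 2) \<theta>" if "\<theta> \<in> bulk" for \<theta>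
      using that by (rule \<psi>_minus_cubic_le)
    show "Z * f \<theta> = exp (\<psi> \<theta>) * g \<theta>" if "\<theta> \<in> bulk" for \<theta>
      using that by (rule density_ratio)
    show "0 \<le> dominator 2 2 4 \<theta>" "0 \<le> dominator 4 3 (real n / 2) \<theta>" "0 \<le> dominator 6 4 c6 \<theta>" for \<theta>
      using c6 by (auto intro!: dominator_nonneg)
    show "(cubic \<theta>)\<^sup>2 \<le> dominator 6 4 c6 \<theta>" for \<theta>
      unfolding c6_def by (rule cubic_sq_le)
    show "(\<psi> \<theta>)\<^sup>2 \<le> dominator 6 4 c6 \<theta>" if "\<theta> \<in> bulk" for \<theta>
      unfolding c6_def using that by (rule \<psi>_sq_le)
  qed (use f_integral f_nonneg g g_nonneg Z_pos \<kappa> S G2 G4 G6 P2 P6 in auto)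
  have "tv_dist (post d N) (laplace_approx d n p) = (\<integral>\<theta>. \<bar>f \<theta> - g \<theta>\<bar> \<partial>lebesgue_d d) / 2"
    unfolding post_density laplace_approx_eq gauss_measure_def
    using f_integral f_nonneg g g_nonneg by (intro tv_dist_density) auto
  moreover have "L_TV d n p = (\<integral>\<theta>. g \<theta> * \<bar>cubic \<theta>\<bar> \<partial>lebesgue_d d) / 2"
    unfolding L_TV_def S_fun_eq laplace_approx_eq by (subst integral_gauss_measure(1)) auto
  ultimately show ?thesis
    using err by (simp add: diff_divide_distrib[symmetric])
qed

end

section \<open>The leading term and the final constants\<close>

context simplex_weights
begin

lemma L_TV_eq: "L_TV d n p = (\<integral>\<theta>. \<bar>cubic \<theta>\<bar> \<partial>gauss_measure) / 2"
  by (simp add: L_TV_def S_fun_eq laplace_approx_eq)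

lemma L_TV_nonneg: "0 \<le> L_TV d n p"
  unfolding L_TV_eq by (simp add: Bochner_Integration.integral_nonneg)

text \<open>The first absolute moment of the cubic is at most its root mean square, expressed as
  nonnegativity of the variance of its absolute value.\<close>

lemma L_TV_le_eps3: "L_TV d n p \<le> eps3 d n p"
proof -
  have "integrable gauss_measure (\<lambda>\<theta>. (cubic \<theta>)\<^sup>2)" and sq: "(\<integral>\<theta>. (cubic \<theta>)\<^sup>2 \<partial>gauss_measure) = third_mean_square"
    using cubic_square by (auto simp: has_bochner_integral_iff third_mean_square_def)
  then have "gauss.variance (\<lambda>\<theta>. \<bar>cubic \<theta>\<bar>) = third_mean_square - (\<integral>\<theta>. \<bar>cubic \<theta>\<bar> \<partial>gauss_measure)\<^sup>2"
    using cubic_mean(1) by (subst gauss.variance_eq) auto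
  then have "(\<integral>\<theta>. \<bar>cubic \<theta>\<bar> \<partial>gauss_measure)\<^sup>2 \<le> third_mean_square"
    using gauss.variance_positive[of "\<lambda>\<theta>. \<bar>cubic \<theta>\<bar>"] by simp
  then have "(\<integral>\<theta>. \<bar>cubic \<theta>\<bar> \<partial>gauss_measure) \<le> eps3 d n p"
    unfolding eps3_eq by (rule real_le_rsqrt)
  moreover have "0 \<le> (\<integral>\<theta>. \<bar>cubic \<theta>\<bar> \<partial>gauss_measure)"
    by (simp add: Bochner_Integration.integral_nonneg)
  ultimately show ?thesis
    unfolding L_TV_eq by linarith
qed

lemma eps3_le: "eps3 d n p \<le> sqrt (2 / real n * (\<Sum>l\<le>d. 1 / p l))"
  unfolding eps3_eq using third_mean_square_le by (rule real_sqrt_le_mono)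

end

theorem proposition4p5:
  shows "\<exists>c C C' :: real. c > 0 \<and> C > 0 \<and> C' > 0 \<and>
    (\<forall>(d::nat) (n::nat) (N :: nat \<Rightarrow> nat) (p :: nat \<Rightarrow> real) (pmin :: real).
      d \<ge> 1 \<and> (\<Sum>j\<le>d. N j) = n \<and> p = (\<lambda>j. real (N j) / real n) \<and> pmin = Min (p ` {..d}) \<and>
      pmin > 0 \<and> (real d)\<^sup>2 / (real n * pmin) < c \<longrightarrow>
      0 \<le> L_TV d n p \<and>
      L_TV d n p \<le> eps3 d n p \<and>
      eps3 d n p \<le> sqrt (2 / real n * (\<Sum>j\<le>d. 1 / p j)) \<and>
      sqrt (2 / real n * (\<Sum>j\<le>d. 1 / p j)) \<le> 2 * sqrt (real d / (real n * pmin)) \<and>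
      \<bar>tv_dist (post d N) (laplace_approx d n p) - L_TV d n p\<bar>
        \<le> C' * ((real d)\<^sup>2 / (real n * pmin)
             + real d * exp (- C * sqrt (real d) * (real n * pmin) powr (1 / 4))))"
proof (rule exI[of _ "1 / 1000000"], rule exI[of _ 1], rule exI[of _ 3000000], intro conjI allI impI)
  \<comment> \<open>With x = d^2 / (n p_min) the parameter of the error lemma is at most 244000 x,
    which is below 1/4 once x < 10^(-6); and 12 * 244000 is below 3000000. The exponential term
    enters only as a nonnegative summand on the right, so C = 1 serves.\<close>
  fix d n :: nat and N :: "nat \<Rightarrow> nat" and p :: "nat \<Rightarrow> real" and pmin :: real
  assume H: "d \<ge> 1 \<and> (\<Sum>j\<le>d. N j) = n \<and> p = (\<lambda>j. real (N j) / real n) \<and> pmin = Min (p ` {..d}) \<and>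
      pmin > 0 \<and> (real d)\<^sup>2 / (real n * pmin) < 1 / 1000000"
  then have d: "1 \<le> d" and N: "(\<Sum>j\<le>d. N j) = n" and p: "p = (\<lambda>j. real (N j) / real n)"
    and pmin: "0 < pmin" and small: "(real d)\<^sup>2 / (real n * pmin) < 1 / 1000000"
    by auto
  have pmin_le: "pmin \<le> p l" if "l \<le> d" for l
  proof -
    have "pmin = Min (p ` {..d})"
      using H by blast
    then show ?thesis
      using that by simp
  qed
  \<comment> \<open>For n = 0 all p_l would be 0, because division by zero yields 0, against the
    positivity of \<open>pmin\<close>.\<close>
  have n: "0 < n"
    using pmin pmin_le[of 0] by (cases "n = 0") (auto simp: p)
  interpret multinomial_posterior d n p N
  proof
    show "0 < p l" if "l \<le> d" for l
      using pmin_le[OF that] pmin by simp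
    show "(\<Sum>l\<le>d. p l) = 1"
      using N n by (simp add: p sum_divide_distrib[symmetric] flip: of_nat_sum)
  qed (use d n N in \<open>auto simp: p\<close>)
  define x where "x = (real d)\<^sup>2 / (real n * pmin)"
  let ?s = "\<Sum>l\<le>d. 1 / p l"
  have s: "?s \<le> 2 * real d / pmin"
  proof -
    have "?s \<le> (\<Sum>l\<le>d. 1 / pmin)"
      using pmin pmin_le by (intro sum_mono divide_left_mono mult_pos_pos) (auto intro: p_pos)
    also have "\<dots> = (real d + 1) * (1 / pmin)"
      by simp
    also have "\<dots> \<le> (2 * real d) * (1 / pmin)"
      using d pmin by (intro mult_right_mono) auto
    finally show ?thesis
      by simp
  qed
  show "0 \<le> L_TV d n p" "L_TV d n p \<le> eps3 d n p" "eps3 d n p \<le> sqrt (2 / real n * ?s)"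
    by (fact L_TV_nonneg L_TV_le_eps3 eps3_le)+
  have sqrt4: "sqrt (2\<^sup>2 * y) = 2 * sqrt y" for y
    by (simp add: real_sqrt_mult)
  have "2 / real n * ?s \<le> 2 / real n * (2 * real d / pmin)"
    using s by (intro mult_left_mono) auto
  also have "\<dots> = 2\<^sup>2 * (real d / (real n * pmin))"
    by simp
  finally have "sqrt (2 / real n * ?s) \<le> sqrt (2\<^sup>2 * (real d / (real n * pmin)))"
    by (rule real_sqrt_le_mono)
  then show "sqrt (2 / real n * ?s) \<le> 2 * sqrt (real d / (real n * pmin))"
    by (simp only: sqrt4)
  have "(real d + 1) / real n * ?s \<le> (2 * real d) / real n * (2 * real d / pmin)"
    using s d p_pos by (intro mult_mono divide_right_mono sum_nonneg) (auto intro: less_imp_le)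
  also have "\<dots> = 4 * x"
    by (simp add: x_def power2_eq_square)
  finally have err: "61000 * ((real d + 1) / real n * ?s) \<le> 244000 * x"
    by simp
  have "(real d + 1)\<^sup>2 \<le> (2 * real d)\<^sup>2"
    using d by (intro power_mono) auto
  also have "\<dots> = 4 * x * (real n * pmin)"
    using n pmin by (simp add: x_def power_mult_distrib)
  also have "\<dots> \<le> 1 * (real n * 1)"
  proof (intro mult_mono)
    show "pmin \<le> 1"
      using pmin_le[of 0] p_le_1[of 0] by simp
    show "4 * x \<le> 1"
      using small[folded x_def] by simp
  qed (use pmin in auto)
  finally have dn: "(real d + 1)\<^sup>2 \<le> real n"
    by simp
  have "\<bar>tv_dist (post d N) (laplace_approx d n p) - L_TV d n p\<bar> \<le> 12 * (61000 * ((real d + 1) / real n * ?s))"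
    using err small[folded x_def] by (intro total_variation_error[OF dn refl]) simp
  also have "\<dots> \<le> 12 * (244000 * x)"
    using err by simp
  also have "\<dots> \<le> 3000000 * (x + real d * exp (- 1 * sqrt (real d) * (real n * pmin) powr (1 / 4)))"
  proof -
    have "0 \<le> x" "0 \<le> real d * exp (- 1 * sqrt (real d) * (real n * pmin) powr (1 / 4))"
      using pmin by (auto simp: x_def)
    then show ?thesis
      by (simp add: distrib_left)
  qed
  finally show "\<bar>tv_dist (post d N) (laplace_approx d n p) - L_TV d n p\<bar>
    \<le> 3000000 * ((real d)\<^sup>2 / (real n * pmin) + real d * exp (- 1 * sqrt (real d) * (real n * pmin) powr (1 / 4)))"
    unfolding x_def .
qed auto

end
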